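(* Let $q\in GL_n(A)$ be split and let $(\varphi^{SO}_{pp'})$ be the special orthogonal curvature of the Chern connection attached to $q$. 1) If $n\geq 6$, then $\varphi^{SO}_{pp'}\neq 0$ for all $p\neq p'$ in $\mathcal V$. 2) If $n=2$, then $\varphi^{SO}_{pp'}=0$ for all $p,p'\in\mathcal V$.
   Context: Let $M$ be an even positive integer, $N\geq 1$, $\zeta_N$ a primitive $N$-th root of unity, and $A=\mathbb{Z}[1/M,\zeta_N]$. Let $\mathcal V$ be a (possibly infinite) set of rational primes not dividing $MN$. For a ring $B$, $B^{\widehat{p}}$ denotes its $p$-adic completion. For $p\in\mathcal V$ there is a unique ring endomorphism $\phi_p$ of $A$ lifting the $p$-power Frobenius of $A/pA$; it extends to $A^{\widehat p}$. A $p$-derivation on a $p$-torsion free ring $B$ is a map $\delta_p:B\to B$ such that $\phi_p(b):=b^p+p\delta_p(b)$ is a ring homomorphism (its Frobenius lift). Let $G=GL_n$ over $A$, $\mathcal O(G)=A[x,\det(x)^{-1}]$ with $x$ an $n\times n$ matrix of indeterminates; $u^t$ denotes transpose and $u^{(p)}$ the entrywise $p$-th power of a matrix $u$. An adelic connection is a family $(\delta_p)_{p\in\mathcal V}$ of $p$-derivations on $\mathcal O(G)^{\widehat p}$. Let $T=x-1$. It is global along $1$ if each Frobenius lift $\phi_p$ maps the ideal generated by the entries of $T$ into itself (inducing an endomorphism of $A^{\widehat p}[[T]]$) and maps $A[[T]]$ into $A[[T]]$; its curvature is $\varphi_{pp'}:=\frac{1}{pp'}(\phi_p\phi_{p'}-\phi_{p'}\phi_p)$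 on $A[[T]]$. For $q\in GL_n(A)$ with $q^t=\pm q$, the Chern connection attached to $q$ has Frobenius lifts $\phi_p$ extending $\phi_p$ on $A^{\widehat p}$ with $\phi_p(x)=x^{(p)}\{(x^{(p)t}\phi_p(q)x^{(p)})^{-1}(x^tqx)^{(p)}\}^{1/2}$ (square root via the binomial series $(1+u)^{1/2}=1+\sum_{i\ge1}\binom{1/2}{i}u^i$). For split $q$ this connection is global along $1$ and, with $J$ the ideal of $A[[T]]$ generated by the entries of $x^tqx-q$, each $\phi_p$ maps $J$ into $J$; the special orthogonal curvature $\varphi^{SO}_{pp'}$ is the $\mathbb{Z}$-module endomorphism of $A[[T]]/J$ induced by $\varphi_{pp'}$. A matrix $q$ is split if it is one of $\begin{pmatrix}0&1_r\\-1_r&0\end{pmatrix}$, $\begin{pmatrix}0&1_r\\1_r&0\end{pmatrix}$ (with $n=2r$), or $\begin{pmatrix}1&0&0\\0&0&1_r\\0&1_r&0\end{pmatrix}$ (with $n=2r+1$), $1_r$ the $r\times r$ identity. *)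

theory Defs
  imports
    "HOL-Library.Multiset"
    "HOL-Computational_Algebra.Primes"
    "HOL-Algebra.QuotRing"
    "HOL-Algebra.Generated_Rings"
    "Jordan_Normal_Form.Determinant"
    "Jordan_Normal_Form.VS_Connect"
begin

section \<open>Multivariate formal power series\<close>

text \<open>
  A power series in variables indexed by \<open>'i\<close> is its family of coefficients; the monomial
  with exponent vector \<open>e\<close> is the multiset in which \<open>i\<close> occurs \<open>e i\<close> times, so the total degree
  of \<open>m\<close> is \<open>size m\<close>.
\<close>

typedef ('i, 'a) mps = "UNIV :: ('i multiset \<Rightarrow> 'a) set"
  morphisms mps_nth Abs_mps ..

lemma mps_nth_Abs [simp]: "mps_nth (Abs_mps f) = f"
  by (simp add: Abs_mps_inverse)

lemma mps_eqI: "(\<And>m. mps_nth f m = mps_nth g m) \<Longrightarrow> f = g"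
  by (metis ext mps_nth_inject)

lemma finite_submultisets [simp]: "finite {a. a \<subseteq># (m :: 'i multiset)}"
proof (induction m)
  case empty
  then show ?case by simp
next
  case (add x m)
  have "{a. a \<subseteq># add_mset x m} \<subseteq> {a. a \<subseteq># m} \<union> add_mset x ` {a. a \<subseteq># m}"
  proof
    fix a assume "a \<in> {a. a \<subseteq># add_mset x m}"
    then have a: "a \<subseteq># add_mset x m" by simp
    show "a \<in> {a. a \<subseteq># m} \<union> add_mset x ` {a. a \<subseteq># m}"
    proof (cases "x \<in># a")
      case True
      then obtain b where "a = add_mset x b" by (metis insert_DiffM)
      then show ?thesis using a by auto
    next
      case False
      then have "a \<subseteq># m"
        using a by (metis add_mset_remove_trivial diff_single_trivial subset_eq_diff_conv
            add_mset_add_single)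
      then show ?thesis by simp
    qed
  qed
  then show ?case using add.IH by (meson finite_UnI finite_imageI finite_subset)
qed

instantiation mps :: (type, comm_ring_1) comm_ring_1
begin

definition "0 = Abs_mps (\<lambda>_. 0)"
definition "1 = Abs_mps (\<lambda>m. if m = {#} then 1 else 0)"
definition "f + g = Abs_mps (\<lambda>m. mps_nth f m + mps_nth g m)"
definition "- f = Abs_mps (\<lambda>m. - mps_nth f m)"
definition "f - g = Abs_mps (\<lambda>m. mps_nth f m - mps_nth g m)"
definition "f * g = Abs_mps (\<lambda>m. \<Sum>a | a \<subseteq># m. mps_nth f a * mps_nth g (m - a))"

instance
proof
  fix f g h :: "('a, 'b) mps"
  show "f + g + h = f + (g + h)"
    by (rule mps_eqI) (simp add: plus_mps_def add.assoc)
  show "f + g = g + f"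
    by (rule mps_eqI) (simp add: plus_mps_def add.commute)
  show "0 + f = f"
    by (rule mps_eqI) (simp add: plus_mps_def zero_mps_def)
  show "- f + f = 0"
    by (rule mps_eqI) (simp add: plus_mps_def zero_mps_def uminus_mps_def)
  show "f - g = f + - g"
    by (rule mps_eqI) (simp add: plus_mps_def minus_mps_def uminus_mps_def)
  show "(0 :: ('a, 'b) mps) \<noteq> 1"
  proof
    assume "(0 :: ('a, 'b) mps) = 1"
    then have "mps_nth (0 :: ('a, 'b) mps) {#} = mps_nth 1 {#}" by simp
    then show False by (simp add: zero_mps_def one_mps_def)
  qed
  show "(f + g) * h = f * h + g * h"
    by (rule mps_eqI) (simp add: plus_mps_def times_mps_def distrib_right sum.distrib)
  show "f * g = g * f"
  proof (rule mps_eqI)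
    fix m :: "'a multiset"
    have dd: "m - (m - a) = a" if "a \<subseteq># m" for a
      using that by (simp add: multiset_eq_iff subseteq_mset_def)
    have "(\<Sum>a | a \<subseteq># m. mps_nth f a * mps_nth g (m - a))
        = (\<Sum>a | a \<subseteq># m. mps_nth g a * mps_nth f (m - a))"
      by (rule sum.reindex_bij_witness[where i = "\<lambda>a. m - a" and j = "\<lambda>a. m - a"])
         (auto simp: dd mult.commute)
    then show "mps_nth (f * g) m = mps_nth (g * f) m" by (simp add: times_mps_def)
  qed
  show "1 * f = f"
  proof (rule mps_eqI)
    fix m :: "'a multiset"
    have "(\<Sum>a | a \<subseteq># m. (if a = {#} then 1 else 0) * mps_nth f (m - a))
        = (\<Sum>a | a \<subseteq># m. if a = {#} then mps_nth f m else 0)"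
      by (rule sum.cong) auto
    also have "\<dots> = mps_nth f m" by (subst sum.delta) auto
    finally show "mps_nth (1 * f) m = mps_nth f m" by (simp add: times_mps_def one_mps_def)
  qed
  show "f * g * h = f * (g * h)"
  proof (rule mps_eqI)
    fix m :: "'a multiset"
    have "mps_nth (f * g * h) m
        = (\<Sum>a | a \<subseteq># m. \<Sum>b | b \<subseteq># a. mps_nth f b * mps_nth g (a - b) * mps_nth h (m - a))"
      by (simp add: times_mps_def sum_distrib_right)
    also have "\<dots> = (\<Sum>(a, b) \<in> Sigma {a. a \<subseteq># m} (\<lambda>a. {b. b \<subseteq># a}).
          mps_nth f b * mps_nth g (a - b) * mps_nth h (m - a))"
      by (rule sum.Sigma) auto
    also have "\<dots> = (\<Sum>(b, c) \<in> Sigma {b. b \<subseteq># m} (\<lambda>b. {c. c \<subseteq># m - b}).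
          mps_nth f b * (mps_nth g c * mps_nth h (m - b - c)))"
    proof (rule sum.reindex_bij_witness[where i = "\<lambda>(b, c). (b + c, b)"
          and j = "\<lambda>(a, b). (b, a - b)"], goal_cases)
      case (1 x)
      then show ?case by auto
    next
      case (2 x)
      obtain a b where x: "x = (a, b)" by (cases x)
      have "b \<subseteq># m"
        using 2 x by (auto intro: subset_mset.order_trans)
      moreover have "a - b \<subseteq># m - b"
        using 2 x by (auto simp: subseteq_mset_def intro: diff_le_mono)
      ultimately show ?case using x by simp
    next
      case (3 x)
      then show ?case by auto
    next
      case (4 x)
      then show ?case
        by (auto simp: subset_mset.le_diff_conv2 add.commute)
    next
      case (5 x)
      then show ?case
        by (auto simp: mult.assoc)
    qed
    also have "\<dots> = (\<Sum>b | b \<subseteq># m. \<Sum>c | c \<subseteq># m - b.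
          mps_nth f b * (mps_nth g c * mps_nth h (m - b - c)))"
      by (rule sum.Sigma [symmetric]) auto
    also have "\<dots> = mps_nth (f * (g * h)) m"
      by (simp add: times_mps_def sum_distrib_left)
    finally show "mps_nth (f * g * h) m = mps_nth (f * (g * h)) m" .
  qed
qed

end

definition mps_const :: "'a::comm_ring_1 \<Rightarrow> ('i, 'a) mps" where
  "mps_const c = Abs_mps (\<lambda>m. if m = {#} then c else 0)"

definition mps_var :: "'i \<Rightarrow> ('i, 'a::comm_ring_1) mps" where
  "mps_var i = Abs_mps (\<lambda>m. if m = {#i#} then 1 else 0)"


section \<open>The rings\<close>

definition primitive_root :: "nat \<Rightarrow> complex \<Rightarrow> bool" where
  "primitive_root N \<zeta> \<longleftrightarrow> \<zeta> ^ N = 1 \<and> (\<forall>k. 0 < k \<and> k < N \<longrightarrow> \<zeta> ^ k \<noteq> 1)"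

definition cyclotomic_ring :: "nat \<Rightarrow> complex \<Rightarrow> complex ring" where
  "cyclotomic_ring M \<zeta> = class_ring\<lparr>carrier := generate_ring class_ring {1 / of_nat M, \<zeta>}\<rparr>"

type_synonym series = "(nat \<times> nat, complex) mps"

text \<open>
  \<open>power_series_ring A n\<close> is \<open>A[[T]]\<close>, with \<open>T\<close> the matrix of the variables \<open>T\<^sub>i\<^sub>j\<close>, \<open>i, j < n\<close>.
\<close>

definition power_series_ring :: "complex ring \<Rightarrow> nat \<Rightarrow> series ring" where
  "power_series_ring A n = class_ring\<lparr>carrier :=
     {f. (\<forall>m. mps_nth f m \<in> carrier A) \<and>
         (\<forall>m. mps_nth f m \<noteq> 0 \<longrightarrow> set_mset m \<subseteq> {..<n} \<times> {..<n})}\<rparr>"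

definition generic_mat :: "nat \<Rightarrow> series mat" where
  "generic_mat n = 1\<^sub>m n + mat n n mps_var"

text \<open>
  The coordinate ring \<open>\<O>(GL\<^sub>n) = A[x, det(x)\<^sup>-\<^sup>1]\<close>, with \<open>x = 1 + T\<close>. It is realised inside \<open>A[[T]]\<close>:
  the entries of \<open>x\<close> are algebraically independent over \<open>A\<close> and \<open>det(x)\<close>, having constant term
  \<open>1\<close>, is a unit, so that the localised polynomial ring is the subring generated by \<open>A\<close>, the
  entries of \<open>x\<close> and the inverse of \<open>det(x)\<close>.
\<close>

definition coordinate_ring :: "complex ring \<Rightarrow> nat \<Rightarrow> series ring" where
  "coordinate_ring A n = class_ring\<lparr>carrier := generate_ring class_ring
     (mps_const ` carrier A \<union> elements_mat (generic_mat n) \<union> {d. d * det (generic_mat n) = 1})\<rparr>"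


section \<open>$p$-adic completion\<close>

definition padic_ideal :: "('a, 'm) ring_scheme \<Rightarrow> nat \<Rightarrow> nat \<Rightarrow> 'a set" where
  "padic_ideal R p k = PIdl\<^bsub>R\<^esub> (add_pow R (p ^ k) \<one>\<^bsub>R\<^esub>)"

text \<open>
  The completion is the inverse limit of the rings \<open>R / p\<^sup>k R\<close>. A coset of \<open>p\<^sup>k\<^sup>+\<^sup>1 R\<close> maps to a coset of
  \<open>p\<^sup>k R\<close> if and only if it is contained in it.
\<close>

definition padic_completion :: "('a, 'm) ring_scheme \<Rightarrow> nat \<Rightarrow> (nat \<Rightarrow> 'a set) ring" where
  "padic_completion R p =
    \<lparr>carrier = {f. \<forall>k. f k \<in> carrier (R Quot padic_ideal R p k) \<and> f (Suc k) \<subseteq> f k},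
     mult = (\<lambda>f g k. f k \<otimes>\<^bsub>R Quot padic_ideal R p k\<^esub> g k),
     one = (\<lambda>k. \<one>\<^bsub>R Quot padic_ideal R p k\<^esub>),
     zero = (\<lambda>k. \<zero>\<^bsub>R Quot padic_ideal R p k\<^esub>),
     add = (\<lambda>f g k. f k \<oplus>\<^bsub>R Quot padic_ideal R p k\<^esub> g k)\<rparr>"

definition to_completion :: "('a, 'm) ring_scheme \<Rightarrow> nat \<Rightarrow> 'a \<Rightarrow> nat \<Rightarrow> 'a set" where
  "to_completion R p a = (\<lambda>k. padic_ideal R p k +>\<^bsub>R\<^esub> a)"

text \<open>
  The map induced on completions by an additive map \<open>h\<close> from \<open>R\<close> to \<open>S\<close>. All sets in the union
  are equal, because \<open>h\<close> maps \<open>p\<^sup>k R\<close> into \<open>p\<^sup>k S\<close>.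
\<close>

definition completion_map ::
  "('a, 'm) ring_scheme \<Rightarrow> ('b, 'k) ring_scheme \<Rightarrow> nat \<Rightarrow> ('a \<Rightarrow> 'b) \<Rightarrow> (nat \<Rightarrow> 'a set) \<Rightarrow> nat \<Rightarrow> 'b set"
  where
  "completion_map R S p h f = (\<lambda>k. \<Union>a\<in>f k. padic_ideal S p k +>\<^bsub>S\<^esub> h a)"

text \<open>Convergence in the $p$-adic topology of the series \<open>\<Sum>i. a i\<close> to \<open>s\<close>.\<close>

definition padic_sums ::
  "('a, 'm) ring_scheme \<Rightarrow> nat \<Rightarrow> (nat \<Rightarrow> nat \<Rightarrow> 'a set) \<Rightarrow> (nat \<Rightarrow> 'a set) \<Rightarrow> bool" where
  "padic_sums R p a s \<longleftrightarrow>
     (\<forall>k. \<forall>\<^sub>F l in sequentially. (\<Oplus>\<^bsub>padic_completion R p\<^esub>i\<in>{..<l}. a i) k = s k)"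


section \<open>Matrices over a ring given by a record\<close>

definition rmat :: "('a, 'm) ring_scheme \<Rightarrow> nat \<Rightarrow> 'a mat set" where
  "rmat R n = {Y \<in> carrier_mat n n. elements_mat Y \<subseteq> carrier R}"

definition rmat_one :: "('a, 'm) ring_scheme \<Rightarrow> nat \<Rightarrow> 'a mat" where
  "rmat_one R n = mat n n (\<lambda>(i, j). if i = j then \<one>\<^bsub>R\<^esub> else \<zero>\<^bsub>R\<^esub>)"

definition rmat_minus :: "('a, 'm) ring_scheme \<Rightarrow> 'a mat \<Rightarrow> 'a mat \<Rightarrow> 'a mat" where
  "rmat_minus R Y Z = mat (dim_row Y) (dim_col Y) (\<lambda>(i, j). Y $$ (i, j) \<ominus>\<^bsub>R\<^esub> Z $$ (i, j))"

definition rmat_mult :: "('a, 'm) ring_scheme \<Rightarrow> 'a mat \<Rightarrow> 'a mat \<Rightarrow> 'a mat" where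
  "rmat_mult R Y Z = mat (dim_row Y) (dim_col Z)
     (\<lambda>(i, j). \<Oplus>\<^bsub>R\<^esub>k\<in>{..<dim_col Y}. Y $$ (i, k) \<otimes>\<^bsub>R\<^esub> Z $$ (k, j))"

primrec rmat_pow :: "('a, 'm) ring_scheme \<Rightarrow> nat \<Rightarrow> 'a mat \<Rightarrow> nat \<Rightarrow> 'a mat" where
  "rmat_pow R n Y 0 = rmat_one R n"
| "rmat_pow R n Y (Suc i) = rmat_mult R (rmat_pow R n Y i) Y"

definition rmat_inverse :: "('a, 'm) ring_scheme \<Rightarrow> nat \<Rightarrow> 'a mat \<Rightarrow> 'a mat \<Rightarrow> bool" where
  "rmat_inverse R n Y W \<longleftrightarrow> W \<in> rmat R n \<and>
     rmat_mult R Y W = rmat_one R n \<and> rmat_mult R W Y = rmat_one R n"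

definition general_linear :: "('a, 'm) ring_scheme \<Rightarrow> nat \<Rightarrow> 'a mat set" where
  "general_linear R n = {Y \<in> rmat R n. \<exists>W. rmat_inverse R n Y W}"

text \<open>The matrix \<open>u\<^sup>(\<^sup>p\<^sup>)\<close> of the \<open>p\<close>-th powers of the entries of \<open>u\<close>.\<close>

definition entry_power :: "('a, 'm) ring_scheme \<Rightarrow> nat \<Rightarrow> 'a mat \<Rightarrow> 'a mat" where
  "entry_power R p = map_mat (\<lambda>a. a [^]\<^bsub>R\<^esub> p)"

definition split_matrix :: "nat \<Rightarrow> complex mat \<Rightarrow> bool" where
  "split_matrix n q \<longleftrightarrow> (\<exists>r.
     n = 2 * r \<and> q = four_block_mat (0\<^sub>m r r) (1\<^sub>m r) (- 1\<^sub>m r) (0\<^sub>m r r) \<or>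
     n = 2 * r \<and> q = four_block_mat (0\<^sub>m r r) (1\<^sub>m r) (1\<^sub>m r) (0\<^sub>m r r) \<or>
     n = 2 * r + 1 \<and> q = four_block_mat (1\<^sub>m 1) (0\<^sub>m 1 (2 * r)) (0\<^sub>m (2 * r) 1)
       (four_block_mat (0\<^sub>m r r) (1\<^sub>m r) (1\<^sub>m r) (0\<^sub>m r r)))"


section \<open>Frobenius lifts and adelic connections\<close>

definition frobenius_of ::
  "('a, 'm) ring_scheme \<Rightarrow> nat \<Rightarrow> ('a \<Rightarrow> 'a) \<Rightarrow> 'a \<Rightarrow> 'a" where
  "frobenius_of R p \<delta> b = b [^]\<^bsub>R\<^esub> p \<oplus>\<^bsub>R\<^esub> add_pow R p (\<delta> b)"

definition p_derivation :: "('a, 'm) ring_scheme \<Rightarrow> nat \<Rightarrow> ('a \<Rightarrow> 'a) \<Rightarrow> bool" where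
  "p_derivation R p \<delta> \<longleftrightarrow>
     \<delta> \<in> carrier R \<rightarrow> carrier R \<and> frobenius_of R p \<delta> \<in> Ring.ring_hom R R"

definition lifts_frobenius :: "('a, 'm) ring_scheme \<Rightarrow> nat \<Rightarrow> ('a \<Rightarrow> 'a) \<Rightarrow> bool" where
  "lifts_frobenius R p \<phi> \<longleftrightarrow> \<phi> \<in> Ring.ring_hom R R \<and>
     (\<forall>a\<in>carrier R. \<phi> a \<ominus>\<^bsub>R\<^esub> a [^]\<^bsub>R\<^esub> p \<in> padic_ideal R p 1)"

type_synonym connection = "nat \<Rightarrow> (nat \<Rightarrow> series set) \<Rightarrow> (nat \<Rightarrow> series set)"

definition adelic_connection ::
  "complex ring \<Rightarrow> nat \<Rightarrow> nat set \<Rightarrow> connection \<Rightarrow> bool" where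
  "adelic_connection A n V \<delta> \<longleftrightarrow>
     (\<forall>p\<in>V. p_derivation (padic_completion (coordinate_ring A n) p) p (\<delta> p))"

abbreviation connection_frobenius ::
  "complex ring \<Rightarrow> nat \<Rightarrow> connection \<Rightarrow> nat \<Rightarrow> (nat \<Rightarrow> series set) \<Rightarrow> (nat \<Rightarrow> series set)" where
  "connection_frobenius A n \<delta> p \<equiv>
     frobenius_of (padic_completion (coordinate_ring A n) p) p (\<delta> p)"


section \<open>Chern connections\<close>

text \<open>
  \<open>S\<close> is the value of the binomial series \<open>(1 + U)\<^sup>1\<^sup>/\<^sup>2 = 1 + \<Sum>i\<ge>1. (1/2 choose i) U\<^sup>i\<close> in the $n \times n$
  matrices over the completion of the coordinate ring. The coefficients lie in \<open>\<int>[1/2]\<close>, hence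
  in \<open>A\<close> if \<open>M\<close> is even.
\<close>

definition is_binomial_sqrt ::
  "complex ring \<Rightarrow> nat \<Rightarrow> nat \<Rightarrow> (nat \<Rightarrow> series set) mat \<Rightarrow> (nat \<Rightarrow> series set) mat \<Rightarrow> bool" where
  "is_binomial_sqrt A n p U S \<longleftrightarrow>
     (let OG = coordinate_ring A n; B = padic_completion OG p in
      S \<in> rmat B n \<and>
      (\<forall>i<n. \<forall>j<n. padic_sums OG p
         (\<lambda>l. to_completion OG p (mps_const ((1 / 2) gchoose l)) \<otimes>\<^bsub>B\<^esub> rmat_pow B n U l $$ (i, j))
         (S $$ (i, j))))"

text \<open>
  In the condition at \<open>p\<close>, \<open>\<phi>\<^sub>0\<close> is the Frobenius lift of \<open>A\<close>, \<open>X\<close>, \<open>Q\<close> and \<open>Q'\<close> are the images of \<open>x\<close>,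
  \<open>q\<close> and \<open>\<phi>\<^sub>0(q)\<close> in the matrices over the completion \<open>B\<close>, and \<open>W\<close> is the inverse in the formula
  \<open>\<phi>(x) = x\<^sup>(\<^sup>p\<^sup>) {(x\<^sup>(\<^sup>p\<^sup>)\<^sup>t \<phi>(q) x\<^sup>(\<^sup>p\<^sup>))\<^sup>-\<^sup>1 (x\<^sup>t q x)\<^sup>(\<^sup>p\<^sup>)}\<^sup>1\<^sup>/\<^sup>2\<close>.
\<close>

definition chern_connection ::
  "complex ring \<Rightarrow> nat \<Rightarrow> complex mat \<Rightarrow> nat set \<Rightarrow> connection \<Rightarrow> bool" where
  "chern_connection A n q V \<delta> \<longleftrightarrow> adelic_connection A n V \<delta> \<and>
     (\<forall>p\<in>V. \<exists>\<phi>\<^sub>0 W S. lifts_frobenius A p \<phi>\<^sub>0 \<and>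
       (let OG = coordinate_ring A n;
            B = padic_completion OG p;
            \<phi> = connection_frobenius A n \<delta> p;
            X = map_mat (to_completion OG p) (generic_mat n);
            Xp = entry_power B p X;
            Q = map_mat (\<lambda>a. to_completion OG p (mps_const a)) q;
            Q' = map_mat (\<lambda>a. to_completion OG p (mps_const (\<phi>\<^sub>0 a))) q;
            Y = rmat_mult B (transpose_mat Xp) (rmat_mult B Q' Xp);
            Z = entry_power B p (rmat_mult B (transpose_mat X) (rmat_mult B Q X))
        in (\<forall>a\<in>carrier (padic_completion A p).
              \<phi> (completion_map A OG p mps_const a) =
              completion_map A OG p mps_const (completion_map A A p \<phi>\<^sub>0 a)) \<and>
           rmat_inverse B n Y W \<and>
           is_binomial_sqrt A n p (rmat_minus B (rmat_mult B W Z) (rmat_one B n)) S \<and>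
           map_mat \<phi> X = rmat_mult B Xp S))"


section \<open>Curvature\<close>

text \<open>
  The Taylor expansion along \<open>x = 1\<close>, from the completion of the coordinate ring to \<open>A\<^sub>p[[T]]\<close>, with
  \<open>A\<^sub>p\<close> the completion of \<open>A\<close>; elements of \<open>A\<^sub>p[[T]]\<close> are given by their coefficients.
\<close>

definition taylor ::
  "complex ring \<Rightarrow> nat \<Rightarrow> nat \<Rightarrow> (nat \<Rightarrow> series set) \<Rightarrow> (nat \<times> nat) multiset \<Rightarrow> nat \<Rightarrow> complex set" where
  "taylor A n p g = (\<lambda>m. completion_map (coordinate_ring A n) A p (\<lambda>b. mps_nth b m) g)"

text \<open>Congruence modulo the \<open>k\<close>-th power of the ideal \<open>(T)\<close>.\<close>

definition cong_T :: "nat \<Rightarrow> ('i multiset \<Rightarrow> 'a) \<Rightarrow> ('i multiset \<Rightarrow> 'a) \<Rightarrow> bool" where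
  "cong_T k F G \<longleftrightarrow> (\<forall>m. size m < k \<longrightarrow> F m = G m)"

text \<open>
  If \<open>\<phi>\<close> maps the ideal \<open>(T)\<close> of the completed coordinate ring \<open>B\<close> into itself, then it induces an
  endomorphism of \<open>A\<^sub>p[[T]]\<close>, the inverse limit of the rings \<open>B / (T)\<^sup>k\<close>: its value \<open>H\<close> at \<open>F\<close> is
  congruent to \<open>\<phi> g\<close> modulo \<open>(T)\<^sup>k\<close> whenever \<open>F\<close> is congruent to \<open>g\<close> modulo \<open>(T)\<^sup>k\<close>.
\<close>

definition formal_frobenius ::
  "complex ring \<Rightarrow> nat \<Rightarrow> connection \<Rightarrow> nat \<Rightarrow>
    ((nat \<times> nat) multiset \<Rightarrow> nat \<Rightarrow> complex set) \<Rightarrow> (nat \<times> nat) multiset \<Rightarrow> nat \<Rightarrow> complex set" where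
  "formal_frobenius A n \<delta> p F = (THE H.
     \<forall>k. \<forall>g\<in>carrier (padic_completion (coordinate_ring A n) p).
       cong_T k (taylor A n p g) F \<longrightarrow>
       cong_T k (taylor A n p (connection_frobenius A n \<delta> p g)) H)"

text \<open>Its restriction to \<open>A[[T]]\<close>, for a connection that is global along \<open>1\<close>.\<close>

definition series_frobenius ::
  "complex ring \<Rightarrow> nat \<Rightarrow> connection \<Rightarrow> nat \<Rightarrow> series \<Rightarrow> series" where
  "series_frobenius A n \<delta> p f = (THE h. h \<in> carrier (power_series_ring A n) \<and>
     (\<lambda>m. to_completion A p (mps_nth h m)) =
     formal_frobenius A n \<delta> p (\<lambda>m. to_completion A p (mps_nth f m)))"

definition curvature ::
  "complex ring \<Rightarrow> nat \<Rightarrow> connection \<Rightarrow> nat \<Rightarrow> nat \<Rightarrow> series \<Rightarrow> series" where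
  "curvature A n \<delta> p p' f = mps_const (1 / (of_nat p * of_nat p')) *
     (series_frobenius A n \<delta> p (series_frobenius A n \<delta> p' f) -
      series_frobenius A n \<delta> p' (series_frobenius A n \<delta> p f))"

definition orthogonal_ideal :: "complex ring \<Rightarrow> nat \<Rightarrow> complex mat \<Rightarrow> series set" where
  "orthogonal_ideal A n q = Idl\<^bsub>power_series_ring A n\<^esub>
     (elements_mat (transpose_mat (generic_mat n) * map_mat mps_const q * generic_mat n
                    - map_mat mps_const q))"

text \<open>
  The map induced by the curvature on \<open>A[[T]] / J\<close>, with \<open>J\<close> the orthogonal ideal. All sets in the
  union are equal when the curvature maps \<open>J\<close> into itself.
\<close>

definition so_curvature ::
  "complex ring \<Rightarrow> nat \<Rightarrow> complex mat \<Rightarrow> connection \<Rightarrow> nat \<Rightarrow> nat \<Rightarrow> series set \<Rightarrow> series set" where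
  "so_curvature A n q \<delta> p p' C =
     (\<Union>f\<in>C. orthogonal_ideal A n q +>\<^bsub>power_series_ring A n\<^esub> curvature A n \<delta> p p' f)"

end

theory Submission
  imports
    Defs
    "HOL-Computational_Algebra.Formal_Power_Series"
    "Jordan_Normal_Form.Char_Poly"
begin

text \<open>
  The Frobenius lift \<open>\<phi>\<close> of the Chern connection acts on \<open>A[[T]]\<close> as the continuous endomorphism
  that is \<open>\<phi>\<^sub>0\<close> on \<open>A\<close> and sends \<open>x\<close> to \<open>\<chi>\<^sub>p(x) = x\<^sup>(\<^sup>p\<^sup>) S\<close>, where \<open>S\<close> is the only matrix with
  \<open>S \<equiv> 1\<close> modulo \<open>T\<close> and \<open>(x\<^sup>(\<^sup>p\<^sup>)\<^sup>t q x\<^sup>(\<^sup>p\<^sup>)) S\<^sup>2 = (x\<^sup>t q x)\<^sup>(\<^sup>p\<^sup>)\<close>. Uniqueness makes \<open>\<chi>\<^sub>p\<close> commute with continuous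
  homomorphisms, so the curvature at \<open>x\<close> compares \<open>\<chi>\<^sub>p\<^sub>' \<circ> \<chi>\<^sub>p\<close> with \<open>\<chi>\<^sub>p \<circ> \<chi>\<^sub>p\<^sub>'\<close>, and may be evaluated at any
  matrix \<open>g \<equiv> 1\<close> that preserves \<open>q\<close>.

  If \<open>n \<ge> 6\<close>, take \<open>g = diag(G, G\<^sup>-\<^sup>t)\<close> with \<open>G\<close> upper unitriangular of size three with entries \<open>a, b\<close>
  next to the diagonal and \<open>c\<close> in the corner. Then \<open>\<chi>\<^sub>p\<close> acts by \<open>a \<mapsto> a\<^sup>p\<close>, \<open>b \<mapsto> b\<^sup>p\<close> and
  \<open>c \<mapsto> (c\<^sup>p + (ab)\<^sup>p + (c - ab)\<^sup>p) / 2\<close>. For \<open>a = 2t\<close>, \<open>b = t\<close>, \<open>c = t + t\<^sup>2\<close> the two compositions differ in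
  the coefficient of \<open>t\<close> to the power \<open>pp' + 2\<close>, which is \<open>p'\<close> times the binomial coefficient of \<open>p\<close> over
  \<open>2\<close> in one order and \<open>p\<close> times that of \<open>p'\<close> over \<open>2\<close> in the other.

  If \<open>n = 2\<close> and \<open>q\<close> is symplectic, then \<open>\<chi>\<^sub>p(x) = \<lambda> x\<^sup>(\<^sup>p\<^sup>)\<close> with \<open>\<lambda>\<^sup>2 det(x\<^sup>(\<^sup>p\<^sup>)) = det(x)\<^sup>p\<close>, hence both compositions
  are given by the same formula with \<open>pp'\<close> in place of \<open>p\<close>. If \<open>q\<close> is symmetric, the orthogonal group is
  diagonal near \<open>1\<close> and \<open>\<chi>\<^sub>p\<close> is the \<open>p\<close>-th power map on it.
\<close>

section \<open>Orders of vanishing and convergent matrix series\<close>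

text \<open>The obstacle is that a Chern connection lives on the p-adic completion of the coordinate
  ring, a different ring for every prime, while the curvature composes lifts for two primes on
  A[[T]]. The rings are therefore compared level by level: the coordinate ring sits inside A[[T]],
  and an element of its completion is matched with a power series modulo p^j, for every j. Two
  topologies meet here: the binomial root converges p-adically in the completion and T-adically in
  A[[T]], and the values agree because each coefficient sees only finitely many terms. Returning
  from series over the completed A to A[[T]] needs that no nonzero element of A is divisible by all
  powers of p, which rests on integrality.

  For vanishing modulo the orthogonal ideal, membership of the commutator is not enough: its
  quotient by pp' has to lie in the ideal. The quotient is therefore shown to be a series over A,
  and it is killed by an evaluation that is congruent to the identity modulo the ideal.\<close>

lemma mps_nth_0 [simp]: "mps_nth 0 m = 0"
  by (simp add: zero_mps_def)

lemma mps_nth_1: "mps_nth 1 m = (if m = {#} then 1 else 0)"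
  by (simp add: one_mps_def)

lemma mps_nth_add [simp]: "mps_nth (f + g) m = mps_nth f m + mps_nth g m"
  by (simp add: plus_mps_def)

lemma mps_nth_minus [simp]: "mps_nth (f - g) m = mps_nth f m - mps_nth g m"
  by (simp add: minus_mps_def)

lemma mps_nth_uminus [simp]: "mps_nth (- f) m = - mps_nth f m"
  by (simp add: uminus_mps_def)

lemma mps_nth_mult: "mps_nth (f * g) m = (\<Sum>a | a \<subseteq># m. mps_nth f a * mps_nth g (m - a))"
  by (simp add: times_mps_def)

lemma mps_nth_sum [simp]: "mps_nth (sum f S) m = (\<Sum>i\<in>S. mps_nth (f i) m)"
  by (induction S rule: infinite_finite_induct) auto

lemma mps_nth_const: "mps_nth (mps_const c) m = (if m = {#} then c else 0)"
  by (simp add: mps_const_def)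

lemma mps_nth_var: "mps_nth (mps_var i) m = (if m = {#i#} then 1 else 0)"
  by (simp add: mps_var_def)

lemma mps_nth_const_mult [simp]: "mps_nth (mps_const c * f) m = c * mps_nth f m"
proof -
  have "mps_nth (mps_const c * f) m = (\<Sum>a | a \<subseteq># m. if a = {#} then c * mps_nth f m else 0)"
    unfolding mps_nth_mult by (rule sum.cong) (auto simp: mps_nth_const)
  then show ?thesis by (simp add: sum.delta)
qed

lemma mps_nth_mult_empty [simp]: "mps_nth (f * g) {#} = mps_nth f {#} * mps_nth g {#}"
  by (simp add: mps_nth_mult)

lemma comm_ring_hom_mps_const: "comm_ring_hom (mps_const :: 'a::comm_ring_1 \<Rightarrow> ('i, 'a) mps)"
proof
  fix x y :: 'a
  show "(mps_const (x * y) :: ('i, 'a) mps) = mps_const x * mps_const y"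
    by (rule mps_eqI) (simp add: mps_nth_const)
qed (auto intro!: mps_eqI simp: mps_nth_const mps_nth_1)

interpretation mps_const: comm_ring_hom "mps_const :: 'a::comm_ring_1 \<Rightarrow> ('i, 'a) mps"
  by (rule comm_ring_hom_mps_const)

lemma comm_ring_hom_const_coeff: "comm_ring_hom (\<lambda>f :: ('i, 'a::comm_ring_1) mps. mps_nth f {#})"
  by standard (auto simp: mps_nth_1)

interpretation const_coeff: comm_ring_hom "\<lambda>f :: ('i, 'a::comm_ring_1) mps. mps_nth f {#}"
  by (rule comm_ring_hom_const_coeff)

section \<open>The T-adic filtration on power series\<close>

definition vanishes :: "nat \<Rightarrow> ('i, 'a::comm_ring_1) mps \<Rightarrow> bool" where
  "vanishes k f \<longleftrightarrow> (\<forall>m. size m < k \<longrightarrow> mps_nth f m = 0)"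

lemma vanishesD: "vanishes k f \<Longrightarrow> size m < k \<Longrightarrow> mps_nth f m = 0"
  by (simp add: vanishes_def)

lemma vanishes_0 [simp]: "vanishes 0 f"
  by (simp add: vanishes_def)

lemma vanishes_zero [simp]: "vanishes k 0"
  by (simp add: vanishes_def)

lemma vanishes_mono: "vanishes k f \<Longrightarrow> l \<le> k \<Longrightarrow> vanishes l f"
  by (auto simp: vanishes_def)

lemma vanishes_add: "vanishes k f \<Longrightarrow> vanishes k g \<Longrightarrow> vanishes k (f + g)"
  by (simp add: vanishes_def)

lemma vanishes_diff: "vanishes k f \<Longrightarrow> vanishes k g \<Longrightarrow> vanishes k (f - g)"
  by (simp add: vanishes_def)

lemma vanishes_uminus [simp]: "vanishes k (- f) \<longleftrightarrow> vanishes k f"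
  by (simp add: vanishes_def)

lemma vanishes_sum: "(\<And>i. i \<in> S \<Longrightarrow> vanishes k (f i)) \<Longrightarrow> vanishes k (sum f S)"
  by (simp add: vanishes_def)

lemma vanishes_mult:
  assumes "vanishes k f" "vanishes l g"
  shows "vanishes (k + l) (f * g)"
  unfolding vanishes_def
proof (intro allI impI)
  fix m :: "'a multiset" assume m: "size m < k + l"
  have "mps_nth f a * mps_nth g (m - a) = 0" if "a \<subseteq># m" for a
  proof (cases "size a < k")
    case False
    have "size (m - a) = size m - size a" using that by (rule size_Diff_submset)
    then have "size (m - a) < l" using m False size_mset_mono[OF that] by linarith
    then show ?thesis using assms by (simp add: vanishes_def)
  qed (use assms in \<open>simp add: vanishes_def\<close>)
  then show "mps_nth (f * g) m = 0" by (simp add: mps_nth_mult)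
qed

lemma vanishes_mult_left: "vanishes k f \<Longrightarrow> vanishes k (f * g)"
  using vanishes_mult[of k f 0 g] by simp

lemma vanishes_mult_right: "vanishes k g \<Longrightarrow> vanishes k (f * g)"
  using vanishes_mult[of 0 f k g] by simp

lemma vanishes_power: "vanishes k f \<Longrightarrow> vanishes (k * l) (f ^ l)"
  by (induction l) (use vanishes_mult in \<open>auto simp: add.commute\<close>)

lemma vanishes_prod_mset:
  "(\<And>i. vanishes 1 (t i)) \<Longrightarrow> vanishes (size m) (\<Prod>i\<in>#m. t i)"
proof (induction m)
  case (add x m)
  show ?case using vanishes_mult[OF add.prems[of x] add.IH] add.prems by simp
qed simp

lemma vanishes_1_iff: "vanishes 1 f \<longleftrightarrow> mps_nth f {#} = 0"
  by (auto simp: vanishes_def)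

lemmas vanishes_Suc_0_iff = vanishes_1_iff [unfolded One_nat_def]

lemma vanishes_var: "vanishes 1 (mps_var i)"
  unfolding vanishes_1_iff by (simp add: mps_nth_var)

lemma vanishes_eq_0: "(\<And>k. vanishes k f) \<Longrightarrow> f = 0"
  by (rule mps_eqI) (use vanishesD lessI in \<open>metis mps_nth_0\<close>)

lemma mps_eq_if_cong: "(\<And>k. vanishes k (f - g)) \<Longrightarrow> f = g"
  using vanishes_eq_0[of "f - g"] by simp

lemma vanishes_cong_trans: "vanishes k (f - g) \<Longrightarrow> vanishes k (g - h) \<Longrightarrow> vanishes k (f - h)"
  by (simp add: vanishes_def)

lemma vanishes_cong_sym: "vanishes k (f - g) \<longleftrightarrow> vanishes k (g - f)"
  by (auto simp: vanishes_def)

lemma vanishes_cong_mult: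
  assumes "vanishes k (f - f')" "vanishes k (g - g')"
  shows "vanishes k (f * g - f' * g')"
proof -
  have "f * g - f' * g' = (f - f') * g + f' * (g - g')" by (simp add: algebra_simps)
  then show ?thesis using assms by (simp add: vanishes_add vanishes_mult_left vanishes_mult_right)
qed

lemma vanishes_cong_sum:
  "(\<And>i. i \<in> S \<Longrightarrow> vanishes k (f i - g i)) \<Longrightarrow> vanishes k (sum f S - sum g S)"
  using vanishes_sum[of S k "\<lambda>i. f i - g i"] by (simp add: sum_subtractf)

section \<open>Matrices of power series and convergent series in one matrix\<close>

lemma mult_mat_index:
  assumes "X \<in> carrier_mat n m" "Y \<in> carrier_mat m l" "i < n" "j < l"
  shows "(X * Y) $$ (i, j) = (\<Sum>k<m. X $$ (i, k) * Y $$ (k, j))"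
  using assms by (auto simp: scalar_prod_def lessThan_atLeast0 intro!: sum.cong)

definition mat_vanishes :: "nat \<Rightarrow> ('i, 'a::comm_ring_1) mps mat \<Rightarrow> bool" where
  "mat_vanishes k X \<longleftrightarrow> (\<forall>i<dim_row X. \<forall>j<dim_col X. vanishes k (X $$ (i, j)))"

lemma mat_vanishes_mult:
  assumes "X \<in> carrier_mat n m" "Y \<in> carrier_mat m l" "mat_vanishes a X" "mat_vanishes b Y"
  shows "mat_vanishes (a + b) (X * Y)"
  using assms unfolding mat_vanishes_def
  by (auto simp: mult_mat_index simp del: index_mult_mat(1) intro!: vanishes_sum vanishes_mult)

lemma mat_vanishes_add:
  assumes "X \<in> carrier_mat n m" "Y \<in> carrier_mat n m" "mat_vanishes a X" "mat_vanishes a Y"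
  shows "mat_vanishes a (X + Y)"
  using assms by (auto simp: mat_vanishes_def intro!: vanishes_add)

lemma pow_mat_vanishes:
  assumes "X \<in> carrier_mat n n" "mat_vanishes 1 X"
  shows "mat_vanishes l (X ^\<^sub>m l)"
proof (induction l)
  case (Suc l)
  show ?case using mat_vanishes_mult[OF _ _ Suc.IH assms(2), of n n n] assms(1) by simp
qed (simp add: mat_vanishes_def)

lemma pow_mat_plus:
  fixes X :: "'a::comm_ring_1 mat"
  assumes "X \<in> carrier_mat n n"
  shows "X ^\<^sub>m (k + l) = X ^\<^sub>m k * X ^\<^sub>m l"
proof (induction l)
  case (Suc l)
  have "X ^\<^sub>m (k + Suc l) = (X ^\<^sub>m k * X ^\<^sub>m l) * X" by (simp add: Suc)
  also have "\<dots> = X ^\<^sub>m k * (X ^\<^sub>m l * X)"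
    by (rule assoc_mult_mat[of _ n n _ n _ n]) (use assms in \<open>auto intro: pow_carrier_mat\<close>)
  finally show ?case by simp
qed (use assms pow_carrier_mat[OF assms] in simp)

lemma sum_square_triangle:
  fixes F :: "nat \<Rightarrow> nat \<Rightarrow> 'b::comm_monoid_add"
  shows "(\<Sum>(a, b)\<in>{(a, b). a + b \<le> L}. F a b) = (\<Sum>l\<le>L. \<Sum>a\<le>l. F a (l - a))"
proof -
  have "(\<Sum>l\<le>L. \<Sum>a\<le>l. F a (l - a)) = (\<Sum>(l, a)\<in>Sigma {..L} (\<lambda>l. {..l}). F a (l - a))"
    by (rule sum.Sigma) auto
  also have "\<dots> = (\<Sum>(a, b)\<in>{(a, b). a + b \<le> L}. F a b)"
    by (rule sum.reindex_bij_witness[where i = "\<lambda>(a, b). (a + b, a)" and j = "\<lambda>(l, a). (a, l - a)"])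
       auto
  finally show ?thesis ..
qed

text \<open>If \<open>E\<close> has zero constant term, then \<open>E\<^sup>l\<close> has no monomials of degree below \<open>l\<close>, so that the
  truncation at \<open>size m\<close> loses nothing.\<close>

definition mat_series :: "(nat \<Rightarrow> 'a::comm_ring_1) \<Rightarrow> ('i, 'a) mps mat \<Rightarrow> ('i, 'a) mps mat" where
  "mat_series c E = mat (dim_row E) (dim_row E) (\<lambda>(i, j).
     Abs_mps (\<lambda>m. \<Sum>l\<le>size m. c l * mps_nth ((E ^\<^sub>m l) $$ (i, j)) m))"

lemma mat_series_carrier [simp]: "E \<in> carrier_mat n n \<Longrightarrow> mat_series c E \<in> carrier_mat n n"
  by (simp add: mat_series_def)

lemma pow_mat_nth_eq_0:
  assumes "E \<in> carrier_mat n n" "mat_vanishes 1 E" "i < n" "j < n" "size m < l"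
  shows "mps_nth ((E ^\<^sub>m l) $$ (i, j)) m = 0"
  using pow_mat_vanishes[OF assms(1,2), of l] assms pow_carrier_mat[OF assms(1), of l]
  by (auto simp: mat_vanishes_def vanishes_def)

lemma mat_series_nth:
  assumes "E \<in> carrier_mat n n" "mat_vanishes 1 E" "i < n" "j < n" "size m \<le> L"
  shows "mps_nth (mat_series c E $$ (i, j)) m = (\<Sum>l\<le>L. c l * mps_nth ((E ^\<^sub>m l) $$ (i, j)) m)"
proof -
  have "(\<Sum>l\<le>size m. c l * mps_nth ((E ^\<^sub>m l) $$ (i, j)) m)
      = (\<Sum>l\<le>L. c l * mps_nth ((E ^\<^sub>m l) $$ (i, j)) m)"
    by (rule sum.mono_neutral_left)
       (use assms in \<open>auto simp: pow_mat_nth_eq_0[OF assms(1,2,3,4)] not_le\<close>)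
  then show ?thesis using assms by (simp add: mat_series_def)
qed

lemma mat_series_trunc:
  assumes "E \<in> carrier_mat n n" "mat_vanishes 1 E" "i < n" "j < n"
  shows "vanishes (Suc L) (mat_series c E $$ (i, j) - (\<Sum>l\<le>L. mps_const (c l) * (E ^\<^sub>m l) $$ (i, j)))"
  by (simp add: vanishes_def mat_series_nth[OF assms, of _ L])

text \<open>Powers of one matrix commute, so the coefficients multiply as in a Cauchy product.
  Modulo (T)^(L+1) both factors may be cut off at \<open>L\<close>; in the resulting square of index
  pairs those with \<open>a + b > L\<close> have order above \<open>L\<close>, which leaves a
  triangle.\<close>

lemma mat_series_mult:
  assumes E: "E \<in> carrier_mat n n" "mat_vanishes 1 E"
  shows "mat_series c E * mat_series d E = mat_series (\<lambda>l. \<Sum>k\<le>l. c k * d (l - k)) E"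
proof (rule eq_matI)
  fix i j assume "i < dim_row (mat_series (\<lambda>l. \<Sum>k\<le>l. c k * d (l - k)) E)"
    "j < dim_col (mat_series (\<lambda>l. \<Sum>k\<le>l. c k * d (l - k)) E)"
  then have ij: "i < n" "j < n" using E by (auto simp: mat_series_def)
  let ?p = "\<lambda>l i j. (E ^\<^sub>m l) $$ (i, j)"
  show "(mat_series c E * mat_series d E) $$ (i, j)
      = mat_series (\<lambda>l. \<Sum>k\<le>l. c k * d (l - k)) E $$ (i, j)"
  proof (rule mps_eq_if_cong)
    fix L :: nat
    let ?S = "{..L} \<times> {..L}"
    define F where "F = (\<lambda>a b. mps_const (c a * d b) * ?p (a + b) i j)"
    have "vanishes (Suc L) ((mat_series c E * mat_series d E) $$ (i, j)
      - (\<Sum>k<n. (\<Sum>a\<le>L. mps_const (c a) * ?p a i k) * (\<Sum>b\<le>L. mps_const (d b) * ?p b k j)))"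
      unfolding mult_mat_index[OF mat_series_carrier[OF E(1)] mat_series_carrier[OF E(1)] ij]
      by (intro vanishes_cong_sum vanishes_cong_mult mat_series_trunc[OF E]) (use ij in auto)
    also have "(\<Sum>k<n. (\<Sum>a\<le>L. mps_const (c a) * ?p a i k) * (\<Sum>b\<le>L. mps_const (d b) * ?p b k j))
        = (\<Sum>k<n. \<Sum>(a,b)\<in>?S. mps_const (c a * d b) * (?p a i k * ?p b k j))"
      by (simp add: sum_product sum.cartesian_product mps_const.hom_mult mult_ac)
    also have "\<dots> = (\<Sum>(a,b)\<in>?S. \<Sum>k<n. mps_const (c a * d b) * (?p a i k * ?p b k j))"
      by (subst sum.swap) (simp add: case_prod_unfold)
    also have "\<dots> = (\<Sum>(a,b)\<in>?S. F a b)"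
    proof (rule sum.cong, simp, clarsimp)
      fix a b
      have "?p (a + b) i j = (\<Sum>k<n. ?p a i k * ?p b k j)"
        unfolding pow_mat_plus[OF E(1)] by (rule mult_mat_index[OF pow_carrier_mat[OF E(1)] pow_carrier_mat[OF E(1)] ij])
      then show "(\<Sum>k<n. mps_const (c a * d b) * (?p a i k * ?p b k j)) = F a b"
        by (simp add: F_def sum_distrib_left)
    qed
    finally have 1: "vanishes (Suc L) ((mat_series c E * mat_series d E) $$ (i, j) - (\<Sum>(a,b)\<in>?S. F a b))" .
    have "(\<Sum>(a,b)\<in>?S. F a b) = (\<Sum>(a,b)\<in>{(a, b). a + b \<le> L}. F a b)
        + (\<Sum>(a,b)\<in>?S - {(a, b). a + b \<le> L}. F a b)"
      by (subst sum.subset_diff[of "{(a, b). a + b \<le> L}"]) (auto simp: add.commute)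
    moreover have "vanishes (Suc L) (\<Sum>(a,b)\<in>?S - {(a, b). a + b \<le> L}. F a b)"
    proof (rule vanishes_sum, clarsimp simp: F_def)
      fix a b assume "\<not> a + b \<le> L"
      then have "vanishes (Suc L) (?p (a + b) i j)"
        using ij by (auto simp: vanishes_def intro!: pow_mat_nth_eq_0[OF E])
      then show "vanishes (Suc L) (mps_const (c a * d b) * ?p (a + b) i j)"
        by (rule vanishes_mult_right)
    qed
    ultimately have 2: "vanishes (Suc L) ((\<Sum>(a,b)\<in>?S. F a b) - (\<Sum>(a,b)\<in>{(a, b). a + b \<le> L}. F a b))"
      by simp
    have "(\<Sum>(a,b)\<in>{(a, b). a + b \<le> L}. F a b)
        = (\<Sum>l\<le>L. mps_const (\<Sum>k\<le>l. c k * d (l - k)) * ?p l i j)"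
      unfolding sum_square_triangle
      by (rule sum.cong) (auto simp: F_def mps_const.hom_sum sum_distrib_right)
    then have "vanishes (Suc L) (mat_series (\<lambda>l. \<Sum>k\<le>l. c k * d (l - k)) E $$ (i, j)
        - (\<Sum>(a,b)\<in>{(a, b). a + b \<le> L}. F a b))"
      using mat_series_trunc[OF E ij] by simp
    then have "vanishes (Suc L) ((mat_series c E * mat_series d E) $$ (i, j)
        - mat_series (\<lambda>l. \<Sum>k\<le>l. c k * d (l - k)) E $$ (i, j))"
      using 1 2 vanishes_cong_trans vanishes_cong_sym by blast
    then show "vanishes L ((mat_series c E * mat_series d E) $$ (i, j)
        - mat_series (\<lambda>l. \<Sum>k\<le>l. c k * d (l - k)) E $$ (i, j))"
      by (rule vanishes_mono) simp
  qed
qed (use E in \<open>auto simp: mat_series_def\<close>)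

lemma mat_series_1:
  assumes E: "E \<in> carrier_mat n n" "mat_vanishes 1 E"
  shows "mat_series (\<lambda>l. if l = 0 then 1 else 0) E = 1\<^sub>m n" (is "_ = ?I")
proof (rule eq_matI)
  fix i j assume "i < dim_row ?I" "j < dim_col ?I"
  then have ij: "i < n" "j < n" by auto
  show "mat_series (\<lambda>l. if l = 0 then 1 else 0) E $$ (i, j) = 1\<^sub>m n $$ (i, j)"
  proof (rule mps_eqI)
    fix m
    have "(\<Sum>l\<le>size m. (if l = 0 then 1 else 0) * mps_nth ((E ^\<^sub>m l) $$ (i, j)) m)
        = (\<Sum>l\<le>size m. if l = 0 then mps_nth ((E ^\<^sub>m 0) $$ (i, j)) m else 0)"
      by (rule sum.cong) auto
    then show "mps_nth (mat_series (\<lambda>l. if l = 0 then 1 else 0) E $$ (i, j)) m = mps_nth (1\<^sub>m n $$ (i, j)) m"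
      using E ij by (simp add: mat_series_nth[OF E ij order_refl] sum.delta)
  qed
qed (use E in \<open>auto simp: mat_series_def\<close>)

lemma mat_series_1_plus:
  assumes E: "E \<in> carrier_mat n n" "mat_vanishes 1 E"
  shows "mat_series (\<lambda>l. if l \<le> 1 then 1 else 0) E = 1\<^sub>m n + E"
proof (rule eq_matI)
  fix i j assume "i < dim_row (1\<^sub>m n + E)" "j < dim_col (1\<^sub>m n + E)"
  then have ij: "i < n" "j < n" using E by auto
  show "mat_series (\<lambda>l. if l \<le> 1 then 1 else 0) E $$ (i, j) = (1\<^sub>m n + E) $$ (i, j)"
  proof (rule mps_eqI)
    fix m
    have "(\<Sum>l\<le>Suc (size m). (if l \<le> 1 then 1 else 0) * mps_nth ((E ^\<^sub>m l) $$ (i, j)) m)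
        = (\<Sum>l\<in>{0, 1}. mps_nth ((E ^\<^sub>m l) $$ (i, j)) m)"
      by (rule sum.mono_neutral_cong_right) auto
    then show "mps_nth (mat_series (\<lambda>l. if l \<le> 1 then 1 else 0) E $$ (i, j)) m = mps_nth ((1\<^sub>m n + E) $$ (i, j)) m"
      using E ij by (simp add: mat_series_nth[OF E ij le_SucI[OF order_refl]])
  qed
qed (use E in \<open>auto simp: mat_series_def\<close>)

lemma mat_series_vanishes_1:
  assumes E: "E \<in> carrier_mat n n" "mat_vanishes 1 E" and "c 0 = 1"
  shows "mat_vanishes 1 (mat_series c E - 1\<^sub>m n)"
  using assms by (auto simp: mat_vanishes_def vanishes_Suc_0_iff mat_series_def)

text \<open>The geometric series: the alternating signs convolved with the coefficients of 1 + X
  leave only the constant 1.\<close>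

lemma mat_series_inverse:
  fixes E :: "('i, 'a::comm_ring_1) mps mat"
  assumes E: "E \<in> carrier_mat n n" "mat_vanishes 1 E"
  shows "mat_series (\<lambda>l. (-1) ^ l) E * (1\<^sub>m n + E) = 1\<^sub>m n"
proof -
  have "(\<Sum>k\<le>l. (-1) ^ k * (if l - k \<le> 1 then 1 else 0)) = (if l = 0 then 1 else (0::'a))" for l :: nat
  proof (cases l)
    case (Suc l')
    have "(\<Sum>k\<le>l. (-1) ^ k * (if l - k \<le> 1 then 1 else 0)) = (\<Sum>k\<in>{l', l}. (-1::'a) ^ k)"
      by (rule sum.mono_neutral_cong_right) (auto simp: Suc)
    then show ?thesis by (simp add: Suc)
  qed simp
  then show ?thesis
    unfolding mat_series_1_plus[OF E, symmetric] mat_series_mult[OF E]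
    using mat_series_1[OF E] by simp
qed

text \<open>Vandermonde's identity for 1/2 + 1/2 = 1: the coefficients (1/2 choose l) convolved with
  themselves give (1 choose l), the coefficients of 1 + X.\<close>

lemma mat_series_sqrt:
  fixes E :: "('i, 'a::field_char_0) mps mat"
  assumes E: "E \<in> carrier_mat n n" "mat_vanishes 1 E"
  shows "mat_series (\<lambda>l. (1/2) gchoose l) E * mat_series (\<lambda>l. (1/2) gchoose l) E = 1\<^sub>m n + E"
proof -
  have "(\<Sum>k\<le>l. ((1/2) gchoose k) * ((1/2) gchoose (l - k))) = (if l \<le> 1 then 1 else (0::'a))" for l :: nat
  proof -
    have "(\<Sum>k\<le>l. ((1/2) gchoose k) * ((1/2) gchoose (l - k))) = ((1 + 1)/2 :: 'a) gchoose l"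
      using gbinomial_Vandermonde[of "1/2 :: 'a" "1/2" l] by (simp add: atLeast0AtMost)
    also have "\<dots> = of_nat (1 choose l)" by (simp add: binomial_gbinomial)
    finally show ?thesis by (cases l) (auto simp: le_Suc_eq binomial_eq_0)
  qed
  then show ?thesis
    unfolding mat_series_1_plus[OF E, symmetric] mat_series_mult[OF E] by simp
qed

section \<open>Substitution of power series\<close>

text \<open>Subrings are plain subsets of a type-class ring, so that sums, powers, matrices and
  determinants keep their usual operations; the record rings of the statement are reached through
  \<open>ring_on\<close>.\<close>

locale class_subring =
  fixes R :: "'a::comm_ring_1 set"
  assumes one [simp, intro]: "1 \<in> R"
    and add [intro]: "x \<in> R \<Longrightarrow> y \<in> R \<Longrightarrow> x + y \<in> R"
    and mult [intro]: "x \<in> R \<Longrightarrow> y \<in> R \<Longrightarrow> x * y \<in> R"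
    and uminus [intro]: "x \<in> R \<Longrightarrow> - x \<in> R"
begin

lemma zero [simp, intro]: "0 \<in> R"
  using add[OF one uminus[OF one]] by simp

lemma diff [intro]: "x \<in> R \<Longrightarrow> y \<in> R \<Longrightarrow> x - y \<in> R"
  using add[of x "- y"] uminus[of y] by simp

lemma sum [intro]: "(\<And>i. i \<in> S \<Longrightarrow> f i \<in> R) \<Longrightarrow> sum f S \<in> R"
  by (induction S rule: infinite_finite_induct) auto

lemma prod [intro]: "(\<And>i. i \<in> S \<Longrightarrow> f i \<in> R) \<Longrightarrow> prod f S \<in> R"
  by (induction S rule: infinite_finite_induct) auto

lemma prod_mset [intro]: "(\<And>i. i \<in># a \<Longrightarrow> f i \<in> R) \<Longrightarrow> (\<Prod>i\<in>#a. f i) \<in> R"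
  by (induction a) auto

lemma power [intro]: "x \<in> R \<Longrightarrow> x ^ k \<in> R"
  by (induction k) auto

lemma of_nat [simp, intro]: "of_nat k \<in> R"
  by (induction k) auto

lemma of_int [simp, intro]: "of_int c \<in> R"
proof -
  obtain k where "c = int k \<or> c = - int k" using int_cases2[of c] by metis
  then have "(of_int c :: 'a) = of_nat k \<or> (of_int c :: 'a) = - of_nat k" by auto
  then show ?thesis using of_nat[of k] uminus by auto
qed

lemma mult_mat [intro]:
  assumes "X \<in> carrier_mat n m" "Y \<in> carrier_mat m l"
    and "\<And>i j. i < n \<Longrightarrow> j < m \<Longrightarrow> X $$ (i, j) \<in> R"
    and "\<And>i j. i < m \<Longrightarrow> j < l \<Longrightarrow> Y $$ (i, j) \<in> R" and "i < n" "j < l"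
  shows "(X * Y) $$ (i, j) \<in> R"
  unfolding mult_mat_index[OF assms(1,2,5,6)] using assms by (intro sum mult) auto

lemma pow_mat:
  assumes "X \<in> carrier_mat n n" "\<And>i j. i < n \<Longrightarrow> j < n \<Longrightarrow> X $$ (i, j) \<in> R" "i < n" "j < n"
  shows "(X ^\<^sub>m k) $$ (i, j) \<in> R"
  using assms(3,4)
proof (induction k arbitrary: i j)
  case (Suc k)
  show ?case
    unfolding pow_mat.simps
    by (rule mult_mat[OF pow_carrier_mat[OF assms(1)] assms(1)]) (use Suc assms in auto)
qed (use assms in auto)

lemma det:
  assumes "X \<in> carrier_mat n n" "\<And>i j. i < n \<Longrightarrow> j < n \<Longrightarrow> X $$ (i, j) \<in> R"
  shows "Determinant.det X \<in> R"
proof -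
  have "signof p \<in> R" for p
    by (auto simp: sign_def)
  then show ?thesis
    unfolding det_def'[OF assms(1)] using assms(2)
    by (intro sum mult prod) (auto simp: permutes_in_image)
qed

end

section \<open>Power series over a subring, and maps between them\<close>

definition series_over :: "'a::comm_ring_1 set \<Rightarrow> 'i set \<Rightarrow> ('i, 'a) mps set" where
  "series_over R I = {f. (\<forall>m. mps_nth f m \<in> R) \<and> (\<forall>m. mps_nth f m \<noteq> 0 \<longrightarrow> set_mset m \<subseteq> I)}"

lemma series_overI:
  "(\<And>m. mps_nth f m \<in> R) \<Longrightarrow> (\<And>m. mps_nth f m \<noteq> 0 \<Longrightarrow> set_mset m \<subseteq> I) \<Longrightarrow> f \<in> series_over R I"
  by (simp add: series_over_def)

lemma series_over_nth: "f \<in> series_over R I \<Longrightarrow> mps_nth f m \<in> R"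
  by (simp add: series_over_def)

lemma series_over_support: "f \<in> series_over R I \<Longrightarrow> \<not> set_mset m \<subseteq> I \<Longrightarrow> mps_nth f m = 0"
  by (auto simp: series_over_def)

lemma power_series_ring_eq:
  "power_series_ring A n = class_ring\<lparr>carrier := series_over (carrier A) ({..<n} \<times> {..<n})\<rparr>"
  by (simp add: power_series_ring_def series_over_def)

context class_subring begin

lemma class_subring_series: "class_subring (series_over R I :: ('i, 'a) mps set)"
proof
  show "1 \<in> (series_over R I :: ('i, 'a) mps set)"
    by (auto simp: series_over_def mps_nth_1)
next
  fix f g :: "('i, 'a) mps" assume fg: "f \<in> series_over R I" "g \<in> series_over R I"
  show "f + g \<in> series_over R I"
  proof (rule series_overI)
    fix m
    show "mps_nth (f + g) m \<in> R" using fg[THEN series_over_nth] by auto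
    assume "mps_nth (f + g) m \<noteq> 0"
    then have "mps_nth f m \<noteq> 0 \<or> mps_nth g m \<noteq> 0" by auto
    then show "set_mset m \<subseteq> I" using fg series_over_support by blast
  qed
  show "- f \<in> series_over R I"
    using fg by (auto simp: series_over_def)
  show "f * g \<in> series_over R I"
  proof (rule series_overI)
    fix m
    show "mps_nth (f * g) m \<in> R"
      unfolding mps_nth_mult by (intro sum mult fg[THEN series_over_nth])
    assume "mps_nth (f * g) m \<noteq> 0"
    then obtain a where a: "a \<subseteq># m" "mps_nth f a \<noteq> 0" "mps_nth g (m - a) \<noteq> 0"
      unfolding mps_nth_mult by (metis (mono_tags, lifting) mem_Collect_eq mult_not_zero sum.neutral)
    have "set_mset a \<subseteq> I" "set_mset (m - a) \<subseteq> I"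
      using a series_over_support[OF fg(1)] series_over_support[OF fg(2)] by blast+
    then have "set_mset (a + (m - a)) \<subseteq> I" by simp
    then show "set_mset m \<subseteq> I" using a(1) by (metis subset_mset.add_diff_inverse)
  qed
qed

lemma const_in_series [intro]: "c \<in> R \<Longrightarrow> mps_const c \<in> series_over R I"
  by (auto simp: series_over_def mps_nth_const)

lemma var_in_series [intro]: "i \<in> I \<Longrightarrow> mps_var i \<in> series_over R I"
  by (auto simp: series_over_def mps_nth_var)

lemma mat_series_in_series:
  assumes E: "E \<in> carrier_mat n n" "mat_vanishes 1 E"
    and "\<And>i j. i < n \<Longrightarrow> j < n \<Longrightarrow> E $$ (i, j) \<in> series_over R I" and "\<And>l. c l \<in> R" and ij: "i < n" "j < n"
  shows "mat_series c E $$ (i, j) \<in> series_over R I"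
proof -
  have pow: "(E ^\<^sub>m l) $$ (i, j) \<in> series_over R I" for l
    by (rule class_subring.pow_mat[OF class_subring_series E(1)]) (use assms in auto)
  show ?thesis
  proof (rule series_overI)
    fix m
    show "mps_nth (mat_series c E $$ (i, j)) m \<in> R"
      unfolding mat_series_nth[OF E ij order_refl] by (intro sum mult assms(4) series_over_nth[OF pow])
    assume "mps_nth (mat_series c E $$ (i, j)) m \<noteq> 0"
    then obtain l where "mps_nth ((E ^\<^sub>m l) $$ (i, j)) m \<noteq> 0"
      unfolding mat_series_nth[OF E ij order_refl] by (metis (mono_tags, lifting) mult_zero_right sum.neutral)
    then show "set_mset m \<subseteq> I" using series_over_support[OF pow] by blast
  qed
qed

end

text \<open>A homomorphism on \<open>R\<close> alone, with arbitrary values elsewhere: the Frobenius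
  lifts are functions on all complex numbers or on all series, and nothing is known about them off
  the ring in question.\<close>

definition hom_on :: "'a::comm_ring_1 set \<Rightarrow> ('a \<Rightarrow> 'b::comm_ring_1) \<Rightarrow> bool" where
  "hom_on R h \<longleftrightarrow> h 1 = 1 \<and> (\<forall>x\<in>R. \<forall>y\<in>R. h (x + y) = h x + h y \<and> h (x * y) = h x * h y)"

locale class_subring_hom = class_subring R for R :: "'a::comm_ring_1 set" +
  fixes h :: "'a \<Rightarrow> 'b::comm_ring_1"
  assumes hom_on: "hom_on R h"
begin

lemma hom_1 [simp]: "h 1 = 1"
  and hom_add: "x \<in> R \<Longrightarrow> y \<in> R \<Longrightarrow> h (x + y) = h x + h y"
  and hom_mult: "x \<in> R \<Longrightarrow> y \<in> R \<Longrightarrow> h (x * y) = h x * h y"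
  using hom_on by (auto simp: hom_on_def)

lemma hom_0 [simp]: "h 0 = 0"
  using hom_add[of 0 0] by simp

lemma hom_uminus: "x \<in> R \<Longrightarrow> h (- x) = - h x"
  using hom_add[of x "- x"] by (auto simp: eq_neg_iff_add_eq_0 add.commute)

lemma hom_diff: "x \<in> R \<Longrightarrow> y \<in> R \<Longrightarrow> h (x - y) = h x - h y"
  using hom_add[of x "- y"] hom_uminus[of y] by auto

lemma hom_sum: "(\<And>i. i \<in> S \<Longrightarrow> f i \<in> R) \<Longrightarrow> h (sum f S) = (\<Sum>i\<in>S. h (f i))"
proof (induction S rule: infinite_finite_induct)
  case (insert x S)
  then show ?case using hom_add[of "f x" "sum f S"] sum[of S f] by auto
qed auto

lemma hom_power: "x \<in> R \<Longrightarrow> h (x ^ k) = h x ^ k"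
proof (induction k)
  case (Suc k)
  then show ?case using hom_mult[of x "x ^ k"] power[of x k] by auto
qed auto

lemma hom_of_nat: "h (of_nat k) = of_nat k"
  by (induction k) (auto simp: hom_add)

lemma hom_mult_mat:
  assumes XY: "X \<in> carrier_mat n m" "Y \<in> carrier_mat m l"
    and "\<And>i j. i < n \<Longrightarrow> j < m \<Longrightarrow> X $$ (i, j) \<in> R"
    and "\<And>i j. i < m \<Longrightarrow> j < l \<Longrightarrow> Y $$ (i, j) \<in> R"
  shows "map_mat h (X * Y) = map_mat h X * map_mat h Y"
proof (rule eq_matI)
  fix i j assume "i < dim_row (map_mat h X * map_mat h Y)" "j < dim_col (map_mat h X * map_mat h Y)"
  then have ij: "i < n" "j < l" using XY by auto
  have "map_mat h (X * Y) $$ (i, j) = h ((X * Y) $$ (i, j))" using XY ij by simp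
  also have "\<dots> = (\<Sum>k<m. h (X $$ (i, k) * Y $$ (k, j)))"
    unfolding mult_mat_index[OF XY ij] by (rule hom_sum) (use assms ij in auto)
  also have "\<dots> = (\<Sum>k<m. map_mat h X $$ (i, k) * map_mat h Y $$ (k, j))"
    by (rule sum.cong) (use assms ij in \<open>auto simp: hom_mult\<close>)
  also have "\<dots> = (map_mat h X * map_mat h Y) $$ (i, j)"
    by (rule mult_mat_index[symmetric]) (use XY ij in auto)
  finally show "map_mat h (X * Y) $$ (i, j) = (map_mat h X * map_mat h Y) $$ (i, j)" .
qed (use XY in auto)

end

lemma finite_multisets_size_le: "finite I \<Longrightarrow> finite {a. set_mset a \<subseteq> I \<and> size a \<le> k}"
proof (rule finite_subset)
  show "{a. set_mset a \<subseteq> I \<and> size a \<le> k} \<subseteq> mset ` {xs. set xs \<subseteq> I \<and> length xs \<le> k}"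
  proof
    fix a assume "a \<in> {a. set_mset a \<subseteq> I \<and> size a \<le> k}"
    moreover obtain xs where "mset xs = a" using ex_mset by blast
    ultimately show "a \<in> mset ` {xs. set xs \<subseteq> I \<and> length xs \<le> k}" by force
  qed
qed (simp add: finite_lists_length_le)

lemma mps_nth_prod_var:
  "mps_nth (\<Prod>i\<in>#a. mps_var i :: ('i, 'a::comm_ring_1) mps) m = (if m = a then 1 else 0)"
proof (induction a arbitrary: m)
  case (add x a)
  have "mps_nth (\<Prod>i\<in>#add_mset x a. mps_var i :: ('i, 'a) mps) m
      = (\<Sum>b | b \<subseteq># m. if b = {#x#} \<and> m = add_mset x a then 1 else 0)"
    unfolding image_mset_add_mset prod_mset.add_mset mps_nth_mult
    by (rule sum.cong) (auto simp: add.IH mps_nth_var)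
  also have "\<dots> = (if m = add_mset x a then 1 else 0)"
    by (auto simp: sum.delta)
  finally show ?case .
qed (simp add: mps_nth_1)

text \<open>Meaningful only if the series \<open>t i\<close> have zero constant term: then monomials of degree above
  \<open>size m\<close> do not contribute to the coefficient at \<open>m\<close>.\<close>

definition mps_subst :: "'i set \<Rightarrow> ('a \<Rightarrow> 'b) \<Rightarrow> ('i \<Rightarrow> ('j, 'b) mps) \<Rightarrow> ('i, 'a) mps \<Rightarrow> ('j, 'b::comm_ring_1) mps" where
  "mps_subst I h t f = Abs_mps (\<lambda>m. \<Sum>a | set_mset a \<subseteq> I \<and> size a \<le> size m.
     h (mps_nth f a) * mps_nth (\<Prod>i\<in>#a. t i) m)"

text \<open>Compatibility with the powers of (T) stands for continuity; it is what makes such a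
  homomorphism determined by its values on constants and variables.\<close>

definition local_hom :: "'a::comm_ring_1 set \<Rightarrow> 'i set \<Rightarrow> (('i, 'a) mps \<Rightarrow> ('j, 'b::comm_ring_1) mps) \<Rightarrow> bool" where
  "local_hom R I H \<longleftrightarrow> hom_on (series_over R I) H \<and>
     (\<forall>k. \<forall>f\<in>series_over R I. vanishes k f \<longrightarrow> vanishes k (H f))"

locale substitution = class_subring_hom R h for R :: "'a::comm_ring_1 set" and h :: "'a \<Rightarrow> 'b::comm_ring_1" +
  fixes I :: "'i set" and t :: "'i \<Rightarrow> ('j, 'b) mps"
  assumes fin: "finite I" and t: "\<And>i. vanishes 1 (t i)"
begin

abbreviation "S \<equiv> mps_subst I h t"

abbreviation trunc :: "nat \<Rightarrow> ('i, 'a) mps \<Rightarrow> ('j, 'b) mps" where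
  "trunc k f \<equiv> \<Sum>a | set_mset a \<subseteq> I \<and> size a \<le> k. mps_const (h (mps_nth f a)) * (\<Prod>i\<in>#a. t i)"

lemma subst_nth:
  assumes "size m \<le> k"
  shows "mps_nth (S f) m = (\<Sum>a | set_mset a \<subseteq> I \<and> size a \<le> k. h (mps_nth f a) * mps_nth (\<Prod>i\<in>#a. t i) m)"
proof -
  have "mps_nth (\<Prod>i\<in>#a. t i) m = 0" if "\<not> size a \<le> size m" for a
    using vanishesD[OF vanishes_prod_mset[of t a]] t that by auto
  then show ?thesis
    unfolding mps_subst_def mps_nth_Abs
    by (intro sum.mono_neutral_left) (use assms fin finite_multisets_size_le in auto)
qed

lemma subst_trunc: "vanishes (Suc k) (S f - trunc k f)"
  by (simp add: vanishes_def subst_nth[of _ k])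

lemma subst_const [simp]: "S (mps_const c) = mps_const (h c)"
proof (rule mps_eqI)
  fix m
  have "mps_nth (S (mps_const c)) m
      = (\<Sum>a | set_mset a \<subseteq> I \<and> size a \<le> size m. if a = {#} then h c * mps_nth 1 m else 0)"
    unfolding subst_nth[OF order_refl] by (rule sum.cong) (auto simp: mps_nth_const)
  also have "\<dots> = h c * mps_nth 1 m"
    using fin by (simp add: sum.delta finite_multisets_size_le)
  finally show "mps_nth (S (mps_const c)) m = mps_nth (mps_const (h c)) m"
    by (simp add: mps_nth_const mps_nth_1)
qed

lemma subst_var [simp]:
  assumes "i \<in> I" shows "S (mps_var i) = t i"
proof (rule mps_eqI)
  fix m
  have "mps_nth (S (mps_var i)) m
      = (\<Sum>a | set_mset a \<subseteq> I \<and> size a \<le> Suc (size m). if a = {#i#} then mps_nth (t i) m else 0)"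
    unfolding subst_nth[OF le_SucI[OF order_refl]] by (rule sum.cong) (auto simp: mps_nth_var)
  also have "\<dots> = mps_nth (t i) m"
    using fin assms by (simp add: sum.delta finite_multisets_size_le)
  finally show "mps_nth (S (mps_var i)) m = mps_nth (t i) m" .
qed

lemma subst_add:
  "f \<in> series_over R I \<Longrightarrow> g \<in> series_over R I \<Longrightarrow> S (f + g) = S f + S g"
  by (rule mps_eqI)
    (simp add: subst_nth[OF order_refl] hom_add series_over_nth distrib_right sum.distrib)

lemma sum_multiset_triangle:
  fixes F :: "'i multiset \<Rightarrow> 'i multiset \<Rightarrow> ('j, 'b) mps"
  shows "(\<Sum>a | set_mset a \<subseteq> I \<and> size a \<le> k. \<Sum>b | b \<subseteq># a. F b (a - b))
    = (\<Sum>(b, c)\<in>{(b, c). set_mset b \<subseteq> I \<and> set_mset c \<subseteq> I \<and> size b + size c \<le> k}. F b c)"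
proof -
  have "(\<Sum>a | set_mset a \<subseteq> I \<and> size a \<le> k. \<Sum>b | b \<subseteq># a. F b (a - b))
      = (\<Sum>(a, b)\<in>Sigma {a. set_mset a \<subseteq> I \<and> size a \<le> k} (\<lambda>a. {b. b \<subseteq># a}). F b (a - b))"
    by (rule sum.Sigma) (use fin finite_multisets_size_le in auto)
  also have "\<dots> = (\<Sum>(b, c)\<in>{(b, c). set_mset b \<subseteq> I \<and> set_mset c \<subseteq> I \<and> size b + size c \<le> k}. F b c)"
    by (rule sum.reindex_bij_witness[where i = "\<lambda>(b, c). (b + c, b)" and j = "\<lambda>(a, b). (b, a - b)"])
       (auto simp: size_Diff_submset size_mset_mono dest: in_diffD mset_subset_eqD)
  finally show ?thesis .
qed

text \<open>The product of the truncations at degree \<open>k\<close> differs from the truncation of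
  the product only by pairs of monomials of total degree above \<open>k\<close>, and these vanish to
  order \<open>k + 1\<close> once series without constant term are substituted.\<close>

lemma subst_mult:
  assumes fg: "f \<in> series_over R I" "g \<in> series_over R I"
  shows "S (f * g) = S f * S g"
proof (rule mps_eq_if_cong)
  fix k
  let ?M = "{a. set_mset a \<subseteq> I \<and> size a \<le> k}"
  let ?T = "{(b, c). set_mset b \<subseteq> I \<and> set_mset c \<subseteq> I \<and> size b + size c \<le> k}"
  define F where "F = (\<lambda>b c. mps_const (h (mps_nth f b) * h (mps_nth g c)) * (\<Prod>i\<in>#b + c. t i))"
  have "trunc k (f * g) = (\<Sum>a\<in>?M. \<Sum>b | b \<subseteq># a. F b (a - b))"
  proof (rule sum.cong)
    fix a assume "a \<in> ?M"
    have "h (mps_nth (f * g) a) = (\<Sum>b | b \<subseteq># a. h (mps_nth f b) * h (mps_nth g (a - b)))"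
      unfolding mps_nth_mult using fg
      by (subst hom_sum) (auto simp: hom_mult series_over_nth)
    then show "mps_const (h (mps_nth (f * g) a)) * (\<Prod>i\<in>#a. t i) = (\<Sum>b | b \<subseteq># a. F b (a - b))"
      by (auto simp: mps_const.hom_sum sum_distrib_right F_def simp flip: prod_mset.union image_mset_union
          intro!: sum.cong)
  qed simp
  then have 1: "trunc k (f * g) = (\<Sum>(b, c)\<in>?T. F b c)"
    by (simp add: sum_multiset_triangle)
  have "trunc k f * trunc k g = (\<Sum>(b, c)\<in>?M \<times> ?M. F b c)"
    by (simp add: sum_product sum.cartesian_product F_def mps_const.hom_mult mult_ac)
  also have "\<dots> = (\<Sum>(b, c)\<in>?T. F b c) + (\<Sum>(b, c)\<in>?M \<times> ?M - ?T. F b c)"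
    by (subst sum.subset_diff[of ?T]) (use fin finite_multisets_size_le in \<open>auto simp: add.commute\<close>)
  finally have 2: "trunc k f * trunc k g = trunc k (f * g) + (\<Sum>(b, c)\<in>?M \<times> ?M - ?T. F b c)"
    unfolding 1 .
  have "vanishes (Suc k) (\<Sum>(b, c)\<in>?M \<times> ?M - ?T. F b c)"
  proof (rule vanishes_sum)
    fix bc assume bc: "bc \<in> ?M \<times> ?M - ?T"
    obtain b c where [simp]: "bc = (b, c)" by (cases bc)
    have "(b, c) \<in> ?M \<times> ?M" "(b, c) \<notin> ?T" using bc by auto
    then have "Suc k \<le> size (b + c)" by auto
    then have "vanishes (Suc k) (\<Prod>i\<in>#b + c. t i)"
      by (rule vanishes_mono[OF vanishes_prod_mset[OF t]])
    then show "vanishes (Suc k) (case bc of (b, c) \<Rightarrow> F b c)"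
      unfolding F_def by (simp only: \<open>bc = (b, c)\<close> prod.case vanishes_mult_right)
  qed
  then have "vanishes (Suc k) (trunc k f * trunc k g - trunc k (f * g))"
    unfolding 2 by simp
  moreover have "vanishes (Suc k) (S f * S g - trunc k f * trunc k g)"
    by (intro vanishes_cong_mult subst_trunc)
  ultimately have "vanishes (Suc k) (S (f * g) - S f * S g)"
    using subst_trunc[of k "f * g"] vanishes_cong_trans vanishes_cong_sym by blast
  then show "vanishes k (S (f * g) - S f * S g)"
    by (rule vanishes_mono) simp
qed

lemma subst_vanishes:
  assumes "vanishes k f" shows "vanishes k (S f)"
  unfolding vanishes_def
proof (intro allI impI)
  fix m :: "'j multiset" assume "size m < k"
  then show "mps_nth (S f) m = 0"
    unfolding subst_nth[OF order_refl] by (intro sum.neutral) (auto simp: vanishesD[OF assms])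
qed

lemma local_hom_subst: "local_hom R I S"
  using subst_const[of 1] subst_vanishes
  by (auto simp: local_hom_def hom_on_def subst_add subst_mult simp del: subst_const)

lemma subst_in_series:
  assumes "class_subring R'" and "\<And>x. x \<in> R \<Longrightarrow> h x \<in> R'" and "\<And>i. i \<in> I \<Longrightarrow> t i \<in> series_over R' I'"
    and f: "f \<in> series_over R I"
  shows "S f \<in> series_over R' I'"
proof -
  interpret R': class_subring R' by fact
  have mon: "(\<Prod>i\<in>#a. t i) \<in> series_over R' I'" if "set_mset a \<subseteq> I" for a
    by (rule class_subring.prod_mset[OF R'.class_subring_series]) (use assms(3) that in auto)
  show ?thesis
  proof (rule series_overI)
    fix m
    show "mps_nth (S f) m \<in> R'"
      unfolding subst_nth[OF order_refl]
    proof (intro R'.sum R'.mult)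
      fix a assume a: "a \<in> {a. set_mset a \<subseteq> I \<and> size a \<le> size m}"
      show "h (mps_nth f a) \<in> R'" by (rule assms(2)[OF series_over_nth[OF f]])
      show "mps_nth (\<Prod>i\<in>#a. t i) m \<in> R'" by (rule series_over_nth[OF mon]) (use a in simp)
    qed
    assume "mps_nth (S f) m \<noteq> 0"
    then obtain a where "set_mset a \<subseteq> I" "mps_nth (\<Prod>i\<in>#a. t i) m \<noteq> 0"
      unfolding subst_nth[OF order_refl]
      by (metis (mono_tags, lifting) mem_Collect_eq mult_zero_right sum.neutral)
    then show "set_mset m \<subseteq> I'" using series_over_support[OF mon] by blast
  qed
qed

end

lemma local_hom_comp:
  assumes "local_hom R I G" "local_hom R' I' H" "\<And>f. f \<in> series_over R I \<Longrightarrow> G f \<in> series_over R' I'"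
  shows "local_hom R I (\<lambda>f. H (G f))"
  using assms by (auto simp: local_hom_def hom_on_def)

text \<open>T-adic density, stated for any subring \<open>P\<close> containing constants and
  variables because it is used in two ways: \<open>P\<close> is the coordinate ring when elements of
  A[[T]] are approximated by it, and the set where two homomorphisms agree in
  \<open>local_hom_eqI\<close>.\<close>

lemma series_poly_approx:
  assumes "finite I" "class_subring P" and f: "f \<in> series_over R I"
    and const: "\<And>c. c \<in> R \<Longrightarrow> mps_const c \<in> P" and var: "\<And>i. i \<in> I \<Longrightarrow> mps_var i \<in> P"
  shows "\<exists>g\<in>P. vanishes k (f - g)"
proof -
  interpret P: class_subring P by fact
  let ?M = "{a. set_mset a \<subseteq> I \<and> size a \<le> k}"
  define g where "g = (\<Sum>a\<in>?M. mps_const (mps_nth f a) * (\<Prod>i\<in>#a. mps_var i))"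
  have "(\<Prod>i\<in>#a. mps_var i) \<in> P" if "a \<in> ?M" for a
    using var that by (intro P.prod_mset) auto
  then have "g \<in> P"
    unfolding g_def using const series_over_nth[OF f] by (intro P.sum P.mult) auto
  moreover have "vanishes (Suc k) (f - g)"
    unfolding vanishes_def
  proof (intro allI impI)
    fix m :: "'a multiset" assume "size m < Suc k"
    have "mps_nth g m = (\<Sum>a\<in>?M. if a = m then mps_nth f m else 0)"
      unfolding g_def mps_nth_sum by (rule sum.cong) (auto simp: mps_nth_prod_var)
    also have "\<dots> = mps_nth f m"
      using finite_multisets_size_le[OF assms(1)] \<open>size m < Suc k\<close> series_over_support[OF f, of m]
      by (auto simp: sum.delta)
    finally show "mps_nth (f - g) m = 0" by simp
  qed
  then have "vanishes k (f - g)" by (rule vanishes_mono) simp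
  ultimately show ?thesis by blast
qed

lemma local_hom_eqI:
  assumes "class_subring R" "finite I" and G: "local_hom R I G" and H: "local_hom R I H"
    and const: "\<And>c. c \<in> R \<Longrightarrow> G (mps_const c) = H (mps_const c)"
    and var: "\<And>i. i \<in> I \<Longrightarrow> G (mps_var i) = H (mps_var i)"
    and f: "f \<in> series_over R I"
  shows "G f = H f"
proof (rule mps_eq_if_cong)
  fix k
  interpret R: class_subring R by fact
  interpret K: class_subring "series_over R I" by (rule R.class_subring_series)
  interpret G: class_subring_hom "series_over R I" G
    using G by unfold_locales (simp add: local_hom_def)
  interpret H: class_subring_hom "series_over R I" H
    using H by unfold_locales (simp add: local_hom_def)
  have "class_subring {g \<in> series_over R I. G g = H g}"
    by unfold_locales
      (auto simp: G.hom_add H.hom_add G.hom_mult H.hom_mult G.hom_uminus H.hom_uminus)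
  then obtain g where g: "g \<in> series_over R I" "G g = H g" and fg: "vanishes k (f - g)"
    using series_poly_approx[OF assms(2) _ f, of "{g \<in> series_over R I. G g = H g}" k] const var by blast
  have "vanishes k (G (f - g))" "vanishes k (H (f - g))"
    using G H fg K.diff[OF f g(1)] unfolding local_hom_def by auto
  then show "vanishes k (G f - H f)"
    using vanishes_diff[of k "G f - G g" "H f - H g"] G.hom_diff[OF f g(1)] H.hom_diff[OF f g(1)] g(2)
    by simp
qed

section \<open>The cyclotomic ring\<close>

lemma class_subring_generate: "class_subring (generate_ring (class_ring :: 'a::comm_ring_1 ring) H)"
  by unfold_locales
    (use generate_ring.one[of "class_ring :: 'a ring"] generate_ring.a_inv[of _ "class_ring :: 'a ring"]
      generate_ring.eng_add[of _ "class_ring :: 'a ring"] generate_ring.eng_mult[of _ "class_ring :: 'a ring"]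
     in \<open>auto simp: class_ring_simps\<close>)

lemma carrier_cyclotomic_ring:
  "carrier (cyclotomic_ring M \<zeta>) = generate_ring class_ring {1 / of_nat M, \<zeta>}"
  by (simp add: cyclotomic_ring_def)

text \<open>An element of \<open>\<int>[\<zeta>]\<close> is encoded by an integral matrix describing multiplication by it on the
  generators \<open>1, \<zeta>, \<dots>, \<zeta>\<^sup>N\<^sup>-\<^sup>1\<close>.\<close>

definition int_multiplier :: "nat \<Rightarrow> complex \<Rightarrow> complex set" where
  "int_multiplier N \<zeta> = {x. \<exists>B :: nat \<Rightarrow> nat \<Rightarrow> int. \<forall>i<N. x * \<zeta> ^ i = (\<Sum>j<N. of_int (B i j) * \<zeta> ^ j)}"

lemma int_multiplierI:
  fixes B :: "nat \<Rightarrow> nat \<Rightarrow> int"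
  assumes "\<And>i. i < N \<Longrightarrow> x * \<zeta> ^ i = (\<Sum>j<N. of_int (B i j) * \<zeta> ^ j)"
  shows "x \<in> int_multiplier N \<zeta>"
  using assms unfolding int_multiplier_def by blast

lemma class_subring_int_multiplier: "class_subring (int_multiplier N \<zeta>)"
proof
  have "1 * \<zeta> ^ i = (\<Sum>j<N. of_int (if j = i then 1 else 0) * \<zeta> ^ j)" if "i < N" for i
  proof -
    have "(\<Sum>j<N. of_int (if j = i then 1 else 0) * \<zeta> ^ j) = (\<Sum>j<N. if j = i then \<zeta> ^ j else 0)"
      by (rule sum.cong) auto
    then show ?thesis using that by (simp add: sum.delta)
  qed
  then show "1 \<in> int_multiplier N \<zeta>" by (rule int_multiplierI)
next
  fix x y assume "x \<in> int_multiplier N \<zeta>" "y \<in> int_multiplier N \<zeta>"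
  then obtain B C :: "nat \<Rightarrow> nat \<Rightarrow> int" where B: "\<And>i. i < N \<Longrightarrow> x * \<zeta> ^ i = (\<Sum>j<N. of_int (B i j) * \<zeta> ^ j)"
    and C: "\<And>i. i < N \<Longrightarrow> y * \<zeta> ^ i = (\<Sum>j<N. of_int (C i j) * \<zeta> ^ j)"
    unfolding int_multiplier_def by blast
  have "(x + y) * \<zeta> ^ i = (\<Sum>j<N. of_int (B i j + C i j) * \<zeta> ^ j)" if "i < N" for i
    using B C that by (simp add: distrib_right sum.distrib)
  then show "x + y \<in> int_multiplier N \<zeta>" by (rule int_multiplierI)
  have "(x * y) * \<zeta> ^ i = (\<Sum>k<N. of_int (\<Sum>j<N. C i j * B j k) * \<zeta> ^ k)" if "i < N" for i
  proof -
    have "(x * y) * \<zeta> ^ i = x * (\<Sum>j<N. of_int (C i j) * \<zeta> ^ j)"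
      using C that by (simp add: mult.assoc)
    also have "\<dots> = (\<Sum>j<N. of_int (C i j) * (x * \<zeta> ^ j))"
      by (simp add: sum_distrib_left mult_ac)
    also have "\<dots> = (\<Sum>j<N. \<Sum>k<N. of_int (C i j * B j k) * \<zeta> ^ k)"
      by (simp add: B sum_distrib_left mult_ac)
    also have "\<dots> = (\<Sum>k<N. of_int (\<Sum>j<N. C i j * B j k) * \<zeta> ^ k)"
      by (subst sum.swap) (simp add: sum_distrib_right)
    finally show ?thesis .
  qed
  then show "x * y \<in> int_multiplier N \<zeta>" by (rule int_multiplierI)
next
  fix x assume "x \<in> int_multiplier N \<zeta>"
  then obtain B :: "nat \<Rightarrow> nat \<Rightarrow> int" where B: "\<And>i. i < N \<Longrightarrow> x * \<zeta> ^ i = (\<Sum>j<N. of_int (B i j) * \<zeta> ^ j)"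
    unfolding int_multiplier_def by blast
  then have "- x * \<zeta> ^ i = (\<Sum>j<N. of_int (- B i j) * \<zeta> ^ j)" if "i < N" for i
    using that by (simp add: sum_negf)
  then show "- x \<in> int_multiplier N \<zeta>" by (rule int_multiplierI)
qed

lemma zeta_int_multiplier:
  assumes "\<zeta> ^ N = 1" "N \<ge> 1"
  shows "\<zeta> \<in> int_multiplier N \<zeta>"
proof -
  have "\<zeta> * \<zeta> ^ i = (\<Sum>j<N. of_int (if j = Suc i mod N then 1 else 0) * \<zeta> ^ j)" if "i < N" for i
  proof -
    have "(\<Sum>j<N. of_int (if j = Suc i mod N then 1 else 0) * \<zeta> ^ j)
        = (\<Sum>j<N. if j = Suc i mod N then \<zeta> ^ j else 0)"
      by (rule sum.cong) auto
    also have "\<dots> = \<zeta> ^ (Suc i mod N)" using assms by (simp add: sum.delta)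
    also have "\<dots> = \<zeta> ^ Suc i"
      using assms that by (cases "Suc i = N") auto
    finally show ?thesis by simp
  qed
  then show ?thesis by (rule int_multiplierI)
qed

text \<open>The vector of the powers of \<zeta> is an eigenvector, with eigenvalue \<open>x\<close>,
  of the integral matrix encoding \<open>x\<close>. Hence \<open>x\<close> is a root of a monic
  integral characteristic polynomial. The entry \<zeta>^0 = 1 makes the vector nonzero.\<close>

lemma int_multiplier_algebraic_int:
  assumes "x \<in> int_multiplier N \<zeta>" "N \<ge> 1"
  shows "algebraic_int x"
proof -
  obtain B :: "nat \<Rightarrow> nat \<Rightarrow> int" where B: "\<And>i. i < N \<Longrightarrow> x * \<zeta> ^ i = (\<Sum>j<N. of_int (B i j) * \<zeta> ^ j)"
    using assms(1) unfolding int_multiplier_def by blast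
  define C where "C = mat N N (\<lambda>(i, j). B i j)"
  define v where "v = vec N (\<lambda>i. \<zeta> ^ i)"
  have C: "C \<in> carrier_mat N N" by (simp add: C_def)
  have C': "map_mat of_int C \<in> carrier_mat N N" by (simp add: C_def)
  have "v $ 0 \<noteq> 0" using assms(2) by (simp add: v_def)
  then have "v \<noteq> 0\<^sub>v N" using assms(2) by auto
  moreover have "map_mat of_int C *\<^sub>v v = x \<cdot>\<^sub>v v"
    by (rule eq_vecI) (auto simp: C_def v_def B scalar_prod_def lessThan_atLeast0)
  ultimately have "eigenvector (map_mat of_int C) v x"
    using C by (auto simp: eigenvector_def v_def)
  then have "eigenvalue (map_mat of_int C) x" by (auto simp: eigenvalue_def)
  then have "poly (map_poly of_int (char_poly C)) x = 0"
    unfolding eigenvalue_root_char_poly[OF C'] of_int_hom.char_poly_hom[OF C] .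
  then show ?thesis
    using degree_monic_char_poly[OF C] by (auto simp: algebraic_int_altdef_ipoly)
qed

text \<open>Factors X may be cancelled because \<open>z\<close> is not zero. The resulting relation
  c + z Q(z) = 0 exhibits a nonzero integer as a multiple of \<open>z\<close>.\<close>

lemma nonzero_const_coeff_root:
  fixes z :: complex and P :: "int poly"
  assumes "z \<noteq> 0" "P \<noteq> 0" "poly (map_poly of_int P) z = 0"
  shows "\<exists>c Q. c \<noteq> 0 \<and> poly (map_poly of_int (pCons c Q)) z = 0"
  using assms
proof (induction P)
  case (pCons a P)
  show ?case
  proof (cases "a = 0")
    case True
    then have "P \<noteq> 0" using pCons.prems by auto
    moreover have "poly (map_poly of_int P) z = 0"
      using pCons.prems True by (simp add: map_poly_pCons)
    ultimately show ?thesis using pCons.IH pCons.prems(1) by blast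
  qed (use pCons in blast)
qed simp

lemma int_poly_in_int_multiplier:
  assumes "z \<in> int_multiplier N \<zeta>"
  shows "poly (map_poly of_int Q) z \<in> int_multiplier N \<zeta>"
proof -
  interpret class_subring "int_multiplier N \<zeta>" by (rule class_subring_int_multiplier)
  show ?thesis
    by (induction Q) (use assms in \<open>auto simp: map_poly_pCons\<close>)
qed

lemma cyclotomic_denominator:
  assumes "\<zeta> ^ N = 1" "N \<ge> 1" "M > 0" "x \<in> carrier (cyclotomic_ring M \<zeta>)"
  shows "\<exists>s. of_nat M ^ s * x \<in> int_multiplier N \<zeta>"
  using assms(4) unfolding carrier_cyclotomic_ring
proof (induction rule: generate_ring.induct)
  interpret class_subring "int_multiplier N \<zeta>" by (rule class_subring_int_multiplier)
  {
    case one
    show ?case by (rule exI[of _ 0]) simp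
  next
    case (incl h)
    then consider "h = 1 / of_nat M" | "h = \<zeta>" by auto
    then show ?case
    proof cases
      case 1
      then show ?thesis using assms(3) by (intro exI[of _ 1]) simp
    next
      case 2
      then show ?thesis using zeta_int_multiplier[OF assms(1,2)] by (intro exI[of _ 0]) simp
    qed
  next
    case (a_inv h)
    then show ?case using uminus by (auto simp: class_ring_simps)
  next
    case (eng_add h1 h2)
    then obtain s t where st: "of_nat M ^ s * h1 \<in> int_multiplier N \<zeta>" "of_nat M ^ t * h2 \<in> int_multiplier N \<zeta>"
      by blast
    have "of_nat M ^ (s + t) * (h1 + h2) = of_nat M ^ t * (of_nat M ^ s * h1) + of_nat M ^ s * (of_nat M ^ t * h2)"
      by (simp add: algebra_simps power_add)
    moreover have "\<dots> \<in> int_multiplier N \<zeta>"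
      by (intro add mult[OF power[OF of_nat] st(1)] mult[OF power[OF of_nat] st(2)])
    ultimately show ?case by (intro exI[of _ "s + t"]) simp
  next
    case (eng_mult h1 h2)
    then obtain s t where st: "of_nat M ^ s * h1 \<in> int_multiplier N \<zeta>" "of_nat M ^ t * h2 \<in> int_multiplier N \<zeta>"
      by blast
    have "of_nat M ^ (s + t) * (h1 * h2) = (of_nat M ^ s * h1) * (of_nat M ^ t * h2)"
      by (simp add: algebra_simps power_add)
    then have "of_nat M ^ (s + t) * (h1 * h2) \<in> int_multiplier N \<zeta>" using mult[OF st] by (metis (no_types))
    then show ?case by (intro exI[of _ "s + t"]) simp
  }
qed

lemma int_multiplier_subset_cyclotomic:
  assumes "N \<ge> 1" "x \<in> int_multiplier N \<zeta>"
  shows "x \<in> carrier (cyclotomic_ring M \<zeta>)"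
proof -
  interpret A: class_subring "carrier (cyclotomic_ring M \<zeta>)"
    unfolding carrier_cyclotomic_ring by (rule class_subring_generate)
  obtain B :: "nat \<Rightarrow> nat \<Rightarrow> int" where B: "\<And>i. i < N \<Longrightarrow> x * \<zeta> ^ i = (\<Sum>j<N. of_int (B i j) * \<zeta> ^ j)"
    using assms(2) unfolding int_multiplier_def by blast
  have zeta: "\<zeta> \<in> carrier (cyclotomic_ring M \<zeta>)"
    unfolding carrier_cyclotomic_ring by (rule generate_ring.incl) simp
  have "x = (\<Sum>j<N. of_int (B 0 j) * \<zeta> ^ j)" using B[of 0] assms(1) by simp
  also have "\<dots> \<in> carrier (cyclotomic_ring M \<zeta>)"
    by (intro A.sum A.mult A.power A.of_int zeta)
  finally show ?thesis .
qed

text \<open>A nonzero \<open>x\<close> yields, after clearing powers of \<open>M\<close>, a nonzero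
  integer \<open>c\<close> that is a multiple of it. If p^k divides \<open>x\<close> in A, then c /
  p^k times a power of \<open>M\<close> is an algebraic integer and rational, hence an integer; as
  \<open>p\<close> does not divide \<open>M\<close>, p^k divides \<open>c\<close>. No nonzero
  integer allows this for every k.\<close>

lemma cyclotomic_separated:
  assumes "\<zeta> ^ N = 1" "N \<ge> 1" "M > 0" "prime p" "\<not> p dvd M"
    and x: "x \<in> carrier (cyclotomic_ring M \<zeta>)"
    and div: "\<And>k. \<exists>y\<in>carrier (cyclotomic_ring M \<zeta>). x = of_nat p ^ k * y"
  shows "x = 0"
proof (rule ccontr)
  assume "x \<noteq> 0"
  interpret Z: class_subring "int_multiplier N \<zeta>" by (rule class_subring_int_multiplier)
  interpret A: class_subring "carrier (cyclotomic_ring M \<zeta>)"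
    unfolding carrier_cyclotomic_ring by (rule class_subring_generate)
  obtain s where s: "of_nat M ^ s * x \<in> int_multiplier N \<zeta>"
    using cyclotomic_denominator[OF assms(1-3) x] by blast
  define z where "z = of_nat M ^ s * x"
  have z: "z \<noteq> 0" "z \<in> int_multiplier N \<zeta>" using s \<open>x \<noteq> 0\<close> assms(3) by (auto simp: z_def)
  obtain P :: "int poly" where P: "poly (map_poly of_int P) z = 0" "lead_coeff P = 1"
    using int_multiplier_algebraic_int[OF z(2) assms(2)] unfolding algebraic_int_altdef_ipoly by blast
  then obtain c Q where c: "c \<noteq> 0" "poly (map_poly of_int (pCons c Q)) z = 0"
    using nonzero_const_coeff_root[OF z(1), of P] by force
  define w where "w = - poly (map_poly of_int Q) z"
  have w: "w \<in> int_multiplier N \<zeta>" unfolding w_def by (intro Z.uminus int_poly_in_int_multiplier z)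
  have cw: "of_int c = z * w" 
  proof -
    have "poly (map_poly of_int (pCons c Q)) z = of_int c + z * poly (map_poly of_int Q) z"
      by (subst map_poly_pCons) (use c(1) in auto)
    then show ?thesis using c(2) by (simp add: w_def eq_neg_iff_add_eq_0)
  qed
  have dvd: "int p ^ k dvd c" for k
  proof -
    obtain y where y: "y \<in> carrier (cyclotomic_ring M \<zeta>)" "x = of_nat p ^ k * y" using div by blast
    have "of_nat M ^ s * y * w \<in> carrier (cyclotomic_ring M \<zeta>)"
      using y w int_multiplier_subset_cyclotomic[OF assms(2)] by (intro A.mult A.power A.of_nat)
    then obtain t where t: "of_nat M ^ t * (of_nat M ^ s * y * w) \<in> int_multiplier N \<zeta>"
      using cyclotomic_denominator[OF assms(1-3)] by blast
    \<comment> \<open>\<open>u\<close> equals M^t c / p^k, so it is rational; the choice of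
      \<open>t\<close> makes it integral over the integers.\<close>
    define u where "u = of_nat M ^ t * (of_nat M ^ s * y * w)"
    have u: "of_nat p ^ k * u = of_nat M ^ t * of_int c"
      unfolding cw z_def y(2) u_def by (simp add: mult_ac)
    then have "u = of_nat M ^ t * of_int c / of_nat p ^ k"
      using assms(4) by (simp add: field_simps prime_gt_0_nat)
    then have "u \<in> \<rat>" by auto
    then have "u \<in> \<int>"
      using rational_algebraic_int_is_int int_multiplier_algebraic_int[OF _ assms(2)] t u_def by blast
    then obtain r where "u = of_int r" by (auto elim: Ints_cases)
    then have "of_int (int p ^ k * r) = (of_int (int M ^ t * c) :: complex)" using u by simp
    then have "int p ^ k * r = int M ^ t * c" by (simp only: of_int_eq_iff)
    then have "int p ^ k dvd int M ^ t * c" by (metis dvd_triv_left)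
    moreover have "coprime (int p ^ k) (int M ^ t)"
      using assms(4,5) by (intro coprime_power_left_iff[THEN iffD2] coprime_power_right_iff[THEN iffD2] disjI1)
        (simp add: prime_imp_coprime)
    ultimately show ?thesis by (simp add: coprime_dvd_mult_right_iff)
  qed
  have "\<bar>c\<bar> < int p ^ nat \<bar>c\<bar>"
  proof -
    have "nat \<bar>c\<bar> < p ^ nat \<bar>c\<bar>" using assms(4) by (intro less_exp[THEN less_le_trans] power_mono prime_ge_2_nat) auto
    then show ?thesis using of_nat_less_iff[of "nat \<bar>c\<bar>" "p ^ nat \<bar>c\<bar>", where ?'a = int] by simp
  qed
  then show False using dvd_imp_le_int[OF c(1) dvd, of "nat \<bar>c\<bar>"] by simp
qed

lemma half_in_cyclotomic:
  assumes "even M" "M > 0"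
  shows "1 / 2 \<in> carrier (cyclotomic_ring M \<zeta>)"
proof -
  interpret A: class_subring "carrier (cyclotomic_ring M \<zeta>)"
    unfolding carrier_cyclotomic_ring by (rule class_subring_generate)
  obtain k where k: "M = 2 * k" using assms by blast
  have "1 / of_nat M \<in> carrier (cyclotomic_ring M \<zeta>)"
    unfolding carrier_cyclotomic_ring by (rule generate_ring.incl) simp
  then have "of_nat k * (1 / of_nat M) \<in> carrier (cyclotomic_ring M \<zeta>)" by (rule A.mult[OF A.of_nat])
  moreover have "of_nat k * (1 / of_nat M) = (1 / 2 :: complex)" using k assms by (auto simp: field_simps)
  ultimately show ?thesis by metis
qed

text \<open>The two end terms of the convolution identity sum_k c_k c_(l-k) = (1 choose l) add up to
  2 c_l. Solving for c_l expresses it through earlier coefficients with no denominator other than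
  2.\<close>

lemma gbinomial_half_in:
  fixes R :: "complex set"
  assumes "class_subring R" "1 / 2 \<in> R"
  shows "(1 / 2) gchoose l \<in> R"
proof (induction l rule: less_induct)
  case (less l)
  interpret class_subring R by fact
  let ?c = "\<lambda>l. (1 / 2 :: complex) gchoose l"
  show ?case
  proof (cases "l = 0")
    case False
    have "{0..l} = insert 0 (insert l {0<..<l})" using False by auto
    then have "(\<Sum>k\<in>{0..l}. ?c k * ?c (l - k)) = 2 * ?c l + (\<Sum>k\<in>{0<..<l}. ?c k * ?c (l - k))"
      using False by simp
    moreover have "(\<Sum>k\<in>{0..l}. ?c k * ?c (l - k)) = of_nat (1 choose l)"
      using gbinomial_Vandermonde[of "1/2 :: complex" "1/2" l] by (simp add: binomial_gbinomial)
    ultimately have eq: "?c l = 1 / 2 * (of_nat (1 choose l) - (\<Sum>k\<in>{0<..<l}. ?c k * ?c (l - k)))"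
      by (simp add: field_simps)
    show ?thesis
      unfolding eq using less assms(2) by (intro mult diff of_nat sum) auto
  qed simp
qed

section \<open>The completion of a subring\<close>

definition ring_on :: "'a::comm_ring_1 set \<Rightarrow> 'a ring" where
  "ring_on K = class_ring\<lparr>carrier := K\<rparr>"

lemma ring_on_simps [simp]:
  "carrier (ring_on K) = K" "x \<otimes>\<^bsub>ring_on K\<^esub> y = x * y" "x \<oplus>\<^bsub>ring_on K\<^esub> y = x + y"
  "\<one>\<^bsub>ring_on K\<^esub> = 1" "\<zero>\<^bsub>ring_on K\<^esub> = 0"
  by (simp_all add: ring_on_def)

lemma cyclotomic_ring_eq: "cyclotomic_ring M \<zeta> = ring_on (carrier (cyclotomic_ring M \<zeta>))"
  by (simp add: cyclotomic_ring_def ring_on_def)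

lemma power_series_ring_eq': "power_series_ring A n = ring_on (series_over (carrier A) ({..<n} \<times> {..<n}))"
  by (simp add: power_series_ring_eq ring_on_def)

lemma pow_ring_on [simp]: "x [^]\<^bsub>ring_on K\<^esub> (k::nat) = x ^ k"
  by (induction k) (simp_all add: nat_pow_def mult.commute)

lemma add_pow_ring_on [simp]: "add_pow (ring_on K) (k::nat) x = of_nat k * x"
  by (induction k) (simp_all add: add_pow_def nat_pow_def distrib_right add.commute)

definition padic_cong :: "'a::comm_ring_1 set \<Rightarrow> nat \<Rightarrow> nat \<Rightarrow> 'a \<Rightarrow> 'a \<Rightarrow> bool" where
  "padic_cong K p k x y \<longleftrightarrow> (\<exists>a\<in>K. x - y = of_nat p ^ k * a)"

definition padic_coset :: "'a::comm_ring_1 set \<Rightarrow> nat \<Rightarrow> nat \<Rightarrow> 'a \<Rightarrow> 'a set" where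
  "padic_coset K p k x = {y. padic_cong K p k y x}"

lemma padic_ideal_coset: "padic_ideal (ring_on K) p k +>\<^bsub>ring_on K\<^esub> x = padic_coset K p k x"
proof -
  have "padic_ideal (ring_on K) p k = {of_nat p ^ k * a | a. a \<in> K}"
    by (simp add: padic_ideal_def cgenideal_def mult.commute)
  moreover have "padic_ideal (ring_on K) p k +>\<^bsub>ring_on K\<^esub> x = {i + x | i. i \<in> padic_ideal (ring_on K) p k}"
    by (auto simp: a_r_coset_def r_coset_def)
  ultimately show ?thesis
    by (auto simp: padic_coset_def padic_cong_def algebra_simps)
qed

context class_subring begin

lemma cring_ring_on: "cring (ring_on R)"
proof (rule cringI)
  show "abelian_group (ring_on R)"
    by (rule abelian_groupI) (auto simp: add_ac intro: bexI[of _ "- _"])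
  show "comm_monoid (ring_on R)"
    by (rule comm_monoidI) (auto simp: mult_ac)
qed (auto simp: distrib_right)

lemma a_inv_ring_on [simp]: "x \<in> R \<Longrightarrow> \<ominus>\<^bsub>ring_on R\<^esub> x = - x"
proof -
  interpret cring "ring_on R" by (rule cring_ring_on)
  assume "x \<in> R"
  then show ?thesis using minus_equality[of "- x" x] by (auto intro: uminus)
qed

lemma padic_cong_refl [simp]: "padic_cong R p k x x"
  by (auto simp: padic_cong_def intro: bexI[of _ 0])

lemma padic_cong_sym: "padic_cong R p k x y \<Longrightarrow> padic_cong R p k y x"
  unfolding padic_cong_def by (metis minus_diff_eq mult_minus_right uminus)

lemma padic_cong_trans: "padic_cong R p k x y \<Longrightarrow> padic_cong R p k y z \<Longrightarrow> padic_cong R p k x z"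
  unfolding padic_cong_def
proof (elim bexE)
  fix a b assume "x - y = of_nat p ^ k * a" "y - z = of_nat p ^ k * b" "a \<in> R" "b \<in> R"
  moreover from this have "x - z = of_nat p ^ k * (a + b)" by (simp add: algebra_simps)
  ultimately show "\<exists>a\<in>R. x - z = of_nat p ^ k * a" by blast
qed

lemma padic_cong_add:
  "padic_cong R p k x x' \<Longrightarrow> padic_cong R p k y y' \<Longrightarrow> padic_cong R p k (x + y) (x' + y')"
  unfolding padic_cong_def
proof (elim bexE)
  fix a b assume "x - x' = of_nat p ^ k * a" "y - y' = of_nat p ^ k * b" "a \<in> R" "b \<in> R"
  moreover from this have "x + y - (x' + y') = of_nat p ^ k * (a + b)" by (simp add: algebra_simps)
  ultimately show "\<exists>a\<in>R. x + y - (x' + y') = of_nat p ^ k * a" by blast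
qed

lemma padic_cong_mult:
  assumes "padic_cong R p k x x'" "padic_cong R p k y y'" "x' \<in> R" "y \<in> R"
  shows "padic_cong R p k (x * y) (x' * y')"
proof -
  obtain a b where "x - x' = of_nat p ^ k * a" "y - y' = of_nat p ^ k * b" and ab: "a \<in> R" "b \<in> R"
    using assms unfolding padic_cong_def by blast
  then have x: "x = x' + of_nat p ^ k * a" and y': "y' = y - of_nat p ^ k * b"
    by (simp_all add: algebra_simps)
  have "x * y - x' * y' = of_nat p ^ k * (a * y + x' * b)"
    unfolding x y' by (simp add: algebra_simps)
  moreover have "a * y + x' * b \<in> R" using assms ab by auto
  ultimately show ?thesis unfolding padic_cong_def by blast
qed

lemma padic_cong_uminus: "padic_cong R p k x y \<Longrightarrow> padic_cong R p k (- x) (- y)"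
  unfolding padic_cong_def
proof (elim bexE)
  fix a assume "x - y = of_nat p ^ k * a" "a \<in> R"
  moreover from this have "- x - - y = of_nat p ^ k * (- a)" by (simp add: algebra_simps)
  ultimately show "\<exists>a\<in>R. - x - - y = of_nat p ^ k * a" by blast
qed

lemma padic_cong_Suc: "padic_cong R p (Suc k) x y \<Longrightarrow> padic_cong R p k x y"
  unfolding padic_cong_def by (metis mult mult.assoc of_nat power_Suc2)

lemma padic_cong_mono: "padic_cong R p l x y \<Longrightarrow> k \<le> l \<Longrightarrow> padic_cong R p k x y"
  by (induction l rule: nat_induct) (auto simp: le_Suc_eq dest: padic_cong_Suc)

lemma padic_coset_eq: "padic_coset R p k x = padic_coset R p k y \<longleftrightarrow> padic_cong R p k x y"
  unfolding padic_coset_def using padic_cong_sym padic_cong_trans padic_cong_refl by blast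

lemma padic_coset_subset: "padic_coset R p (Suc k) x \<subseteq> padic_coset R p k y \<longleftrightarrow> padic_cong R p k x y"
  unfolding padic_coset_def using padic_cong_sym padic_cong_trans padic_cong_refl padic_cong_Suc
  by blast

lemma padic_coset_self: "x \<in> padic_coset R p k x"
  by (simp add: padic_coset_def)

lemma ideal_padic: "ideal (padic_ideal (ring_on R) p k) (ring_on R)"
proof -
  interpret cring "ring_on R" by (rule cring_ring_on)
  show ?thesis unfolding padic_ideal_def by (rule cgenideal_ideal) (simp flip: of_nat_power)
qed

lemma quot_simps:
  shows "carrier (ring_on R Quot padic_ideal (ring_on R) p k) = padic_coset R p k ` R"
    and "x \<in> R \<Longrightarrow> y \<in> R \<Longrightarrow> padic_coset R p k x \<otimes>\<^bsub>ring_on R Quot padic_ideal (ring_on R) p k\<^esub> padic_coset R p k y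
      = padic_coset R p k (x * y)"
    and "x \<in> R \<Longrightarrow> y \<in> R \<Longrightarrow> padic_coset R p k x \<oplus>\<^bsub>ring_on R Quot padic_ideal (ring_on R) p k\<^esub> padic_coset R p k y
      = padic_coset R p k (x + y)"
    and "\<one>\<^bsub>ring_on R Quot padic_ideal (ring_on R) p k\<^esub> = padic_coset R p k 1"
    and "\<zero>\<^bsub>ring_on R Quot padic_ideal (ring_on R) p k\<^esub> = padic_coset R p k 0"
proof -
  interpret ideal "padic_ideal (ring_on R) p k" "ring_on R" by (rule ideal_padic)
  show "carrier (ring_on R Quot padic_ideal (ring_on R) p k) = padic_coset R p k ` R"
    by (auto simp: FactRing_def A_RCOSETS_def' padic_ideal_coset)
  show "x \<in> R \<Longrightarrow> y \<in> R \<Longrightarrow> padic_coset R p k x \<otimes>\<^bsub>ring_on R Quot padic_ideal (ring_on R) p k\<^esub> padic_coset R p k y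
      = padic_coset R p k (x * y)"
    using rcoset_mult_add[of x y] by (simp add: FactRing_def padic_ideal_coset)
  show "x \<in> R \<Longrightarrow> y \<in> R \<Longrightarrow> padic_coset R p k x \<oplus>\<^bsub>ring_on R Quot padic_ideal (ring_on R) p k\<^esub> padic_coset R p k y
      = padic_coset R p k (x + y)"
    using a_rcos_sum[of x y] by (simp add: FactRing_def padic_ideal_coset)
  show "\<one>\<^bsub>ring_on R Quot padic_ideal (ring_on R) p k\<^esub> = padic_coset R p k 1"
    by (simp add: FactRing_def padic_ideal_coset)
  have "padic_ideal (ring_on R) p k = {of_nat p ^ k * a | a. a \<in> R}"
    by (simp add: padic_ideal_def cgenideal_def mult.commute)
  then show "\<zero>\<^bsub>ring_on R Quot padic_ideal (ring_on R) p k\<^esub> = padic_coset R p k 0"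
    by (auto simp: FactRing_def padic_coset_def padic_cong_def)
qed

abbreviation completion :: "nat \<Rightarrow> (nat \<Rightarrow> 'a set) ring" where
  "completion p \<equiv> padic_completion (ring_on R) p"

lemma completion_carrier: "g \<in> carrier (completion p) \<longleftrightarrow>
    (\<forall>k. \<exists>x\<in>R. g k = padic_coset R p k x) \<and> (\<forall>k. g (Suc k) \<subseteq> g k)"
  by (auto simp: padic_completion_def quot_simps image_def)

lemma completion_rep: "g \<in> carrier (completion p) \<Longrightarrow> \<exists>x\<in>R. g k = padic_coset R p k x"
  by (simp add: completion_carrier)

lemma completion_reps:
  assumes "g \<in> carrier (completion p)"
  obtains x where "\<And>k. x k \<in> R" "\<And>k. g k = padic_coset R p k (x k)" "\<And>k. padic_cong R p k (x (Suc k)) (x k)"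
proof -
  obtain x where x: "\<And>k. x k \<in> R" "\<And>k. g k = padic_coset R p k (x k)"
    using completion_rep[OF assms] by metis
  moreover have "padic_cong R p k (x (Suc k)) (x k)" for k
    using assms padic_coset_subset[of p k "x (Suc k)" "x k"] x(2) unfolding completion_carrier by metis
  ultimately show ?thesis using that by blast
qed

lemma completionI:
  "(\<And>k. x k \<in> R) \<Longrightarrow> (\<And>k. padic_cong R p k (x (Suc k)) (x k)) \<Longrightarrow>
    (\<lambda>k. padic_coset R p k (x k)) \<in> carrier (completion p)"
  unfolding completion_carrier by (auto simp: padic_coset_subset)

lemma completion_mult_nth:
  "g k = padic_coset R p k x \<Longrightarrow> h k = padic_coset R p k y \<Longrightarrow> x \<in> R \<Longrightarrow> y \<in> R \<Longrightarrow>
    (g \<otimes>\<^bsub>completion p\<^esub> h) k = padic_coset R p k (x * y)"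
  by (simp add: padic_completion_def quot_simps)

lemma completion_add_nth:
  "g k = padic_coset R p k x \<Longrightarrow> h k = padic_coset R p k y \<Longrightarrow> x \<in> R \<Longrightarrow> y \<in> R \<Longrightarrow>
    (g \<oplus>\<^bsub>completion p\<^esub> h) k = padic_coset R p k (x + y)"
  by (simp add: padic_completion_def quot_simps)

lemma completion_one_nth: "\<one>\<^bsub>completion p\<^esub> k = padic_coset R p k 1"
  by (simp add: padic_completion_def quot_simps)

lemma completion_zero_nth: "\<zero>\<^bsub>completion p\<^esub> k = padic_coset R p k 0"
  by (simp add: padic_completion_def quot_simps)

lemma cring_completion: "cring (completion p)"
proof -
  let ?B = "completion p"
  have mult: "g \<otimes>\<^bsub>?B\<^esub> h \<in> carrier ?B" if gh: "g \<in> carrier ?B" "h \<in> carrier ?B" for g h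
  proof -
    obtain x where x: "\<And>k. x k \<in> R" "\<And>k. g k = padic_coset R p k (x k)" "\<And>k. padic_cong R p k (x (Suc k)) (x k)"
      using completion_reps[OF gh(1)] by blast
    obtain y where y: "\<And>k. y k \<in> R" "\<And>k. h k = padic_coset R p k (y k)" "\<And>k. padic_cong R p k (y (Suc k)) (y k)"
      using completion_reps[OF gh(2)] by blast
    have "g \<otimes>\<^bsub>?B\<^esub> h = (\<lambda>k. padic_coset R p k (x k * y k))"
      by (rule ext) (rule completion_mult_nth[OF x(2) y(2) x(1) y(1)])
    also have "\<dots> \<in> carrier ?B"
      by (rule completionI) (use x(1,3) y(1,3) in \<open>auto intro: padic_cong_mult\<close>)
    finally show ?thesis .
  qed
  have add: "g \<oplus>\<^bsub>?B\<^esub> h \<in> carrier ?B" if gh: "g \<in> carrier ?B" "h \<in> carrier ?B" for g h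
  proof -
    obtain x where x: "\<And>k. x k \<in> R" "\<And>k. g k = padic_coset R p k (x k)" "\<And>k. padic_cong R p k (x (Suc k)) (x k)"
      using completion_reps[OF gh(1)] by blast
    obtain y where y: "\<And>k. y k \<in> R" "\<And>k. h k = padic_coset R p k (y k)" "\<And>k. padic_cong R p k (y (Suc k)) (y k)"
      using completion_reps[OF gh(2)] by blast
    have "g \<oplus>\<^bsub>?B\<^esub> h = (\<lambda>k. padic_coset R p k (x k + y k))"
      by (rule ext) (rule completion_add_nth[OF x(2) y(2) x(1) y(1)])
    also have "\<dots> \<in> carrier ?B"
      by (rule completionI) (use x(1,3) y(1,3) in \<open>auto intro: padic_cong_add\<close>)
    finally show ?thesis .
  qed
  have inv: "\<exists>h\<in>carrier ?B. h \<oplus>\<^bsub>?B\<^esub> g = \<zero>\<^bsub>?B\<^esub>" if g: "g \<in> carrier ?B" for g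
  proof -
    obtain x where x: "\<And>k. x k \<in> R" "\<And>k. g k = padic_coset R p k (x k)" "\<And>k. padic_cong R p k (x (Suc k)) (x k)"
      using completion_reps[OF g] by blast
    define h where "h = (\<lambda>k. padic_coset R p k (- x k))"
    have "h \<in> carrier ?B" unfolding h_def
      by (rule completionI) (use x padic_cong_uminus in blast)+
    moreover have "(h \<oplus>\<^bsub>?B\<^esub> g) k = \<zero>\<^bsub>?B\<^esub> k" for k
      using completion_add_nth[of h k p "- x k" g "x k"] x uminus
      by (simp add: h_def completion_zero_nth)
    ultimately show ?thesis by blast
  qed
  have one: "\<one>\<^bsub>?B\<^esub> \<in> carrier ?B" and zero: "\<zero>\<^bsub>?B\<^esub> \<in> carrier ?B"
    unfolding completion_carrier completion_one_nth completion_zero_nth by (auto simp: padic_coset_subset)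
  \<comment> \<open>Representatives chosen independently at each level. The remaining laws are
    checked in each quotient separately, so the choices at different levels need not be compatible;
    compatibility was needed only for closure and inverses.\<close>
  define rp where "rp g k = (SOME x. x \<in> R \<and> g k = padic_coset R p k x)" for g :: "nat \<Rightarrow> 'a set" and k
  have rp: "rp g k \<in> R \<and> g k = padic_coset R p k (rp g k)" if "g \<in> carrier ?B" for g k
    unfolding rp_def by (rule someI_ex) (use completion_rep[OF that, of k] in blast)
  note ops = completion_mult_nth completion_add_nth
  have eqI: "g = h" if "\<And>k. g k = h k" for g h :: "nat \<Rightarrow> 'a set"
    using that by blast
  show ?thesis
  proof (rule cringI)
    show "abelian_group ?B"
    proof (rule abelian_groupI)
      fix g h l assume "g \<in> carrier ?B" "h \<in> carrier ?B" "l \<in> carrier ?B"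
      then have gc: "g \<in> carrier ?B" "h \<in> carrier ?B" "l \<in> carrier ?B" .
      define x where "x = rp g"
      define y where "y = rp h"
      define z where "z = rp l"
      have r: "\<And>k. x k \<in> R \<and> g k = padic_coset R p k (x k)" "\<And>k. y k \<in> R \<and> h k = padic_coset R p k (y k)"
        "\<And>k. z k \<in> R \<and> l k = padic_coset R p k (z k)"
        using gc[THEN rp] by (auto simp: x_def y_def z_def)
      have gh: "(g \<oplus>\<^bsub>?B\<^esub> h) k = padic_coset R p k (x k + y k)" for k by (rule ops) (use r in auto)
      have hl: "(h \<oplus>\<^bsub>?B\<^esub> l) k = padic_coset R p k (y k + z k)" for k by (rule ops) (use r in auto)
      have "(g \<oplus>\<^bsub>?B\<^esub> h \<oplus>\<^bsub>?B\<^esub> l) k = padic_coset R p k (x k + y k + z k)" for k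
        by (rule ops(2)) (use gh r in auto)
      moreover have "(g \<oplus>\<^bsub>?B\<^esub> (h \<oplus>\<^bsub>?B\<^esub> l)) k = padic_coset R p k (x k + (y k + z k))" for k
        by (rule ops(2)) (use hl r in auto)
      ultimately show "g \<oplus>\<^bsub>?B\<^esub> h \<oplus>\<^bsub>?B\<^esub> l = g \<oplus>\<^bsub>?B\<^esub> (h \<oplus>\<^bsub>?B\<^esub> l)"
        by (intro eqI) (simp add: add.assoc)
      have "(h \<oplus>\<^bsub>?B\<^esub> g) k = padic_coset R p k (y k + x k)" for k by (rule ops) (use r in auto)
      then show "g \<oplus>\<^bsub>?B\<^esub> h = h \<oplus>\<^bsub>?B\<^esub> g" using gh by (intro eqI) (simp add: add.commute)
      have "(\<zero>\<^bsub>?B\<^esub> \<oplus>\<^bsub>?B\<^esub> g) k = padic_coset R p k (0 + x k)" for k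
        by (rule ops(2)) (use completion_zero_nth r in auto)
      then show "\<zero>\<^bsub>?B\<^esub> \<oplus>\<^bsub>?B\<^esub> g = g" using r by (intro eqI) simp
    qed (use add zero inv in auto)
    show "comm_monoid ?B"
    proof (rule comm_monoidI)
      fix g h l assume "g \<in> carrier ?B" "h \<in> carrier ?B" "l \<in> carrier ?B"
      then have gc: "g \<in> carrier ?B" "h \<in> carrier ?B" "l \<in> carrier ?B" .
      define x where "x = rp g"
      define y where "y = rp h"
      define z where "z = rp l"
      have r: "\<And>k. x k \<in> R \<and> g k = padic_coset R p k (x k)" "\<And>k. y k \<in> R \<and> h k = padic_coset R p k (y k)"
        "\<And>k. z k \<in> R \<and> l k = padic_coset R p k (z k)"
        using gc[THEN rp] by (auto simp: x_def y_def z_def)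
      have gh: "(g \<otimes>\<^bsub>?B\<^esub> h) k = padic_coset R p k (x k * y k)" for k by (rule ops) (use r in auto)
      have hl: "(h \<otimes>\<^bsub>?B\<^esub> l) k = padic_coset R p k (y k * z k)" for k by (rule ops) (use r in auto)
      have "(g \<otimes>\<^bsub>?B\<^esub> h \<otimes>\<^bsub>?B\<^esub> l) k = padic_coset R p k (x k * y k * z k)" for k
        by (rule ops(1)) (use gh r in auto)
      moreover have "(g \<otimes>\<^bsub>?B\<^esub> (h \<otimes>\<^bsub>?B\<^esub> l)) k = padic_coset R p k (x k * (y k * z k))" for k
        by (rule ops(1)) (use hl r in auto)
      ultimately show "g \<otimes>\<^bsub>?B\<^esub> h \<otimes>\<^bsub>?B\<^esub> l = g \<otimes>\<^bsub>?B\<^esub> (h \<otimes>\<^bsub>?B\<^esub> l)"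
        by (intro eqI) (simp add: mult.assoc)
      have "(h \<otimes>\<^bsub>?B\<^esub> g) k = padic_coset R p k (y k * x k)" for k by (rule ops) (use r in auto)
      then show "g \<otimes>\<^bsub>?B\<^esub> h = h \<otimes>\<^bsub>?B\<^esub> g" using gh by (intro eqI) (simp add: mult.commute)
      have "(\<one>\<^bsub>?B\<^esub> \<otimes>\<^bsub>?B\<^esub> g) k = padic_coset R p k (1 * x k)" for k
        by (rule ops(1)) (use completion_one_nth r in auto)
      then show "\<one>\<^bsub>?B\<^esub> \<otimes>\<^bsub>?B\<^esub> g = g" using r by (intro eqI) simp
    qed (use mult one in auto)
    fix g h l assume "g \<in> carrier ?B" "h \<in> carrier ?B" "l \<in> carrier ?B"
    then have gc: "g \<in> carrier ?B" "h \<in> carrier ?B" "l \<in> carrier ?B" .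
    define x where "x = rp g"
    define y where "y = rp h"
    define z where "z = rp l"
    have r: "\<And>k. x k \<in> R \<and> g k = padic_coset R p k (x k)" "\<And>k. y k \<in> R \<and> h k = padic_coset R p k (y k)"
      "\<And>k. z k \<in> R \<and> l k = padic_coset R p k (z k)"
      using gc[THEN rp] by (auto simp: x_def y_def z_def)
    have gh: "(g \<oplus>\<^bsub>?B\<^esub> h) k = padic_coset R p k (x k + y k)" for k by (rule ops) (use r in auto)
    have gl: "(g \<otimes>\<^bsub>?B\<^esub> l) k = padic_coset R p k (x k * z k)" for k by (rule ops) (use r in auto)
    have hl: "(h \<otimes>\<^bsub>?B\<^esub> l) k = padic_coset R p k (y k * z k)" for k by (rule ops) (use r in auto)
    have "((g \<oplus>\<^bsub>?B\<^esub> h) \<otimes>\<^bsub>?B\<^esub> l) k = padic_coset R p k ((x k + y k) * z k)" for k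
      by (rule ops(1)) (use gh r in auto)
    moreover have "(g \<otimes>\<^bsub>?B\<^esub> l \<oplus>\<^bsub>?B\<^esub> h \<otimes>\<^bsub>?B\<^esub> l) k = padic_coset R p k (x k * z k + y k * z k)" for k
      by (rule ops(2)) (use gl hl r in auto)
    ultimately show "(g \<oplus>\<^bsub>?B\<^esub> h) \<otimes>\<^bsub>?B\<^esub> l = g \<otimes>\<^bsub>?B\<^esub> l \<oplus>\<^bsub>?B\<^esub> h \<otimes>\<^bsub>?B\<^esub> l"
      by (intro eqI) (simp add: distrib_right)
  qed
qed

lemma to_completion_nth: "to_completion (ring_on R) p x k = padic_coset R p k x"
  by (simp add: to_completion_def padic_ideal_coset)

lemma to_completion_in: "x \<in> R \<Longrightarrow> to_completion (ring_on R) p x \<in> carrier (completion p)"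
  unfolding completion_carrier to_completion_nth by (auto simp: padic_coset_subset)

lemma to_completion_mult:
  "x \<in> R \<Longrightarrow> y \<in> R \<Longrightarrow> to_completion (ring_on R) p (x * y)
     = to_completion (ring_on R) p x \<otimes>\<^bsub>completion p\<^esub> to_completion (ring_on R) p y"
  by (rule ext) (simp add: to_completion_nth completion_mult_nth)

lemma to_completion_add:
  "x \<in> R \<Longrightarrow> y \<in> R \<Longrightarrow> to_completion (ring_on R) p (x + y)
     = to_completion (ring_on R) p x \<oplus>\<^bsub>completion p\<^esub> to_completion (ring_on R) p y"
  by (rule ext) (simp add: to_completion_nth completion_add_nth)

lemma to_completion_1: "to_completion (ring_on R) p 1 = \<one>\<^bsub>completion p\<^esub>"
  by (intro ext) (simp add: to_completion_nth completion_one_nth)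

lemma to_completion_0: "to_completion (ring_on R) p 0 = \<zero>\<^bsub>completion p\<^esub>"
  by (intro ext) (simp add: to_completion_nth completion_zero_nth)

lemma to_completion_uminus:
  assumes "x \<in> R"
  shows "to_completion (ring_on R) p (- x) = \<ominus>\<^bsub>completion p\<^esub> to_completion (ring_on R) p x"
proof -
  interpret B: cring "completion p" by (rule cring_completion)
  have "to_completion (ring_on R) p (- x) \<oplus>\<^bsub>completion p\<^esub> to_completion (ring_on R) p x = \<zero>\<^bsub>completion p\<^esub>"
    using to_completion_add[of "- x" x p] assms to_completion_0 uminus[OF assms] by simp
  then show ?thesis
    using assms uminus[OF assms] to_completion_in by (metis B.minus_equality)
qed

text \<open>Division by p^j costs j levels: the quotient at level k is read off from the
  representative at level j + k, and torsion-freeness makes these quotients compatible. Consequently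
  the kernel of the projection to level j consists of multiples of p^j, which every ring
  homomorphism respects.\<close>

lemma completion_divide:
  assumes g: "g \<in> carrier (completion p)" "g j = padic_coset R p j 0"
    and torsion: "\<And>x :: 'a. of_nat p ^ j * x = 0 \<Longrightarrow> x = 0"
  obtains h where "h \<in> carrier (completion p)"
    "g = to_completion (ring_on R) p (of_nat p ^ j) \<otimes>\<^bsub>completion p\<^esub> h"
proof -
  obtain x where x: "\<And>k. x k \<in> R" "\<And>k. g k = padic_coset R p k (x k)" "\<And>k. padic_cong R p k (x (Suc k)) (x k)"
    using completion_reps[OF g(1)] by blast
  have add_cong: "padic_cong R p k (x (k + l)) (x k)" for k l
  proof (induction l)
    case (Suc l)
    show ?case using padic_cong_trans[OF padic_cong_mono[OF x(3)[of "k + l"] le_add1] Suc] by simp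
  qed simp
  have "padic_cong R p j (x j) 0" using g(2) x(2) padic_coset_eq by metis
  then have "padic_cong R p j (x (j + k)) 0" for k
    using add_cong[of j k] padic_cong_trans by blast
  then obtain y where y: "\<And>k. y k \<in> R" "\<And>k. x (j + k) = of_nat p ^ j * y k"
    unfolding padic_cong_def by (metis diff_zero)
  define h where "h = (\<lambda>k. padic_coset R p k (y k))"
  have "padic_cong R p k (y (Suc k)) (y k)" for k
  proof -
    have "padic_cong R p (j + k) (x (j + Suc k)) (x (j + k))" using x(3)[of "j + k"] by simp
    then obtain a where a: "a \<in> R" "of_nat p ^ j * y (Suc k) - of_nat p ^ j * y k = of_nat p ^ (j + k) * a"
      unfolding padic_cong_def y by blast
    then have "of_nat p ^ j * (y (Suc k) - y k - of_nat p ^ k * a) = 0"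
      by (simp add: algebra_simps power_add)
    then have "y (Suc k) - y k = of_nat p ^ k * a" using torsion by (metis right_minus_eq)
    then show ?thesis using a(1) unfolding padic_cong_def by blast
  qed
  then have "h \<in> carrier (completion p)" unfolding h_def using y(1) by (intro completionI)
  moreover have "g = to_completion (ring_on R) p (of_nat p ^ j) \<otimes>\<^bsub>completion p\<^esub> h"
  proof
    fix k
    have "(to_completion (ring_on R) p (of_nat p ^ j) \<otimes>\<^bsub>completion p\<^esub> h) k = padic_coset R p k (of_nat p ^ j * y k)"
      by (rule completion_mult_nth[OF to_completion_nth]) (use y(1) in \<open>auto simp: h_def\<close>)
    moreover have "padic_cong R p k (x (j + k)) (x k)" using add_cong[of k j] by (simp add: add.commute)
    ultimately show "g k = (to_completion (ring_on R) p (of_nat p ^ j) \<otimes>\<^bsub>completion p\<^esub> h) k"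
      using x(2) y(2) padic_coset_eq by metis
  qed
  ultimately show ?thesis using that by blast
qed

end

lemma completion_map_nth:
  assumes "class_subring R" "class_subring R'"
    and cong: "\<And>x y. x \<in> R \<Longrightarrow> y \<in> R \<Longrightarrow> padic_cong R p k x y \<Longrightarrow> padic_cong R' p k (h x) (h y)"
    and "x \<in> R" "g k = padic_coset R p k x"
  shows "completion_map (ring_on R) (ring_on R') p h g k = padic_coset R' p k (h x)"
proof -
  interpret R: class_subring R by fact
  interpret R': class_subring R' by fact
  have "y \<in> R" if "y \<in> padic_coset R p k x" for y
  proof -
    obtain a where "a \<in> R" "y = x + of_nat p ^ k * a"
      using \<open>y \<in> padic_coset R p k x\<close> unfolding padic_coset_def padic_cong_def
      by (auto simp: algebra_simps)
    then show ?thesis using assms(4) by auto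
  qed
  then have "padic_coset R' p k (h y) = padic_coset R' p k (h x)" if "y \<in> padic_coset R p k x" for y
    using that cong[OF _ assms(4)] unfolding R'.padic_coset_eq by (simp add: padic_coset_def)
  moreover have "completion_map (ring_on R) (ring_on R') p h g k = (\<Union>y\<in>padic_coset R p k x. padic_coset R' p k (h y))"
    by (simp add: completion_map_def padic_ideal_coset assms(5))
  ultimately show ?thesis using R.padic_coset_self by blast
qed

lemma padic_cong_mono_ring: "R \<subseteq> R' \<Longrightarrow> padic_cong R p k x y \<Longrightarrow> padic_cong R' p k x y"
  unfolding padic_cong_def by blast

text \<open>For subrings \<open>L \<subseteq> K\<close>, \<open>approx j g f\<close> states that \<open>g \<in> L\<^sub>p\<close> and \<open>f \<in> K\<close> have the same image
  in \<open>K / p\<^sup>j K\<close>.\<close>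

locale completion_approx = L: class_subring L + K: class_subring K
  for L K :: "'a::comm_ring_1 set" +
  fixes p :: nat
  assumes LK: "L \<subseteq> K"
begin

abbreviation B :: "(nat \<Rightarrow> 'a set) ring" where "B \<equiv> L.completion p"

abbreviation tc :: "'a \<Rightarrow> nat \<Rightarrow> 'a set" where "tc \<equiv> to_completion (ring_on L) p"

sublocale B: cring B by (rule L.cring_completion)

definition approx :: "nat \<Rightarrow> (nat \<Rightarrow> 'a set) \<Rightarrow> 'a \<Rightarrow> bool" where
  "approx j g f \<longleftrightarrow> g \<in> carrier B \<and> f \<in> K \<and> (\<exists>b\<in>L. g j = padic_coset L p j b \<and> padic_cong K p j b f)"

lemma approx_in: "approx j g f \<Longrightarrow> g \<in> carrier B" "approx j g f \<Longrightarrow> f \<in> K"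
  by (simp_all add: approx_def)

lemma approx_tc: "b \<in> L \<Longrightarrow> approx j (tc b) b"
  using LK L.to_completion_nth[of p b j] L.to_completion_in[of b p] by (auto simp: approx_def)

lemma approx_rep:
  assumes "g \<in> carrier B"
  obtains b where "b \<in> L" "g j = padic_coset L p j b" "approx j g b"
proof -
  obtain b where b: "b \<in> L" "g j = padic_coset L p j b" using L.completion_rep[OF assms] by blast
  moreover have "approx j g b"
    using assms b LK by (auto simp: approx_def)
  ultimately show ?thesis using that by blast
qed

lemma approx_cong_left: "approx j g f \<Longrightarrow> g' \<in> carrier B \<Longrightarrow> g' j = g j \<Longrightarrow> approx j g' f"
  by (simp add: approx_def)

lemma approx_cong: "approx j g f \<Longrightarrow> f' \<in> K \<Longrightarrow> padic_cong K p j f f' \<Longrightarrow> approx j g f'"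
  unfolding approx_def by (meson K.padic_cong_trans)

lemma approx_unique: "approx j g f \<Longrightarrow> approx j g f' \<Longrightarrow> padic_cong K p j f f'"
  unfolding approx_def
  by (metis K.padic_cong_trans K.padic_cong_sym padic_cong_mono_ring[OF LK] L.padic_coset_eq)

lemma approx_mult:
  assumes "approx j g f" "approx j g' f'" shows "approx j (g \<otimes>\<^bsub>B\<^esub> g') (f * f')"
proof -
  obtain b b' where b: "b \<in> L" "g j = padic_coset L p j b" "padic_cong K p j b f"
    and b': "b' \<in> L" "g' j = padic_coset L p j b'" "padic_cong K p j b' f'"
    using assms unfolding approx_def by blast
  have "padic_cong K p j (b * b') (f * f')"
    using b b' assms LK by (intro K.padic_cong_mult) (auto simp: approx_def)
  then show ?thesis
    using assms b b' L.completion_mult_nth[of g j p b g' b', OF b(2) b'(2) b(1) b'(1)] unfolding approx_def by blast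
qed

lemma approx_add:
  assumes "approx j g f" "approx j g' f'" shows "approx j (g \<oplus>\<^bsub>B\<^esub> g') (f + f')"
proof -
  obtain b b' where b: "b \<in> L" "g j = padic_coset L p j b" "padic_cong K p j b f"
    and b': "b' \<in> L" "g' j = padic_coset L p j b'" "padic_cong K p j b' f'"
    using assms unfolding approx_def by blast
  have "padic_cong K p j (b + b') (f + f')"
    using b b' by (intro K.padic_cong_add)
  then show ?thesis
    using assms b b' L.completion_add_nth[of g j p b g' b', OF b(2) b'(2) b(1) b'(1)] unfolding approx_def by blast
qed

lemma approx_0: "approx j \<zero>\<^bsub>B\<^esub> 0"
  using approx_tc[of 0 j] L.to_completion_0 by simp

lemma approx_1: "approx j \<one>\<^bsub>B\<^esub> 1"
  using approx_tc[of 1 j] L.to_completion_1 by simp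

lemma approx_uminus:
  assumes "approx j g f" shows "approx j (\<ominus>\<^bsub>B\<^esub> g) (- f)"
proof -
  have g: "g \<in> carrier B" using assms approx_in by blast
  obtain b where b: "approx j (\<ominus>\<^bsub>B\<^esub> g) b"
    by (rule approx_rep[of "\<ominus>\<^bsub>B\<^esub> g" j]) (use g in auto)
  have "approx j \<zero>\<^bsub>B\<^esub> (b + f)"
    using approx_add[OF b assms] B.l_neg[OF g] by simp
  then have "padic_cong K p j (b + f) 0" using approx_0 approx_unique by blast
  then have "padic_cong K p j (b + f + - f) (0 + - f)" by (rule K.padic_cong_add) simp
  then show ?thesis using b approx_cong[of j _ b "- f"] approx_in[OF assms] by auto
qed

lemma approx_minus: "approx j g f \<Longrightarrow> approx j g' f' \<Longrightarrow> approx j (g \<ominus>\<^bsub>B\<^esub> g') (f - f')"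
  using approx_add[OF _ approx_uminus, of j g f g' f'] by (simp add: a_minus_def)

lemma approx_pow: "approx j g f \<Longrightarrow> approx j (g [^]\<^bsub>B\<^esub> (k::nat)) (f ^ k)"
proof (induction k)
  case (Suc k)
  then show ?case using approx_mult[of j "g [^]\<^bsub>B\<^esub> k" "f ^ k" g f] by (simp add: mult.commute)
qed (simp add: approx_1)

lemma approx_sum:
  "(\<And>i. i < l \<Longrightarrow> approx j (g i) (f i)) \<Longrightarrow> approx j (\<Oplus>\<^bsub>B\<^esub>i\<in>{..<l::nat}. g i) (\<Sum>i<l. f i)"
proof (induction l)
  case (Suc l)
  have "approx j (g l \<oplus>\<^bsub>B\<^esub> (\<Oplus>\<^bsub>B\<^esub>i\<in>{..<l}. g i)) (f l + (\<Sum>i<l. f i))"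
    by (intro approx_add) (use Suc in auto)
  moreover have "(\<Oplus>\<^bsub>B\<^esub>i\<in>insert l {..<l}. g i) = g l \<oplus>\<^bsub>B\<^esub> (\<Oplus>\<^bsub>B\<^esub>i\<in>{..<l}. g i)"
    by (rule B.finsum_insert) (use Suc.prems approx_in in \<open>auto intro: less_SucI\<close>)
  ultimately show ?case by (simp add: lessThan_Suc add.commute)
qed (simp add: approx_0)

text \<open>Inverses are unique modulo p^j: if b f = 1 there, multiplication by \<open>f'\<close>
  gives b = \<open>f'\<close>. This treats the inverse determinant, which is not built from other
  elements by ring operations.\<close>

lemma approx_inverse:
  assumes "approx j g f" "h \<in> carrier B" "h \<otimes>\<^bsub>B\<^esub> g = \<one>\<^bsub>B\<^esub>" "f * f' = 1" "f' \<in> K"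
  shows "approx j h f'"
proof -
  obtain b where b: "b \<in> L" "approx j h b" by (rule approx_rep[OF assms(2)])
  have "padic_cong K p j (b * f) 1"
    using approx_unique[OF approx_mult[OF b(2) assms(1)], of 1] assms(3) approx_1 by simp
  then have "padic_cong K p j (b * f * f') (1 * f')"
    by (rule K.padic_cong_mult) (use assms in auto)
  then show ?thesis using approx_cong[OF b(2) assms(5)] assms(4) by (simp add: mult.assoc)
qed

section \<open>Matrices over the completion\<close>

definition mat_approx :: "nat \<Rightarrow> nat \<Rightarrow> (nat \<Rightarrow> 'a set) mat \<Rightarrow> 'a mat \<Rightarrow> bool" where
  "mat_approx n j G F \<longleftrightarrow> G \<in> carrier_mat n n \<and> F \<in> carrier_mat n n \<and>
     (\<forall>i<n. \<forall>k<n. approx j (G $$ (i, k)) (F $$ (i, k)))"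

lemma mat_approx_mult:
  assumes "mat_approx n j G F" "mat_approx n j G' F'"
  shows "mat_approx n j (rmat_mult B G G') (F * F')"
proof -
  have c: "G \<in> carrier_mat n n" "G' \<in> carrier_mat n n" "F \<in> carrier_mat n n" "F' \<in> carrier_mat n n"
    and a: "\<And>i k. i < n \<Longrightarrow> k < n \<Longrightarrow> approx j (G $$ (i, k)) (F $$ (i, k))"
    and a': "\<And>i k. i < n \<Longrightarrow> k < n \<Longrightarrow> approx j (G' $$ (i, k)) (F' $$ (i, k))"
    using assms by (auto simp: mat_approx_def)
  have "approx j (rmat_mult B G G' $$ (i, k)) ((F * F') $$ (i, k))" if ik: "i < n" "k < n" for i k
    unfolding mult_mat_index[OF c(3,4) ik] using c ik
    by (auto simp: rmat_mult_def intro!: approx_sum approx_mult a a')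
  then show ?thesis using c by (auto simp: mat_approx_def rmat_mult_def)
qed

lemma mat_approx_one: "mat_approx n j (rmat_one B n) (1\<^sub>m n)"
  by (auto simp: mat_approx_def rmat_one_def approx_0 approx_1)

lemma mat_approx_minus:
  "mat_approx n j G F \<Longrightarrow> mat_approx n j G' F' \<Longrightarrow> mat_approx n j (rmat_minus B G G') (F - F')"
  by (auto simp: mat_approx_def rmat_minus_def approx_minus)

lemma mat_approx_transpose:
  "mat_approx n j G F \<Longrightarrow> mat_approx n j (transpose_mat G) (transpose_mat F)"
  by (auto simp: mat_approx_def)

lemma mat_approx_entry_power:
  "mat_approx n j G F \<Longrightarrow> mat_approx n j (entry_power B k G) (map_mat (\<lambda>x. x ^ k) F)"
  by (auto simp: mat_approx_def entry_power_def approx_pow)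

lemma mat_approx_pow:
  "mat_approx n j G F \<Longrightarrow> mat_approx n j (rmat_pow B n G k) (F ^\<^sub>m k)"
proof (induction k)
  case 0
  then have "dim_row F = n" by (auto simp: mat_approx_def)
  then show ?case using mat_approx_one by simp
qed (simp add: mat_approx_mult)

text \<open>The matrix inverse in the Chern formula is known only through its defining equations.
  Any entrywise approximation \<open>W\<close> of it satisfies F W = 1 modulo p^j, and
  multiplication by F' on the left identifies it with F'.\<close>

lemma mat_approx_inverse:
  assumes G: "mat_approx n j G F" and H: "rmat_inverse B n G H"
    and F': "F' \<in> carrier_mat n n" "F' * F = 1\<^sub>m n" "\<And>i k. i < n \<Longrightarrow> k < n \<Longrightarrow> F' $$ (i, k) \<in> K"
  shows "mat_approx n j H F'"
proof -
  have F: "F \<in> carrier_mat n n" using G by (simp add: mat_approx_def)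
  have Hc: "H \<in> carrier_mat n n" and "elements_mat H \<subseteq> carrier B" and GH: "rmat_mult B G H = rmat_one B n"
    using H by (auto simp: rmat_inverse_def rmat_def)
  then have "H $$ (i, k) \<in> carrier B" if "i < n" "k < n" for i k
    using that elements_matI[OF Hc that refl] by blast
  then have ex: "\<exists>b. approx j (H $$ (i, k)) b" if "i < n" "k < n" for i k
    using that approx_rep by meson
  define h where "h i k = (SOME b. approx j (H $$ (i, k)) b)" for i k
  have h: "approx j (H $$ (i, k)) (h i k)" if "i < n" "k < n" for i k
    unfolding h_def using ex[OF that] by (rule someI_ex)
  define W where "W = mat n n (\<lambda>(i, k). h i k)"
  have W: "W \<in> carrier_mat n n" and HW: "mat_approx n j H W"
    using h Hc by (auto simp: mat_approx_def W_def)
  have "mat_approx n j (rmat_one B n) (F * W)"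
    using mat_approx_mult[OF G HW] GH by simp
  then have cong: "padic_cong K p j ((F * W) $$ (i, k)) (1\<^sub>m n $$ (i, k))" "(F * W) $$ (i, k) \<in> K"
    if "i < n" "k < n" for i k
    using mat_approx_one[of n j] that approx_unique[of j "rmat_one B n $$ (i, k)"]
      approx_in(2)[of j "rmat_one B n $$ (i, k)"] unfolding mat_approx_def by auto
  have "approx j (H $$ (i, k)) (F' $$ (i, k))" if ik: "i < n" "k < n" for i k
  proof (rule approx_cong[OF h[OF ik] F'(3)[OF ik]])
    have "W = F' * (F * W)"
      using assoc_mult_mat[OF F'(1) F W] F'(2) W by simp
    then have "h i k = (\<Sum>l<n. F' $$ (i, l) * (F * W) $$ (l, k))"
      using mult_mat_index[of F' n n "F * W" n i k] F F' W ik by (simp add: W_def)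
    moreover have "F' $$ (i, k) = (\<Sum>l<n. F' $$ (i, l) * 1\<^sub>m n $$ (l, k))"
      using mult_mat_index[of F' n n "1\<^sub>m n" n i k] F' ik by simp
    moreover have "padic_cong K p j (\<Sum>l\<in>S. F' $$ (i, l) * (F * W) $$ (l, k)) (\<Sum>l\<in>S. F' $$ (i, l) * 1\<^sub>m n $$ (l, k))"
      if "finite S" "S \<subseteq> {..<n}" for S
      using that
    proof (induction S)
      case (insert l S)
      then show ?case
        using cong[of l k] F'(3)[of i l] ik
        by (simp del: index_mult_mat index_one_mat) (intro K.padic_cong_add K.padic_cong_mult, auto)
    qed simp
    ultimately show "padic_cong K p j (h i k) (F' $$ (i, k))" by simp
  qed
  then show ?thesis using Hc F'(1) by (simp add: mat_approx_def)
qed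

end

section \<open>The formula of the Chern connection\<close>

abbreviation entry_pow :: "nat \<Rightarrow> 'a::comm_ring_1 mat \<Rightarrow> 'a mat" where
  "entry_pow p X \<equiv> map_mat (\<lambda>x. x ^ p) X"

abbreviation const_mat :: "'a::comm_ring_1 mat \<Rightarrow> ('i, 'a) mps mat" where
  "const_mat q \<equiv> map_mat mps_const q"

abbreviation const_term :: "('i, 'a::comm_ring_1) mps mat \<Rightarrow> 'a mat" where
  "const_term X \<equiv> map_mat (\<lambda>f. mps_nth f {#}) X"

lemma mat_vanishes_1_iff:
  assumes "X \<in> carrier_mat n n"
  shows "mat_vanishes 1 (X - 1\<^sub>m n) \<longleftrightarrow> const_term X = 1\<^sub>m n"
proof
  assume *: "mat_vanishes 1 (X - 1\<^sub>m n)"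
  show "const_term X = 1\<^sub>m n"
    using * assms by (intro eq_matI) (auto simp: mat_vanishes_def vanishes_Suc_0_iff mps_nth_1)
next
  assume *: "const_term X = 1\<^sub>m n"
  have "mps_nth (X $$ (i, j)) {#} = 1\<^sub>m n $$ (i, j)" if "i < n" "j < n" for i j
    using arg_cong[OF *, of "\<lambda>Y. Y $$ (i, j)"] that assms by simp
  then show "mat_vanishes 1 (X - 1\<^sub>m n)"
    using assms by (auto simp: mat_vanishes_def vanishes_Suc_0_iff mps_nth_1)
qed

lemma const_term_mult:
  "X \<in> carrier_mat n m \<Longrightarrow> Y \<in> carrier_mat m l \<Longrightarrow> const_term (X * Y) = const_term X * const_term Y"
  by (rule const_coeff.mat_hom_mult)

lemma map_mat_transpose': "map_mat f (transpose_mat X) = transpose_mat (map_mat f X)"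
  by (rule eq_matI) auto

lemma const_term_entry_pow: "const_term (entry_pow p X) = entry_pow p (const_term X)"
  by (rule eq_matI) (auto simp: const_coeff.hom_power)

lemma const_term_const_mat [simp]: "const_term (const_mat q) = q"
  by (rule eq_matI) (auto simp: mps_nth_const)

lemma entry_pow_1: "p > 0 \<Longrightarrow> entry_pow p (1\<^sub>m n) = 1\<^sub>m n"
  by (rule eq_matI) (auto simp: power_0_left)

text \<open>\<open>F\<close> is the value \<open>g\<^sup>(\<^sup>p\<^sup>) {(g\<^sup>(\<^sup>p\<^sup>)\<^sup>t q g\<^sup>(\<^sup>p\<^sup>))\<^sup>-\<^sup>1 (g\<^sup>t q g)\<^sup>(\<^sup>p\<^sup>)}\<^sup>1\<^sup>/\<^sup>2\<close> of the formula of the Chern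
  connection at \<open>g\<close>; the square root is determined by its constant term \<open>1\<close>.\<close>

definition chern_image ::
  "complex mat \<Rightarrow> nat \<Rightarrow> ('i, complex) mps mat \<Rightarrow> ('i, complex) mps mat \<Rightarrow> bool" where
  "chern_image q p g F \<longleftrightarrow> (\<exists>S\<in>carrier_mat (dim_row g) (dim_row g).
     mat_vanishes 1 (S - 1\<^sub>m (dim_row g)) \<and> F = entry_pow p g * S \<and>
     (transpose_mat (entry_pow p g) * (const_mat q * entry_pow p g)) * (S * S)
       = entry_pow p (transpose_mat g * (const_mat q * g)))"

text \<open>What the argument uses of a split matrix: its entries are fixed by odd powers and by all
  ring homomorphisms, up to the inclusion of constants, and its inverse is its transpose.\<close>

locale split_form =
  fixes n :: nat and q :: "complex mat"
  assumes q: "q \<in> carrier_mat n n"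
    and q_entries: "i < n \<Longrightarrow> j < n \<Longrightarrow> q $$ (i, j) \<in> {0, 1, - 1}"
    and q_left: "q * transpose_mat q = 1\<^sub>m n" and q_right: "transpose_mat q * q = 1\<^sub>m n"
begin

lemma entry_pow_q: "odd p \<Longrightarrow> entry_pow p q = q"
proof (rule eq_matI)
  fix i j assume "odd p" "i < dim_row q" "j < dim_col q"
  then show "entry_pow p q $$ (i, j) = q $$ (i, j)"
    using q q_entries[of i j] odd_pos[of p] by (auto simp: power_0_left)
qed auto

abbreviation Q :: "('i, complex) mps mat" where "Q \<equiv> const_mat q"

lemma Q: "Q \<in> carrier_mat n n" "transpose_mat Q \<in> carrier_mat n n"
  and Q_left: "Q * transpose_mat Q = 1\<^sub>m n" and Q_right: "transpose_mat Q * Q = 1\<^sub>m n"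
proof -
  show "Q \<in> carrier_mat n n" "transpose_mat Q \<in> carrier_mat n n" using q by auto
  have t: "transpose_mat Q = const_mat (transpose_mat q)" by (rule map_mat_transpose'[symmetric])
  show "Q * transpose_mat Q = 1\<^sub>m n" "transpose_mat Q * Q = 1\<^sub>m n"
    unfolding t using q q_left q_right by (simp_all add: mps_const.mat_hom_one flip: mps_const.mat_hom_mult[of _ n n _ n])
qed

definition formY :: "nat \<Rightarrow> ('i, complex) mps mat \<Rightarrow> ('i, complex) mps mat" where
  "formY p g = transpose_mat (entry_pow p g) * (Q * entry_pow p g)"

definition formZ :: "nat \<Rightarrow> ('i, complex) mps mat \<Rightarrow> ('i, complex) mps mat" where
  "formZ p g = entry_pow p (transpose_mat g * (Q * g))"

text \<open>Since the inverse of q is its transpose, Y = q (1 + E) where E has zero constant term.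
  The inverse of Y is then a geometric series in E followed by the transpose of q.\<close>

definition formE :: "nat \<Rightarrow> ('i, complex) mps mat \<Rightarrow> ('i, complex) mps mat" where
  "formE p g = transpose_mat Q * formY p g - 1\<^sub>m n"

definition formW :: "nat \<Rightarrow> ('i, complex) mps mat \<Rightarrow> ('i, complex) mps mat" where
  "formW p g = mat_series (\<lambda>l. (-1) ^ l) (formE p g) * transpose_mat Q"

definition formU :: "nat \<Rightarrow> ('i, complex) mps mat \<Rightarrow> ('i, complex) mps mat" where
  "formU p g = formW p g * formZ p g - 1\<^sub>m n"

definition formS :: "nat \<Rightarrow> ('i, complex) mps mat \<Rightarrow> ('i, complex) mps mat" where
  "formS p g = mat_series (\<lambda>l. (1 / 2) gchoose l) (formU p g)"

context
  fixes p :: nat and g :: "('i, complex) mps mat"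
  assumes p: "odd p" and g: "g \<in> carrier_mat n n" and g_1: "const_term g = 1\<^sub>m n"
begin

lemma form_carrier:
  "formY p g \<in> carrier_mat n n" "formZ p g \<in> carrier_mat n n" "formE p g \<in> carrier_mat n n"
  "formW p g \<in> carrier_mat n n" "formU p g \<in> carrier_mat n n" "formS p g \<in> carrier_mat n n"
proof -
  show Y: "formY p g \<in> carrier_mat n n" and Z: "formZ p g \<in> carrier_mat n n"
    using g q by (auto simp: formY_def formZ_def)
  show E: "formE p g \<in> carrier_mat n n" using q Y by (auto simp: formE_def)
  show W: "formW p g \<in> carrier_mat n n" unfolding formW_def by (rule mult_carrier_mat[OF mat_series_carrier[OF E] Q(2)])
  show U: "formU p g \<in> carrier_mat n n" using W Z by (auto simp: formU_def)
  show "formS p g \<in> carrier_mat n n" using mat_series_carrier[OF U] by (auto simp: formS_def)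
qed

lemma const_term_formY: "const_term (formY p g) = q"
proof -
  have xp: "entry_pow p g \<in> carrier_mat n n" using g by simp
  have 1: "const_term (entry_pow p g) = 1\<^sub>m n"
    unfolding const_term_entry_pow g_1 using p by (intro entry_pow_1) (rule odd_pos)
  have "const_term (formY p g) = transpose_mat (1\<^sub>m n) * (q * 1\<^sub>m n)"
    unfolding formY_def using xp q 1
    by (simp add: const_term_mult[of _ n n _ n] map_mat_transpose')
  then show ?thesis using q by simp
qed

lemma const_term_formZ: "const_term (formZ p g) = q"
proof -
  have "const_term (formZ p g) = entry_pow p (transpose_mat (1\<^sub>m n) * (q * 1\<^sub>m n))"
    unfolding formZ_def const_term_entry_pow using g q g_1
    by (simp add: const_term_mult[of _ n n _ n] map_mat_transpose')
  then show ?thesis using q entry_pow_q[OF p] by simp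
qed

lemma formE_vanishes: "mat_vanishes 1 (formE p g)"
proof -
  have "const_term (transpose_mat Q * formY p g) = 1\<^sub>m n"
    using const_term_mult[OF Q(2) form_carrier(1)] q_right const_term_formY
    by (simp add: map_mat_transpose')
  then show ?thesis unfolding formE_def using mult_carrier_mat[OF Q(2) form_carrier(1)] by (subst mat_vanishes_1_iff) auto
qed

lemma one_plus_formE: "1\<^sub>m n + formE p g = transpose_mat Q * formY p g"
  using Q form_carrier(1) by (intro eq_matI) (auto simp: formE_def)

lemma formW_left: "formW p g * formY p g = 1\<^sub>m n"
proof -
  note E = form_carrier(3) formE_vanishes
  have "formW p g * formY p g = mat_series (\<lambda>l. (-1) ^ l) (formE p g) * (transpose_mat Q * formY p g)"
    unfolding formW_def by (rule assoc_mult_mat[OF mat_series_carrier[OF E(1)] Q(2) form_carrier(1)])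
  then show ?thesis using mat_series_inverse[OF E] one_plus_formE by simp
qed

lemma formW_right: "formY p g * formW p g = 1\<^sub>m n"
proof -
  note E = form_carrier(3) formE_vanishes
  let ?V = "mat_series (\<lambda>l. (-1) ^ l) (formE p g)"
  have V: "?V \<in> carrier_mat n n" using mat_series_carrier[OF E(1)] .
  \<comment> \<open>The inverse of 1 + E is a series in E, so it commutes with 1 + E; reversing the
    summation index is this commutation on coefficients.\<close>
  have "(\<lambda>l. \<Sum>k\<le>l. (if k \<le> 1 then 1 else 0) * (-1) ^ (l - k)) = (\<lambda>l. \<Sum>k\<le>l. (-1) ^ k * (if l - k \<le> 1 then 1 else (0::complex)))"
    by (rule ext) (rule sum.reindex_bij_witness[of _ "\<lambda>k. l - k" "\<lambda>k. l - k" for l], auto)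
  then have comm: "(1\<^sub>m n + formE p g) * ?V = ?V * (1\<^sub>m n + formE p g)"
    unfolding mat_series_1_plus[OF E, symmetric] mat_series_mult[OF E] by simp
  have Y: "formY p g = Q * (1\<^sub>m n + formE p g)"
    unfolding one_plus_formE using assoc_mult_mat[OF Q(1,2) form_carrier(1)] Q_left form_carrier(1)
    by (metis left_mult_one_mat)
  have "formY p g * formW p g = Q * ((1\<^sub>m n + formE p g) * ?V * transpose_mat Q)"
  proof -
    have c: "1\<^sub>m n + formE p g \<in> carrier_mat n n" using form_carrier(3) by simp
    have "Q * (1\<^sub>m n + formE p g) * (?V * transpose_mat Q) = Q * ((1\<^sub>m n + formE p g) * (?V * transpose_mat Q))"
      by (rule assoc_mult_mat[OF Q(1) c mult_carrier_mat[OF V Q(2)]])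
    then show ?thesis
      unfolding formW_def Y[symmetric] assoc_mult_mat[OF c V Q(2), symmetric] .
  qed
  also have "\<dots> = Q * transpose_mat Q"
    unfolding comm mat_series_inverse[OF E] using Q by simp
  finally show ?thesis by (simp add: Q_left)
qed

text \<open>Y and Z both have constant term q, for Z because odd powers fix 0, 1 and -1. As W
  inverts Y, the constant term of W Z is 1.\<close>

lemma formU_vanishes: "mat_vanishes 1 (formU p g)"
proof -
  have "const_term (formW p g) * const_term (formY p g) = 1\<^sub>m n"
    using formW_left const_term_mult[OF form_carrier(4,1)] by (simp add: const_coeff.mat_hom_one)
  then have "const_term (formW p g * formZ p g) = 1\<^sub>m n"
    using const_term_mult[OF form_carrier(4,2)] const_term_formY const_term_formZ by simp
  then show ?thesis
    unfolding formU_def using mult_carrier_mat[OF form_carrier(4,2)] by (subst mat_vanishes_1_iff) auto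
qed

lemma formS_vanishes: "mat_vanishes 1 (formS p g - 1\<^sub>m n)"
  unfolding formS_def by (rule mat_series_vanishes_1) (use formU_vanishes form_carrier in auto)

lemma formS_square: "formY p g * (formS p g * formS p g) = formZ p g"
proof -
  have "formS p g * formS p g = 1\<^sub>m n + formU p g"
    unfolding formS_def by (rule mat_series_sqrt) (use formU_vanishes form_carrier in auto)
  also have "\<dots> = formW p g * formZ p g"
    using form_carrier by (intro eq_matI) (auto simp: formU_def)
  finally show ?thesis
    using assoc_mult_mat[OF form_carrier(1,4,2)] formW_right form_carrier(2)
    by (metis left_mult_one_mat)
qed

lemma chern_image_formS: "chern_image q p g (entry_pow p g * formS p g)"
  unfolding chern_image_def using g formS_vanishes form_carrier(6) formS_square
  by (intro bexI[of _ "formS p g"]) (auto simp: formY_def formZ_def)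

lemma form_in_series:
  assumes "class_subring R" "1 / 2 \<in> R"
    and gR: "\<And>i j. i < n \<Longrightarrow> j < n \<Longrightarrow> g $$ (i, j) \<in> series_over R I" and ij: "i < n" "j < n"
  shows "formY p g $$ (i, j) \<in> series_over R I" "formZ p g $$ (i, j) \<in> series_over R I"
    "formW p g $$ (i, j) \<in> series_over R I" "formU p g $$ (i, j) \<in> series_over R I"
    "formS p g $$ (i, j) \<in> series_over R I"
proof -
  interpret R: class_subring R by fact
  interpret K: class_subring "series_over R I" by (rule R.class_subring_series)
  have Qin: "Q $$ (i, j) \<in> series_over R I" "transpose_mat Q $$ (i, j) \<in> series_over R I" if "i < n" "j < n" for i j
  proof -
    have "q $$ (i, j) \<in> R" if "i < n" "j < n" for i j
      using q_entries[OF that] R.uminus[OF R.one] by auto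
    then show "Q $$ (i, j) \<in> series_over R I" "transpose_mat Q $$ (i, j) \<in> series_over R I"
      using q that by auto
  qed
  have prod: "(X * X') $$ (i, j) \<in> series_over R I"
    if "X \<in> carrier_mat n n" "X' \<in> carrier_mat n n"
      "\<And>i j. i < n \<Longrightarrow> j < n \<Longrightarrow> X $$ (i, j) \<in> series_over R I"
      "\<And>i j. i < n \<Longrightarrow> j < n \<Longrightarrow> X' $$ (i, j) \<in> series_over R I" "i < n" "j < n" for X X' i j
    using that by (intro K.mult_mat)
  have Qg: "(Q * g) $$ (i, j) \<in> series_over R I" if "i < n" "j < n" for i j
    by (rule prod) (use Q g gR Qin that in auto)
  have gp: "entry_pow p g $$ (i, j) \<in> series_over R I" if "i < n" "j < n" for i j
    using gR that g by auto
  have Qgp: "(Q * entry_pow p g) $$ (i, j) \<in> series_over R I" if "i < n" "j < n" for i j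
    by (rule prod) (use Q g gp Qin that in auto)
  have Y: "formY p g $$ (i, j) \<in> series_over R I" if "i < n" "j < n" for i j
    unfolding formY_def by (rule prod) (use Q g gp Qgp gR that in auto)
  have gQg: "(transpose_mat g * (Q * g)) $$ (i, j) \<in> series_over R I" if "i < n" "j < n" for i j
    by (rule prod) (use Q g gR Qg that in auto)
  have Z: "formZ p g $$ (i, j) \<in> series_over R I" if "i < n" "j < n" for i j
    unfolding formZ_def using gQg[OF that] g Q that by (subst index_map_mat) auto
  have QY: "(transpose_mat Q * formY p g) $$ (i, j) \<in> series_over R I" if "i < n" "j < n" for i j
    by (rule prod[OF Q(2) form_carrier(1)]) (use Y Qin that in auto)
  have E: "formE p g $$ (i, j) \<in> series_over R I" if "i < n" "j < n" for i j
    unfolding formE_def using QY[OF that] that by (subst index_minus_mat) auto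
  have V: "mat_series (\<lambda>l. (-1) ^ l) (formE p g) $$ (i, j) \<in> series_over R I" if "i < n" "j < n" for i j
    by (rule R.mat_series_in_series[OF form_carrier(3) formE_vanishes E]) (use that in auto)
  have W: "formW p g $$ (i, j) \<in> series_over R I" if "i < n" "j < n" for i j
    unfolding formW_def
    by (rule prod[OF mat_series_carrier[OF form_carrier(3)] Q(2)]) (use V Qin that in auto)
  have WZ: "(formW p g * formZ p g) $$ (i, j) \<in> series_over R I" if "i < n" "j < n" for i j
    by (rule prod[OF form_carrier(4,2)]) (use W Z that in auto)
  have U: "formU p g $$ (i, j) \<in> series_over R I" if "i < n" "j < n" for i j
    unfolding formU_def using WZ[OF that] that by (subst index_minus_mat) auto
  have S: "formS p g $$ (i, j) \<in> series_over R I" if "i < n" "j < n" for i j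
    unfolding formS_def
    by (rule R.mat_series_in_series[OF form_carrier(5) formU_vanishes U gbinomial_half_in[OF assms(1,2)] that])
  show "formY p g $$ (i, j) \<in> series_over R I" "formZ p g $$ (i, j) \<in> series_over R I"
    "formW p g $$ (i, j) \<in> series_over R I" "formU p g $$ (i, j) \<in> series_over R I"
    "formS p g $$ (i, j) \<in> series_over R I"
    using Y Z W U S ij by auto
qed

end

text \<open>The square root in \<open>chern_image\<close> is unique, because two square roots that are congruent
  modulo \<open>(T)\<^sup>k\<close> are congruent modulo \<open>(T)\<^sup>k\<^sup>+\<^sup>1\<close>.\<close>

lemma chern_image_unique:
  assumes p: "odd p" and g: "g \<in> carrier_mat n n" "const_term g = 1\<^sub>m n"
    and F: "chern_image q p g F" and F': "chern_image q p g F'"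
  shows "F = F'"
proof -
  have dim: "dim_row g = n" using g by simp
  obtain S where S: "S \<in> carrier_mat n n" "mat_vanishes 1 (S - 1\<^sub>m n)" "F = entry_pow p g * S"
    "formY p g * (S * S) = formZ p g"
    using F unfolding chern_image_def dim formY_def formZ_def by blast
  obtain T where T: "T \<in> carrier_mat n n" "mat_vanishes 1 (T - 1\<^sub>m n)" "F' = entry_pow p g * T"
    "formY p g * (T * T) = formZ p g"
    using F' unfolding chern_image_def dim formY_def formZ_def by blast
  note fc = form_carrier[OF p g]
  have square: "X * X = formW p g * formZ p g" if "X \<in> carrier_mat n n" "formY p g * (X * X) = formZ p g" for X
  proof -
    have "X * X = (formW p g * formY p g) * (X * X)" using formW_left[OF p g] left_mult_one_mat[OF mult_carrier_mat[OF that(1) that(1)]] by simp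
    also have "\<dots> = formW p g * formZ p g"
      using assoc_mult_mat[OF fc(4,1) mult_carrier_mat[OF that(1) that(1)]] that(2) by simp
    finally show ?thesis .
  qed
  have eq: "S * S = T * T" using square[OF S(1,4)] square[OF T(1,4)] by simp
  define D where "D = S - T"
  have D: "D \<in> carrier_mat n n" using S T by (auto simp: D_def)
  let ?s = "S - 1\<^sub>m n" and ?t = "T - 1\<^sub>m n"
  have st: "?s \<in> carrier_mat n n" "?t \<in> carrier_mat n n" using S T by auto
  \<comment> \<open>S and T need not commute, but S D + D T = S^2 - T^2 = 0 still holds, so 2 D =
    -((S - 1) D + D (T - 1)). The right side vanishes to one order more than D.\<close>
  have key: "2 * D $$ (i, j) = - ((?s * D + D * ?t) $$ (i, j))" if "i < n" "j < n" for i j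
  proof -
    have SD: "?s * D = S * D - D"
      using minus_mult_distrib_mat[of S n n "1\<^sub>m n" D n] S(1) D by simp
    have SD': "S * D = S * S - S * T"
      unfolding D_def by (rule mult_minus_distrib_mat[OF S(1) S(1) T(1)])
    have DT: "D * ?t = D * T - D"
      using mult_minus_distrib_mat[of D n n T n "1\<^sub>m n"] T(1) D by simp
    have DT': "D * T = S * T - T * T"
      unfolding D_def by (rule minus_mult_distrib_mat[OF S(1) T(1) T(1)])
    have c: "S * S \<in> carrier_mat n n" "S * T \<in> carrier_mat n n" "T * T \<in> carrier_mat n n"
      using S(1) T(1) by auto
    have "(?s * D + D * ?t) $$ (i, j)
        = (S * S) $$ (i, j) - (S * T) $$ (i, j) - D $$ (i, j) + ((S * T) $$ (i, j) - (T * T) $$ (i, j) - D $$ (i, j))"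
      unfolding SD SD' DT DT' using c D S(1) T(1) that by (simp del: index_mult_mat(1))
    then show ?thesis using eq by simp
  qed
  have "mat_vanishes k D" for k
  proof (induction k)
    case (Suc k)
    have "mat_vanishes (Suc k) (?s * D)" "mat_vanishes (Suc k) (D * ?t)"
      using mat_vanishes_mult[OF st(1) D S(2) Suc] mat_vanishes_mult[OF D st(2) Suc T(2)] by simp_all
    moreover have c: "?s * D + D * ?t \<in> carrier_mat n n"
      by (rule add_carrier_mat[OF mult_carrier_mat[OF D st(2)]])
    ultimately have van: "mat_vanishes (Suc k) (?s * D + D * ?t)"
      using mat_vanishes_add[OF mult_carrier_mat[OF st(1) D] mult_carrier_mat[OF D st(2)]] by blast
    have "vanishes (Suc k) (D $$ (i, j))" if ij: "i < n" "j < n" for i j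
    proof -
      have "vanishes (Suc k) ((?s * D + D * ?t) $$ (i, j))"
        using van ij carrier_matD[OF c] unfolding mat_vanishes_def by metis
      then have "vanishes (Suc k) (2 * D $$ (i, j))" unfolding key[OF ij] vanishes_uminus .
      moreover have "mps_nth (2 * D $$ (i, j)) m = 2 * mps_nth (D $$ (i, j)) m" for m
        by (simp only: mult_2 mps_nth_add)
      ultimately show ?thesis by (simp add: vanishes_def)
    qed
    then show ?case using D by (auto simp: mat_vanishes_def)
  qed (simp add: mat_vanishes_def)
  then have "D $$ (i, j) = 0" if "i < n" "j < n" for i j
    using that D by (intro vanishes_eq_0) (auto simp: mat_vanishes_def)
  then have "S = T" using S T by (intro eq_matI) (auto simp: D_def)
  then show ?thesis using S T by simp
qed

end

section \<open>The Frobenius lifts on power series\<close>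

text \<open>A series is treated as a matrix of size one, so that the geometric series already
  constructed gives an inverse over \<open>R\<close>; inverses are unique. It is applied to the
  determinant of the generic matrix.\<close>

lemma series_inverse_in_series:
  assumes "class_subring R" and f: "f \<in> series_over R I" "mps_nth f {#} = 1" and "d * f = 1"
  shows "d \<in> series_over R I"
proof -
  interpret R: class_subring R by fact
  interpret K: class_subring "series_over R I" by (rule R.class_subring_series)
  define E where "E = mat 1 1 (\<lambda>_. f - 1)"
  have E: "E \<in> carrier_mat 1 1" "mat_vanishes 1 E"
    using f(2) by (auto simp: E_def mat_vanishes_def vanishes_Suc_0_iff mps_nth_1)
  let ?V = "mat_series (\<lambda>l. (-1) ^ l) E"
  have "(?V * (1\<^sub>m 1 + E)) $$ (0, 0) = 1"
    unfolding mat_series_inverse[OF E] by simp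
  then have "?V $$ (0, 0) * f = 1"
    using mult_mat_index[of ?V 1 1 "1\<^sub>m 1 + E" 1 0 0] mat_series_carrier[OF E(1)] E
    by (simp add: E_def)
  then have "d = (?V $$ (0, 0) * f) * d" by simp
  also have "\<dots> = ?V $$ (0, 0) * (d * f)" by (simp only: mult_ac)
  finally have "d = ?V $$ (0, 0)" unfolding assms(4) by simp
  moreover have "?V $$ (0, 0) \<in> series_over R I"
    by (rule R.mat_series_in_series[OF E]) (use f(1) in \<open>auto simp: E_def\<close>)
  ultimately show ?thesis by simp
qed

text \<open>Quotients by p^k chosen coefficient by coefficient could involve foreign variables.
  Torsion-freeness forces a quotient to be zero wherever the difference is, which keeps the support
  inside \<open>I\<close>.\<close>

lemma padic_cong_series:
  fixes f g :: "('i, 'a::comm_ring_1) mps"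
  assumes "class_subring R"
    and f: "f \<in> series_over R I" and g: "g \<in> series_over R I"
    and torsion: "\<And>x :: 'a. of_nat p ^ k * x = 0 \<Longrightarrow> x = 0"
  shows "padic_cong (series_over R I) p k f g \<longleftrightarrow> (\<forall>m. padic_cong R p k (mps_nth f m) (mps_nth g m))"
proof -
  interpret R: class_subring R by fact
  have const: "of_nat p ^ k * h = mps_const (of_nat p ^ k) * h" for h :: "('i, 'a) mps"
    by (simp add: mps_const.hom_power mps_const.hom_of_nat)
  show ?thesis
  proof
    assume "padic_cong (series_over R I) p k f g"
    then obtain h where h: "h \<in> series_over R I" "f - g = mps_const (of_nat p ^ k) * h"
      unfolding padic_cong_def const by blast
    have "mps_nth f m - mps_nth g m = of_nat p ^ k * mps_nth h m" for m
      using arg_cong[OF h(2), of "\<lambda>f. mps_nth f m"] by simp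
    then show "\<forall>m. padic_cong R p k (mps_nth f m) (mps_nth g m)"
      unfolding padic_cong_def using series_over_nth[OF h(1)] by blast
  next
    assume "\<forall>m. padic_cong R p k (mps_nth f m) (mps_nth g m)"
    then have "\<forall>m. \<exists>b. b \<in> R \<and> mps_nth f m - mps_nth g m = of_nat p ^ k * b"
      unfolding padic_cong_def by blast
    from choice[OF this] obtain a where a: "\<And>m. a m \<in> R" "\<And>m. mps_nth f m - mps_nth g m = of_nat p ^ k * a m"
      by blast
    have "Abs_mps a \<in> series_over R I"
    proof (rule series_overI)
      fix m assume "mps_nth (Abs_mps a) m \<noteq> 0"
      then have "mps_nth f m \<noteq> 0 \<or> mps_nth g m \<noteq> 0" using a(2)[of m] torsion by force
      then show "set_mset m \<subseteq> I" using series_over_support f g by blast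
    qed (simp add: a)
    moreover have "f - g = mps_const (of_nat p ^ k) * Abs_mps a"
      by (rule mps_eqI) (simp add: a)
    ultimately show "padic_cong (series_over R I) p k f g"
      unfolding padic_cong_def const by blast
  qed
qed

section \<open>The coordinate ring as a subring of the power series\<close>

definition coord :: "complex set \<Rightarrow> nat \<Rightarrow> series set" where
  "coord R n = carrier (coordinate_ring (ring_on R) n)"

abbreviation vars :: "nat \<Rightarrow> (nat \<times> nat) set" where
  "vars n \<equiv> {..<n} \<times> {..<n}"

lemma coordinate_ring_coord: "coordinate_ring (ring_on R) n = ring_on (coord R n)"
  by (simp add: coordinate_ring_def ring_on_def coord_def)

lemma coord_eq: "coord R n = generate_ring class_ring
     (mps_const ` R \<union> elements_mat (generic_mat n) \<union> {d. d * Determinant.det (generic_mat n) = 1})"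
  by (simp add: coordinate_ring_def coord_def)

lemma class_subring_coord: "class_subring (coord R n)"
  unfolding coord_eq by (rule class_subring_generate)

lemma const_in_coord: "c \<in> R \<Longrightarrow> mps_const c \<in> coord R n"
  unfolding coord_eq by (rule generate_ring.incl) simp

lemma generic_mat_carrier [simp]: "generic_mat n \<in> carrier_mat n n"
  by (simp add: generic_mat_def)

lemma generic_mat_dim [simp]: "dim_row (generic_mat n) = n" "dim_col (generic_mat n) = n"
  by (simp_all add: generic_mat_def)

lemma generic_mat_index: "i < n \<Longrightarrow> j < n \<Longrightarrow> generic_mat n $$ (i, j) = (if i = j then 1 else 0) + mps_var (i, j)"
  by (simp add: generic_mat_def)

lemma generic_mat_in_coord: "i < n \<Longrightarrow> j < n \<Longrightarrow> generic_mat n $$ (i, j) \<in> coord R n"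
  unfolding coord_eq by (rule generate_ring.incl) (use elements_matI[OF generic_mat_carrier] in auto)

lemma var_in_coord:
  assumes "ij \<in> vars n" shows "mps_var ij \<in> coord R n"
proof -
  obtain i j where ij: "ij = (i, j)" "i < n" "j < n" using assms by auto
  interpret class_subring "coord R n" by (rule class_subring_coord)
  have "generic_mat n $$ (i, j) - (if i = j then 1 else 0) \<in> coord R n"
    by (intro diff generic_mat_in_coord ij) auto
  then show ?thesis using ij by (simp add: generic_mat_index)
qed

lemma const_term_generic_mat: "const_term (generic_mat n) = 1\<^sub>m n"
  by (rule eq_matI) (auto simp: generic_mat_def mps_nth_1 mps_nth_var)

lemma generic_mat_in_series:
  assumes "class_subring R" "i < n" "j < n"
  shows "generic_mat n $$ (i, j) \<in> series_over R (vars n)"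
proof -
  interpret R: class_subring R by fact
  interpret K: class_subring "series_over R (vars n)" by (rule R.class_subring_series)
  have "mps_var (i, j) \<in> series_over R (vars n)" using assms by auto
  then show ?thesis unfolding generic_mat_index[OF assms(2,3)] by (intro K.add) auto
qed

lemma const_term_det: "mps_nth (Determinant.det (generic_mat n)) {#} = 1"
  using const_coeff.hom_det[of "generic_mat n"] const_term_generic_mat by simp

lemma coord_subset:
  assumes "class_subring R"
  shows "coord R n \<subseteq> series_over R (vars n)"
proof
  interpret R: class_subring R by fact
  interpret K: class_subring "series_over R (vars n)" by (rule R.class_subring_series)
  have det: "Determinant.det (generic_mat n) \<in> series_over R (vars n)"
    by (rule K.det[OF generic_mat_carrier generic_mat_in_series[OF assms]])
  fix b assume "b \<in> coord R n"
  then show "b \<in> series_over R (vars n)"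
    unfolding coord_eq
  proof (induction rule: generate_ring.induct)
    case (incl h)
    then consider c where "c \<in> R" "h = mps_const c" | "h \<in> elements_mat (generic_mat n)"
      | "h * Determinant.det (generic_mat n) = 1" by blast
    then show ?case
    proof cases
      case 1
      then show ?thesis by auto
    next
      case 2
      then obtain i j where "i < n" "j < n" "h = generic_mat n $$ (i, j)"
        using generic_mat_carrier[of n] by (auto dest!: elements_matD)
      then show ?thesis using generic_mat_in_series[OF assms] by simp
    next
      case 3
      then show ?thesis using series_inverse_in_series[OF assms det const_term_det] by blast
    qed
  qed (auto simp: class_ring_simps)
qed

abbreviation coord_completion :: "complex set \<Rightarrow> nat \<Rightarrow> nat \<Rightarrow> (nat \<Rightarrow> series set) ring" where
  "coord_completion R n p \<equiv> padic_completion (ring_on (coord R n)) p"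

abbreviation to_coord :: "complex set \<Rightarrow> nat \<Rightarrow> nat \<Rightarrow> series \<Rightarrow> nat \<Rightarrow> series set" where
  "to_coord R n p \<equiv> to_completion (ring_on (coord R n)) p"

abbreviation generic_image :: "complex set \<Rightarrow> nat \<Rightarrow> nat \<Rightarrow> (nat \<Rightarrow> series set) mat" where
  "generic_image R n p \<equiv> map_mat (to_coord R n p) (generic_mat n)"

abbreviation generic_power :: "complex set \<Rightarrow> nat \<Rightarrow> nat \<Rightarrow> (nat \<Rightarrow> series set) mat" where
  "generic_power R n p \<equiv> entry_power (coord_completion R n p) p (generic_image R n p)"

text \<open>The data of the connection at a single prime, for a p-adically separated subring
  \<open>R\<close> of the complex numbers that contains 1/2. The last assumptions are the conjuncts
  of \<open>chern_connection\<close> at this prime, with the witnesses of its existential quantifier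
  fixed.\<close>

locale chern_prime = split_form n q + R: class_subring R
  for n :: nat and q :: "complex mat" and R :: "complex set" +
  fixes p :: nat and \<phi>\<^sub>0 :: "complex \<Rightarrow> complex" and \<delta> :: connection
    and W S :: "(nat \<Rightarrow> series set) mat"
  assumes half: "1 / 2 \<in> R" and p: "prime p" "odd p"
    and separated: "\<And>x. x \<in> R \<Longrightarrow> (\<And>k. \<exists>y\<in>R. x = of_nat p ^ k * y) \<Longrightarrow> x = 0"
    and phi0: "hom_on R \<phi>\<^sub>0" "\<And>x. x \<in> R \<Longrightarrow> \<phi>\<^sub>0 x \<in> R"
    and derivation: "p_derivation (coord_completion R n p) p (\<delta> p)"
    and phi_const: "\<And>a. a \<in> carrier (padic_completion (ring_on R) p) \<Longrightarrow>
      frobenius_of (coord_completion R n p) p (\<delta> p) (completion_map (ring_on R) (ring_on (coord R n)) p mps_const a)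
       = completion_map (ring_on R) (ring_on (coord R n)) p mps_const (completion_map (ring_on R) (ring_on R) p \<phi>\<^sub>0 a)"
    and W: "rmat_inverse (coord_completion R n p) n
       (rmat_mult (coord_completion R n p)
         (transpose_mat (generic_power R n p))
         (rmat_mult (coord_completion R n p)
            (map_mat (\<lambda>a. to_coord R n p (mps_const (\<phi>\<^sub>0 a))) q)
            (generic_power R n p))) W"
    and S: "is_binomial_sqrt (ring_on R) n p
       (rmat_minus (coord_completion R n p)
         (rmat_mult (coord_completion R n p) W
           (entry_power (coord_completion R n p) p
             (rmat_mult (coord_completion R n p)
               (transpose_mat (generic_image R n p))
               (rmat_mult (coord_completion R n p)
                 (map_mat (\<lambda>a. to_coord R n p (mps_const a)) q)
                 (generic_image R n p)))))
         (rmat_one (coord_completion R n p) n)) S"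
    and phi_X: "map_mat (frobenius_of (coord_completion R n p) p (\<delta> p))
         (generic_image R n p)
       = rmat_mult (coord_completion R n p)
          (generic_power R n p) S"
begin

abbreviation K :: "series set" where "K \<equiv> series_over R (vars n)"

sublocale approx: completion_approx "coord R n" K p
  by (intro completion_approx.intro completion_approx_axioms.intro class_subring_coord
      R.class_subring_series coord_subset R.class_subring_axioms)

abbreviation x :: "series mat" where "x \<equiv> generic_mat n"

abbreviation B :: "(nat \<Rightarrow> series set) ring" where "B \<equiv> approx.B"

abbreviation X :: "(nat \<Rightarrow> series set) mat" where "X \<equiv> map_mat approx.tc x"

abbreviation \<phi> :: "(nat \<Rightarrow> series set) \<Rightarrow> nat \<Rightarrow> series set" where
  "\<phi> \<equiv> frobenius_of B p (\<delta> p)"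

sublocale phi0: class_subring_hom R \<phi>\<^sub>0
  by unfold_locales (rule phi0)

text \<open>The entries 0, 1 and -1 are fixed by any ring homomorphism, so the twisted form in the
  Chern formula coincides with q.\<close>

lemma phi0_q: "map_mat \<phi>\<^sub>0 q = q"
proof (rule eq_matI)
  fix i j assume "i < dim_row q" "j < dim_col q"
  then show "map_mat \<phi>\<^sub>0 q $$ (i, j) = q $$ (i, j)"
    using q q_entries[of i j] phi0.hom_uminus[of 1] by auto
qed auto

lemma torsion: "of_nat p ^ k * (c :: complex) = 0 \<Longrightarrow> c = 0"
  using p by (simp add: prime_gt_0_nat)

lemma mat_approx_X: "approx.mat_approx n j X x"
  using generic_mat_in_coord approx.approx_tc by (auto simp: approx.mat_approx_def)

lemma q_in: "i < n \<Longrightarrow> j < n \<Longrightarrow> q $$ (i, j) \<in> R"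
  using q_entries[of i j] R.uminus[OF R.one] by auto

lemma mat_approx_Q: "approx.mat_approx n j (map_mat (\<lambda>a. approx.tc (mps_const a)) q) Q"
  using q q_in by (auto simp: approx.mat_approx_def intro!: approx.approx_tc const_in_coord)

lemma mat_approx_Q': "approx.mat_approx n j (map_mat (\<lambda>a. approx.tc (mps_const (\<phi>\<^sub>0 a))) q) Q"
proof -
  have "map_mat (\<lambda>a. approx.tc (mps_const (\<phi>\<^sub>0 a))) q = map_mat (\<lambda>a. approx.tc (mps_const a)) (map_mat \<phi>\<^sub>0 q)"
    by (rule eq_matI) auto
  then show ?thesis using mat_approx_Q by (simp add: phi0_q)
qed

lemma mat_approx_W: "approx.mat_approx n j W (formW p x)"
proof (rule approx.mat_approx_inverse[OF _ W])
  show "approx.mat_approx n j (rmat_mult B (transpose_mat (entry_power B p X))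
      (rmat_mult B (map_mat (\<lambda>a. approx.tc (mps_const (\<phi>\<^sub>0 a))) q) (entry_power B p X))) (formY p x)"
    unfolding formY_def
    by (intro approx.mat_approx_mult approx.mat_approx_transpose approx.mat_approx_entry_power mat_approx_X mat_approx_Q')
qed (use form_carrier[OF p(2) generic_mat_carrier const_term_generic_mat]
    formW_left[OF p(2) generic_mat_carrier const_term_generic_mat]
    form_in_series(3)[OF p(2) generic_mat_carrier const_term_generic_mat R.class_subring_axioms half
      generic_mat_in_series[OF R.class_subring_axioms]] in auto)

lemma mat_approx_U: "approx.mat_approx n j
   (rmat_minus B (rmat_mult B W (entry_power B p (rmat_mult B (transpose_mat X)
      (rmat_mult B (map_mat (\<lambda>a. approx.tc (mps_const a)) q) X)))) (rmat_one B n)) (formU p x)"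
  unfolding formU_def formZ_def
  by (intro approx.mat_approx_minus approx.mat_approx_mult approx.mat_approx_transpose approx.mat_approx_one
      approx.mat_approx_entry_power mat_approx_X mat_approx_Q mat_approx_W)

lemma K_cong: "f \<in> K \<Longrightarrow> g \<in> K \<Longrightarrow>
    padic_cong K p k f g \<longleftrightarrow> (\<forall>m. padic_cong R p k (mps_nth f m) (mps_nth g m))"
  by (rule padic_cong_series[OF R.class_subring_axioms _ _ torsion])

lemma formS_in: "i < n \<Longrightarrow> k < n \<Longrightarrow> formS p x $$ (i, k) \<in> K"
  by (rule form_in_series(5)[OF p(2) generic_mat_carrier const_term_generic_mat R.class_subring_axioms half
      generic_mat_in_series[OF R.class_subring_axioms]])

text \<open>\<open>S\<close> is a p-adic limit and \<open>formS\<close> a T-adic one, of the same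
  partial sums. Modulo p^j the partial sums are constant from some \<open>L0\<close> on, and the
  coefficient at \<open>m\<close> of a partial sum is that of \<open>formS\<close> once more than
  \<open>size m\<close> terms are taken. Congruence of series modulo p^j is congruence of
  coefficients, so the two limits agree.\<close>

lemma mat_approx_S: "approx.mat_approx n j S (formS p x)"
proof -
  let ?U = "rmat_minus B (rmat_mult B W (entry_power B p (rmat_mult B (transpose_mat X)
      (rmat_mult B (map_mat (\<lambda>a. approx.tc (mps_const a)) q) X)))) (rmat_one B n)"
  let ?a = "\<lambda>i k l. approx.tc (mps_const ((1 / 2) gchoose l)) \<otimes>\<^bsub>B\<^esub> rmat_pow B n ?U l $$ (i, k)"
  let ?f = "\<lambda>i k l. mps_const ((1 / 2) gchoose l) * (formU p x ^\<^sub>m l) $$ (i, k)"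
  note U = form_carrier(5)[OF p(2) generic_mat_carrier const_term_generic_mat]
    formU_vanishes[OF p(2) generic_mat_carrier const_term_generic_mat]
  have S': "S \<in> carrier_mat n n" "elements_mat S \<subseteq> carrier B"
    and sums: "\<And>i k. i < n \<Longrightarrow> k < n \<Longrightarrow> padic_sums (ring_on (coord R n)) p (?a i k) (S $$ (i, k))"
    using S unfolding is_binomial_sqrt_def Let_def coordinate_ring_coord rmat_def by auto
  have "approx.approx j (S $$ (i, k)) (formS p x $$ (i, k))" if ik: "i < n" "k < n" for i k
  proof -
    have "approx.approx j (?a i k l) (?f i k l)" for l
      using approx.mat_approx_pow[OF mat_approx_U, of j l] ik gbinomial_half_in[OF R.class_subring_axioms half]
      by (intro approx.approx_mult approx.approx_tc const_in_coord) (auto simp: approx.mat_approx_def)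
    then have part: "approx.approx j (\<Oplus>\<^bsub>B\<^esub>l\<in>{..<L}. ?a i k l) (\<Sum>l<L. ?f i k l)" for L
      by (rule approx.approx_sum)
    obtain L0 where L0: "\<And>L. L \<ge> L0 \<Longrightarrow> (\<Oplus>\<^bsub>B\<^esub>l\<in>{..<L}. ?a i k l) j = (S $$ (i, k)) j"
      using sums[OF ik] unfolding padic_sums_def eventually_sequentially by blast
    have SB: "S $$ (i, k) \<in> carrier B" using S' ik elements_matI[OF S'(1) ik refl] by blast
    have appr: "approx.approx j (S $$ (i, k)) (\<Sum>l<L. ?f i k l)" if "L \<ge> L0" for L
      using approx.approx_cong_left[OF part SB] L0[OF that] by simp
    show ?thesis
    proof (rule approx.approx_cong[OF appr[OF order_refl] formS_in[OF ik]])
      have K0: "(\<Sum>l<L0. ?f i k l) \<in> K" using appr[OF order_refl] approx.approx_in by blast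
      show "padic_cong K p j (\<Sum>l<L0. ?f i k l) (formS p x $$ (i, k))"
        unfolding K_cong[OF K0 formS_in[OF ik]]
      proof
        fix m :: "(nat \<times> nat) multiset"
        \<comment> \<open>Long enough for both topologies: past \<open>L0\<close> the sum is stable
          modulo p^j, and past \<open>size m\<close> the coefficient at \<open>m\<close> is
          final.\<close>
        let ?L = "max L0 (Suc (size m))"
        have "padic_cong K p j (\<Sum>l<L0. ?f i k l) (\<Sum>l<?L. ?f i k l)"
          using approx.approx_unique[OF appr[OF order_refl] appr[OF max.cobounded1]] .
        moreover have "(\<Sum>l<?L. ?f i k l) \<in> K" using approx.approx_in(2)[OF appr[OF max.cobounded1]] .
        ultimately have "padic_cong R p j (mps_nth (\<Sum>l<L0. ?f i k l) m) (mps_nth (\<Sum>l<?L. ?f i k l) m)"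
          using K_cong[OF K0] by blast
        moreover have "mps_nth (\<Sum>l<?L. ?f i k l) m = mps_nth (formS p x $$ (i, k)) m"
        proof -
          define L' where "L' = ?L - 1"
          have L': "?L = Suc L'" "size m \<le> L'" by (auto simp: L'_def)
          show ?thesis
            unfolding formS_def mat_series_nth[OF U ik L'(2)] L'(1) lessThan_Suc_atMost by simp
        qed
        ultimately show "padic_cong R p j (mps_nth (\<Sum>l<L0. ?f i k l) m) (mps_nth (formS p x $$ (i, k)) m)"
          by simp
      qed
    qed
  qed
  then show ?thesis
    using S'(1) form_carrier(6)[OF p(2) generic_mat_carrier const_term_generic_mat]
    by (simp add: approx.mat_approx_def)
qed

definition F :: "series mat" where "F = entry_pow p x * formS p x"

lemma F_carrier: "F \<in> carrier_mat n n"
  unfolding F_def using form_carrier(6)[OF p(2) generic_mat_carrier const_term_generic_mat]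
  by (intro mult_carrier_mat) auto

lemma chern_image_F: "chern_image q p x F"
  unfolding F_def by (rule chern_image_formS[OF p(2) generic_mat_carrier const_term_generic_mat])

lemma mat_approx_F: "approx.mat_approx n j (map_mat \<phi> X) F"
  unfolding phi_X F_def
  by (intro approx.mat_approx_mult approx.mat_approx_entry_power mat_approx_X mat_approx_S)

lemma F_in: "i < n \<Longrightarrow> k < n \<Longrightarrow> F $$ (i, k) \<in> K"
  using mat_approx_F[of 0] approx.approx_in unfolding approx.mat_approx_def by blast

lemma const_term_F: "const_term F = 1\<^sub>m n"
proof -
  note c = generic_mat_carrier const_term_generic_mat
  have "const_term (formS p x) = 1\<^sub>m n"
    using formS_vanishes[OF p(2) c] mat_vanishes_1_iff[OF form_carrier(6)[OF p(2) c]] by simp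
  moreover have "const_term (entry_pow p x) = 1\<^sub>m n"
    unfolding const_term_entry_pow const_term_generic_mat by (rule entry_pow_1) (use p in \<open>simp add: prime_gt_0_nat\<close>)
  moreover have "const_term F = const_term (entry_pow p x) * const_term (formS p x)"
    unfolding F_def by (rule const_term_mult[of _ n n _ n]) (use form_carrier(6)[OF p(2) c] in auto)
  ultimately show ?thesis by simp
qed

text \<open>The variables are the entries of T = x - 1, so x going to F means T going to F - 1. The
  default 0 outside the matrix lets every substituted series have zero constant term.\<close>

definition \<Psi> :: "series \<Rightarrow> series" where
  "\<Psi> = mps_subst (vars n) \<phi>\<^sub>0 (\<lambda>(i, k). if i < n \<and> k < n then F $$ (i, k) - 1\<^sub>m n $$ (i, k) else 0)"

sublocale Psi: substitution R \<phi>\<^sub>0 "vars n" "\<lambda>(i, k). if i < n \<and> k < n then F $$ (i, k) - 1\<^sub>m n $$ (i, k) else 0"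
proof
  show "finite (vars n)" by simp
  fix ik :: "nat \<times> nat"
  have "vanishes 1 (F $$ (i, k) - 1\<^sub>m n $$ (i, k))" if "i < n" "k < n" for i k
  proof -
    have "mat_vanishes 1 (F - 1\<^sub>m n)" using const_term_F mat_vanishes_1_iff[OF F_carrier] by simp
    then show ?thesis using that F_carrier unfolding mat_vanishes_def by auto
  qed
  then show "vanishes 1 (case ik of (i, k) \<Rightarrow> if i < n \<and> k < n then F $$ (i, k) - 1\<^sub>m n $$ (i, k) else 0)"
    by (auto split: prod.splits)
qed

lemma local_hom_Psi: "local_hom R (vars n) \<Psi>"
  unfolding \<Psi>_def by (rule Psi.local_hom_subst)

lemma Psi_const: "\<Psi> (mps_const c) = mps_const (\<phi>\<^sub>0 c)"
  unfolding \<Psi>_def by (rule Psi.subst_const)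

lemma Psi_in: "f \<in> K \<Longrightarrow> \<Psi> f \<in> K"
  unfolding \<Psi>_def
proof (rule Psi.subst_in_series[OF R.class_subring_axioms phi0(2)])
  fix ik assume "ik \<in> vars n"
  moreover have "F $$ (i, k) - 1\<^sub>m n $$ (i, k) \<in> K" if "i < n" "k < n" for i k
    by (rule approx.K.diff[OF F_in[OF that]]) (use that in auto)
  ultimately show "(case ik of (i, k) \<Rightarrow> if i < n \<and> k < n then F $$ (i, k) - 1\<^sub>m n $$ (i, k) else 0) \<in> K"
    by (auto split: prod.splits)
qed auto

sublocale PsiK: class_subring_hom K \<Psi>
  using local_hom_Psi by unfold_locales (simp add: local_hom_def)

lemma Psi_x_index: "i < n \<Longrightarrow> k < n \<Longrightarrow> \<Psi> (x $$ (i, k)) = F $$ (i, k)"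
proof -
  assume ik: "i < n" "k < n"
  have "\<Psi> (mps_var (i, k)) = F $$ (i, k) - 1\<^sub>m n $$ (i, k)"
    unfolding \<Psi>_def using ik by (subst Psi.subst_var) auto
  moreover have "\<Psi> (x $$ (i, k)) = \<Psi> (if i = k then 1 else 0) + \<Psi> (mps_var (i, k))"
    unfolding generic_mat_index[OF ik] by (rule PsiK.hom_add) (use ik in auto)
  ultimately show ?thesis using ik by auto
qed

lemma Psi_x: "map_mat \<Psi> x = F"
  by (rule eq_matI) (use F_carrier Psi_x_index generic_mat_carrier[of n] in auto)

end

section \<open>The Frobenius lift of the connection induces \<open>\<Psi>\<close> on A[[T]]\<close>

context chern_prime begin

lemma phi_hom: "\<phi> \<in> Ring.ring_hom B B" and delta_in: "g \<in> carrier B \<Longrightarrow> \<delta> p g \<in> carrier B"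
  using derivation by (auto simp: p_derivation_def)

lemma phi_in: "g \<in> carrier B \<Longrightarrow> \<phi> g \<in> carrier B"
  using ring_hom_closed[OF phi_hom] .

lemma phi_tc_const:
  assumes "c \<in> R"
  shows "\<phi> (approx.tc (mps_const c)) = approx.tc (mps_const (\<phi>\<^sub>0 c))"
proof -
  have pow: "of_nat p ^ k \<in> R" for k by blast
  have cong_const: "padic_cong (coord R n) p k (mps_const a) (mps_const b)"
    if "padic_cong R p k a b" for a b k
  proof -
    from that obtain e where e: "e \<in> R" "a - b = of_nat p ^ k * e"
      by (auto simp: padic_cong_def)
    have "(mps_const a :: series) - mps_const b = of_nat p ^ k * mps_const e"
      using arg_cong[OF e(2), of "mps_const :: _ \<Rightarrow> series"]
      by (simp only: mps_const.hom_minus mps_const.hom_mult mps_const.hom_power mps_const.hom_of_nat)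
    then show ?thesis unfolding padic_cong_def by (rule bexI[OF _ const_in_coord[OF e(1)]])
  qed
  have cong_phi0: "padic_cong R p k (\<phi>\<^sub>0 a) (\<phi>\<^sub>0 b)"
    if ab: "a \<in> R" "b \<in> R" "padic_cong R p k a b" for a b k
  proof -
    obtain e where e: "e \<in> R" "a - b = of_nat p ^ k * e"
      using ab(3) by (auto simp: padic_cong_def)
    have "\<phi>\<^sub>0 a - \<phi>\<^sub>0 b = \<phi>\<^sub>0 (of_nat p ^ k * e)"
      using phi0.hom_diff[OF ab(1,2)] e(2) by simp
    also have "\<dots> = of_nat p ^ k * \<phi>\<^sub>0 e"
      using phi0.hom_mult[OF pow e(1)] phi0.hom_power[OF R.of_nat, of p k] phi0.hom_of_nat by simp
    finally show ?thesis unfolding padic_cong_def by (rule bexI[OF _ phi0(2)[OF e(1)]])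
  qed
  have const: "completion_map (ring_on R) (ring_on (coord R n)) p mps_const (to_completion (ring_on R) p a)
      = approx.tc (mps_const a)" if "a \<in> R" for a
  proof
    fix k
    show "completion_map (ring_on R) (ring_on (coord R n)) p mps_const (to_completion (ring_on R) p a) k = approx.tc (mps_const a) k"
      unfolding approx.L.to_completion_nth
      by (rule completion_map_nth[of R "coord R n" p k mps_const a "to_completion (ring_on R) p a",
          OF R.class_subring_axioms class_subring_coord cong_const that R.to_completion_nth])
  qed
  have phi0_map: "completion_map (ring_on R) (ring_on R) p \<phi>\<^sub>0 (to_completion (ring_on R) p c) = to_completion (ring_on R) p (\<phi>\<^sub>0 c)"
  proof
    fix k
    have "completion_map (ring_on R) (ring_on R) p \<phi>\<^sub>0 (to_completion (ring_on R) p c) k = padic_coset R p k (\<phi>\<^sub>0 c)"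
      by (rule completion_map_nth[of R R p k \<phi>\<^sub>0 c "to_completion (ring_on R) p c",
          OF R.class_subring_axioms R.class_subring_axioms cong_phi0 assms R.to_completion_nth])
    then show "completion_map (ring_on R) (ring_on R) p \<phi>\<^sub>0 (to_completion (ring_on R) p c) k = to_completion (ring_on R) p (\<phi>\<^sub>0 c) k"
      using R.to_completion_nth[of p "\<phi>\<^sub>0 c" k] by (rule trans[OF _ sym])
  qed
  show ?thesis
    using phi_const[OF R.to_completion_in[OF assms]] const[OF assms] const[OF phi0(2)[OF assms]] phi0_map
    by simp
qed

text \<open>Comparing the two maps on the coordinate ring is thereby reduced to its generators:
  constants, entries of x, and the inverse determinant.\<close>

lemma class_subring_approx_Psi: "class_subring {b \<in> coord R n. \<forall>j. approx.approx j (\<phi> (approx.tc b)) (\<Psi> b)}"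
proof
  have sub: "b \<in> K" if "b \<in> coord R n" for b using that approx.LK by blast
  show "1 \<in> {b \<in> coord R n. \<forall>j. approx.approx j (\<phi> (approx.tc b)) (\<Psi> b)}"
    using ring_hom_one[OF phi_hom] approx.approx_1 by (simp add: approx.L.to_completion_1)
  fix a b assume ab: "a \<in> {b \<in> coord R n. \<forall>j. approx.approx j (\<phi> (approx.tc b)) (\<Psi> b)}"
    "b \<in> {b \<in> coord R n. \<forall>j. approx.approx j (\<phi> (approx.tc b)) (\<Psi> b)}"
  then have c: "a \<in> coord R n" "b \<in> coord R n" by auto
  note i = approx.L.to_completion_in[of a p] approx.L.to_completion_in[of b p]
  show "a + b \<in> {b \<in> coord R n. \<forall>j. approx.approx j (\<phi> (approx.tc b)) (\<Psi> b)}"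
    using ab approx.approx_add PsiK.hom_add[OF sub sub, of a b] ring_hom_add[OF phi_hom i] c
    by (auto simp: approx.L.to_completion_add)
  show "a * b \<in> {b \<in> coord R n. \<forall>j. approx.approx j (\<phi> (approx.tc b)) (\<Psi> b)}"
    using ab approx.approx_mult PsiK.hom_mult[OF sub sub, of a b] ring_hom_mult[OF phi_hom i] c
    by (auto simp: approx.L.to_completion_mult)
next
  have sub: "b \<in> K" if "b \<in> coord R n" for b using that approx.LK by blast
  interpret phi: ring_hom_cring B B \<phi>
    by (intro ring_hom_cring.intro ring_hom_cring_axioms.intro approx.B.cring_axioms phi_hom)
  fix a assume a: "a \<in> {b \<in> coord R n. \<forall>j. approx.approx j (\<phi> (approx.tc b)) (\<Psi> b)}"
  then have c: "a \<in> coord R n" by auto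
  have "\<phi> (approx.tc (- a)) = \<ominus>\<^bsub>B\<^esub> \<phi> (approx.tc a)"
    unfolding approx.L.to_completion_uminus[OF c] by (rule phi.hom_a_inv[OF approx.L.to_completion_in[OF c]])
  then show "- a \<in> {b \<in> coord R n. \<forall>j. approx.approx j (\<phi> (approx.tc b)) (\<Psi> b)}"
    using a approx.approx_uminus PsiK.hom_uminus[OF sub[OF c]] by auto
qed

lemma approx_Psi:
  assumes "b \<in> coord R n"
  shows "approx.approx j (\<phi> (approx.tc b)) (\<Psi> b)"
proof -
  let ?P = "{b \<in> coord R n. \<forall>j. approx.approx j (\<phi> (approx.tc b)) (\<Psi> b)}"
  interpret P: class_subring ?P by (rule class_subring_approx_Psi)
  have entry: "x $$ (i, k) \<in> ?P" if ik: "i < n" "k < n" for i k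
    using mat_approx_F ik generic_mat_in_coord[OF ik] Psi_x_index[OF ik] by (auto simp: approx.mat_approx_def)
  have det: "Determinant.det x \<in> ?P"
    by (rule P.det[OF generic_mat_carrier entry])
  have "b \<in> ?P"
    using assms[unfolded coord_eq]
  proof (induction rule: generate_ring.induct)
    case (incl h)
    have hc: "h \<in> coord R n" unfolding coord_eq using incl by (rule generate_ring.incl)
    consider c where "c \<in> R" "h = mps_const c" | "h \<in> elements_mat x"
      | "h * Determinant.det x = 1" using incl by blast
    then show ?case
    proof cases
      case 1
      then have "approx.approx j (\<phi> (approx.tc h)) (\<Psi> h)" for j
        using phi_tc_const[of c] approx.approx_tc[OF const_in_coord[OF phi0(2)[of c]]] by (simp add: Psi_const)
      then show ?thesis using hc by blast
    next
      case 2
      then obtain i k where "i < n" "k < n" "h = x $$ (i, k)" by (auto dest!: elements_matD)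
      then show ?thesis using entry by blast
    next
      \<comment> \<open>The determinant lies in the comparison subring as a polynomial in the
        entries. Its inverse is handled by uniqueness of inverses modulo p^j.\<close>
      case 3
      have dc: "Determinant.det x \<in> coord R n" and da: "\<And>j. approx.approx j (\<phi> (approx.tc (Determinant.det x))) (\<Psi> (Determinant.det x))"
        using det by auto
      have hK: "h \<in> K" "Determinant.det x \<in> K" using hc dc approx.LK by auto
      have "\<phi> (approx.tc h) \<otimes>\<^bsub>B\<^esub> \<phi> (approx.tc (Determinant.det x)) = \<phi> (approx.tc (h * Determinant.det x))"
        using ring_hom_mult[OF phi_hom] approx.L.to_completion_in hc dc by (simp add: approx.L.to_completion_mult)
      also have "\<dots> = \<one>\<^bsub>B\<^esub>"
        using 3 ring_hom_one[OF phi_hom] by (simp add: approx.L.to_completion_1)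
      finally have inv: "\<phi> (approx.tc h) \<otimes>\<^bsub>B\<^esub> \<phi> (approx.tc (Determinant.det x)) = \<one>\<^bsub>B\<^esub>" .
      have "\<Psi> (Determinant.det x) * \<Psi> h = 1"
        using PsiK.hom_mult[OF hK(2,1)] 3 by (simp add: mult.commute)
      then have "approx.approx j (\<phi> (approx.tc h)) (\<Psi> h)" for j
        by (intro approx.approx_inverse[OF da _ inv] phi_in approx.L.to_completion_in hc Psi_in hK)
      then show ?thesis using hc by blast
    qed
  next
    case (a_inv h)
    then show ?case by (simp only: class_ring_simps P.uminus)
  next
    case (eng_add h1 h2)
    then show ?case by (simp only: class_ring_simps P.add)
  next
    case (eng_mult h1 h2)
    then show ?case by (simp only: class_ring_simps P.mult)
  qed (simp only: class_ring_simps P.one)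
  then show ?thesis by blast
qed

text \<open>Congruence modulo p^j and (T)^k together. A coefficient of degree below k of the image
  involves only coefficients of degree below k of the argument, and \<phi>\<open>\<^sub>0\<close>
  maps p^j R into itself.\<close>

lemma Psi_padic_cong:
  assumes "f \<in> K" "g \<in> K" "\<And>m. size m < k \<Longrightarrow> padic_cong R p j (mps_nth f m) (mps_nth g m)" "size m < k"
  shows "padic_cong R p j (mps_nth (\<Psi> f) m) (mps_nth (\<Psi> g) m)"
proof -
  have t: "(\<Prod>ik\<in>#a. (case ik of (i, k) \<Rightarrow> if i < n \<and> k < n then F $$ (i, k) - 1\<^sub>m n $$ (i, k) else 0)) \<in> K"
    if "set_mset a \<subseteq> vars n" for a
  proof (rule approx.K.prod_mset)
    fix ik assume ik: "ik \<in># a"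
    have "F $$ (i, k) - 1\<^sub>m n $$ (i, k) \<in> K" if "i < n" "k < n" for i k
      by (rule approx.K.diff[OF F_in[OF that]]) (use that in auto)
    then show "(case ik of (i, k) \<Rightarrow> if i < n \<and> k < n then F $$ (i, k) - 1\<^sub>m n $$ (i, k) else 0) \<in> K"
      by (auto split: prod.splits)
  qed
  let ?t = "\<lambda>a. \<Prod>ik\<in>#a. (case ik of (i, k) \<Rightarrow> if i < n \<and> k < n then F $$ (i, k) - 1\<^sub>m n $$ (i, k) else 0)"
  let ?M = "{a. set_mset a \<subseteq> vars n \<and> size a \<le> size m}"
  have "\<exists>e\<in>R. \<phi>\<^sub>0 (mps_nth f a) * mps_nth (?t a) m - \<phi>\<^sub>0 (mps_nth g a) * mps_nth (?t a) m = of_nat p ^ j * e"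
    if a: "a \<in> ?M" for a
  proof -
    have "padic_cong R p j (mps_nth f a) (mps_nth g a)" using assms(3,4) a by simp
    then obtain e where e: "e \<in> R" "mps_nth f a - mps_nth g a = of_nat p ^ j * e"
      by (auto simp: padic_cong_def)
    have "\<phi>\<^sub>0 (mps_nth f a) - \<phi>\<^sub>0 (mps_nth g a) = of_nat p ^ j * \<phi>\<^sub>0 e"
      using phi0.hom_diff[OF series_over_nth[OF assms(1), of a] series_over_nth[OF assms(2), of a]] e(2)
        phi0.hom_mult[OF R.power[OF R.of_nat] e(1), of p j] phi0.hom_power[OF R.of_nat, of p j] phi0.hom_of_nat
      by simp
    then have "\<phi>\<^sub>0 (mps_nth f a) * mps_nth (?t a) m - \<phi>\<^sub>0 (mps_nth g a) * mps_nth (?t a) m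
        = of_nat p ^ j * (\<phi>\<^sub>0 e * mps_nth (?t a) m)"
      by (simp add: left_diff_distrib[symmetric] mult.assoc)
    moreover have "\<phi>\<^sub>0 e * mps_nth (?t a) m \<in> R"
      by (rule R.mult[OF phi0(2)[OF e(1)] series_over_nth[OF t]]) (use a in simp)
    ultimately show ?thesis by (rule bexI)
  qed
  then have ex: "\<forall>a\<in>?M. \<exists>e. e \<in> R \<and>
      \<phi>\<^sub>0 (mps_nth f a) * mps_nth (?t a) m - \<phi>\<^sub>0 (mps_nth g a) * mps_nth (?t a) m = of_nat p ^ j * e"
    by (auto simp: Bex_def)
  from bchoice[OF ex] obtain e where e: "\<And>a. a \<in> ?M \<Longrightarrow> e a \<in> R"
    "\<And>a. a \<in> ?M \<Longrightarrow> \<phi>\<^sub>0 (mps_nth f a) * mps_nth (?t a) m - \<phi>\<^sub>0 (mps_nth g a) * mps_nth (?t a) m = of_nat p ^ j * e a"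
    by blast
  have "mps_nth (\<Psi> f) m - mps_nth (\<Psi> g) m = (\<Sum>a\<in>?M. of_nat p ^ j * e a)"
    unfolding \<Psi>_def Psi.subst_nth[OF order_refl] sum_subtractf[symmetric] by (rule sum.cong) (use e in auto)
  also have "\<dots> = of_nat p ^ j * (\<Sum>a\<in>?M. e a)" by (simp add: sum_distrib_left)
  finally show ?thesis unfolding padic_cong_def by (rule bexI[OF _ R.sum]) (rule e(1))
qed

lemma taylor_nth:
  assumes "approx.approx j g f"
  shows "taylor (ring_on R) n p g m j = padic_coset R p j (mps_nth f m)"
proof -
  obtain b where b: "b \<in> coord R n" "g j = padic_coset (coord R n) p j b" "padic_cong K p j b f" and f: "f \<in> K"
    using assms by (auto simp: approx.approx_def)
  have cong: "padic_cong R p j (mps_nth y m) (mps_nth z m)"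
    if "y \<in> coord R n" "z \<in> coord R n" "padic_cong (coord R n) p j y z" for y z
  proof -
    have "y \<in> K" "z \<in> K" using that approx.LK by auto
    then show ?thesis using K_cong[of y z j] padic_cong_mono_ring[OF approx.LK that(3)] by blast
  qed
  have "taylor (ring_on R) n p g m j = padic_coset R p j (mps_nth b m)"
    unfolding taylor_def coordinate_ring_coord
    by (rule completion_map_nth[of "coord R n" R p j "\<lambda>b. mps_nth b m" b g,
          OF class_subring_coord R.class_subring_axioms cong b(1,2)])
  also have "\<dots> = padic_coset R p j (mps_nth f m)"
    using b(1,3) approx.LK K_cong[of b f j] f unfolding R.padic_coset_eq by blast
  finally show ?thesis .
qed

text \<open>A general element of the completion differs from the image of \<open>b\<close> by p^j
  times some h. A ring homomorphism that fixes p^j sends this difference to a multiple of p^j, so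
  only the already known value at \<open>b\<close> matters modulo p^j.\<close>

lemma approx_phi:
  assumes g: "g \<in> carrier B" "g j = padic_coset (coord R n) p j b" and b: "b \<in> coord R n"
  shows "approx.approx j (\<phi> g) (\<Psi> b)"
proof -
  interpret phi: ring_hom_cring B B \<phi>
    by (intro ring_hom_cring.intro ring_hom_cring_axioms.intro approx.B.cring_axioms phi_hom)
  have tb: "approx.tc b \<in> carrier B" by (rule approx.L.to_completion_in[OF b])
  define d where "d = g \<ominus>\<^bsub>B\<^esub> approx.tc b"
  have d: "d \<in> carrier B" using g(1) tb by (simp add: d_def)
  have "approx.tc (- b) j = padic_coset (coord R n) p j (- b)" by (rule approx.L.to_completion_nth)
  then have "d j = padic_coset (coord R n) p j (b + - b)"
    unfolding d_def a_minus_def approx.L.to_completion_uminus[OF b, symmetric]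
    using g(2) b by (intro approx.L.completion_add_nth) auto
  then have "d j = padic_coset (coord R n) p j 0" by simp
  then obtain h where h: "h \<in> carrier B" "d = approx.tc (of_nat p ^ j) \<otimes>\<^bsub>B\<^esub> h"
  proof (rule approx.L.completion_divide[OF d])
    fix y :: series assume "of_nat p ^ j * y = 0"
    then have "mps_const (of_nat p ^ j) * y = 0" by (simp add: mps_const.hom_power mps_const.hom_of_nat)
    then have "of_nat p ^ j * mps_nth y m = 0" for m
      by (metis mps_nth_0 mps_nth_const_mult)
    then show "y = 0" using torsion by (intro mps_eqI) auto
  qed
  have pj: "of_nat p ^ j \<in> coord R n" by (rule approx.L.power) simp
  have "(of_nat p ^ j :: series) = mps_const (of_nat p ^ j)" by (simp add: mps_const.hom_power mps_const.hom_of_nat)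
  moreover have "\<phi>\<^sub>0 (of_nat p ^ j) = of_nat p ^ j" using phi0.hom_power[OF R.of_nat, of p j] phi0.hom_of_nat by simp
  ultimately have phi_pj: "\<phi> (approx.tc (of_nat p ^ j)) = approx.tc (of_nat p ^ j)"
    using phi_tc_const[of "of_nat p ^ j"] by auto
  obtain e where e: "e \<in> coord R n" "approx.approx j (\<phi> h) e"
    using approx.approx_rep[OF phi_in[OF h(1)]] by blast
  have "\<phi> d = approx.tc (of_nat p ^ j) \<otimes>\<^bsub>B\<^esub> \<phi> h"
    unfolding h(2) using phi_pj ring_hom_mult[OF phi_hom approx.L.to_completion_in[OF pj] h(1)] by simp
  then have "approx.approx j (\<phi> d) (of_nat p ^ j * e)"
    using approx.approx_mult[OF approx.approx_tc[OF pj] e(2)] by simp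
  moreover have "padic_cong K p j (of_nat p ^ j * e) 0"
    unfolding padic_cong_def using e(1) approx.LK by auto
  ultimately have d0: "approx.approx j (\<phi> d) 0" by (intro approx.approx_cong[of j "\<phi> d" "of_nat p ^ j * e" 0]) auto
  have "g = approx.tc b \<oplus>\<^bsub>B\<^esub> d"
    unfolding d_def using g(1) tb by (simp add: a_minus_def approx.B.a_lcomm approx.B.r_neg)
  then have "\<phi> g = \<phi> (approx.tc b) \<oplus>\<^bsub>B\<^esub> \<phi> d"
    using ring_hom_add[OF phi_hom tb d] by simp
  then show ?thesis
    using approx.approx_add[OF approx_Psi[OF b] d0] by simp
qed

text \<open>The definite description is resolved. Its condition holds because both sides depend only
  on data modulo p^j and (T)^k. It determines the value at each \<open>m\<close>, since some element
  of the coordinate ring agrees with \<open>f\<close> in all degrees up to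
  \<open>size m\<close>.\<close>

lemma formal_frobenius_eq:
  assumes f: "f \<in> K"
  shows "formal_frobenius (ring_on R) n \<delta> p (\<lambda>m. to_completion (ring_on R) p (mps_nth f m))
    = (\<lambda>m. to_completion (ring_on R) p (mps_nth (\<Psi> f) m))"
  unfolding formal_frobenius_def coordinate_ring_coord
proof (rule the_equality)
  let ?f = "\<lambda>m. to_completion (ring_on R) p (mps_nth f m)"
  let ?H = "\<lambda>m. to_completion (ring_on R) p (mps_nth (\<Psi> f) m)"
  have main: "cong_T k (taylor (ring_on R) n p (\<phi> g)) ?H"
    if g: "g \<in> carrier B" and cong: "cong_T k (taylor (ring_on R) n p g) ?f" for k g
    unfolding cong_T_def
  proof (intro allI impI ext)
    fix m :: "(nat \<times> nat) multiset" and j assume m: "size m < k"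
    obtain b where b: "b \<in> coord R n" "g j = padic_coset (coord R n) p j b" "approx.approx j g b"
      by (rule approx.approx_rep[OF g])
    have bK: "b \<in> K" using b(1) approx.LK by blast
    have "padic_cong R p j (mps_nth b m) (mps_nth f m)" if "size m < k" for m
    proof -
      have "taylor (ring_on R) n p g m j = to_completion (ring_on R) p (mps_nth f m) j"
        using cong that by (simp add: cong_T_def)
      then show ?thesis
        unfolding taylor_nth[OF b(3)] R.to_completion_nth R.padic_coset_eq .
    qed
    then have "padic_cong R p j (mps_nth (\<Psi> b) m) (mps_nth (\<Psi> f) m)"
      using Psi_padic_cong[OF bK f _ m] by blast
    then show "taylor (ring_on R) n p (\<phi> g) m j = to_completion (ring_on R) p (mps_nth (\<Psi> f) m) j"
      unfolding taylor_nth[OF approx_phi[OF g b(2,1)]] R.to_completion_nth R.padic_coset_eq .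
  qed
  then show "\<forall>k. \<forall>g\<in>carrier B. cong_T k (taylor (ring_on R) n p g) ?f \<longrightarrow> cong_T k (taylor (ring_on R) n p (\<phi> g)) ?H"
    by blast
  fix H assume H: "\<forall>k. \<forall>g\<in>carrier B. cong_T k (taylor (ring_on R) n p g) ?f \<longrightarrow> cong_T k (taylor (ring_on R) n p (\<phi> g)) H"
  show "H = ?H"
  proof
    fix m :: "(nat \<times> nat) multiset"
    obtain b where b: "b \<in> coord R n" "vanishes (Suc (size m)) (f - b)"
      using series_poly_approx[OF _ class_subring_coord f const_in_coord var_in_coord] by blast
    have "taylor (ring_on R) n p (approx.tc b) m' = ?f m'" if "size m' < Suc (size m)" for m'
    proof
      fix j
      have "mps_nth b m' = mps_nth f m'" using vanishesD[OF b(2) that] by simp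
      then show "taylor (ring_on R) n p (approx.tc b) m' j = ?f m' j"
        unfolding taylor_nth[OF approx.approx_tc[OF b(1)]] R.to_completion_nth by simp
    qed
    then have c: "cong_T (Suc (size m)) (taylor (ring_on R) n p (approx.tc b)) ?f" by (simp add: cong_T_def)
    have tb: "approx.tc b \<in> carrier B" by (rule approx.L.to_completion_in[OF b(1)])
    have "taylor (ring_on R) n p (\<phi> (approx.tc b)) m = H m"
      using H c tb unfolding cong_T_def by blast
    moreover have "taylor (ring_on R) n p (\<phi> (approx.tc b)) m = ?H m"
      using main[OF tb c] unfolding cong_T_def by blast
    ultimately show "H m = ?H m" by simp
  qed
qed

text \<open>Uniqueness of the preimage in A[[T]] is the p-adic separatedness of A, applied to each
  coefficient.\<close>

lemma series_frobenius_eq: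
  assumes f: "f \<in> K"
  shows "series_frobenius (ring_on R) n \<delta> p f = \<Psi> f"
  unfolding series_frobenius_def power_series_ring_eq' formal_frobenius_eq[OF f]
proof (rule the_equality)
  show "\<Psi> f \<in> carrier (ring_on (series_over (carrier (ring_on R)) (vars n))) \<and>
    (\<lambda>m. to_completion (ring_on R) p (mps_nth (\<Psi> f) m)) = (\<lambda>m. to_completion (ring_on R) p (mps_nth (\<Psi> f) m))"
    using Psi_in[OF f] by simp
  fix h assume h: "h \<in> carrier (ring_on (series_over (carrier (ring_on R)) (vars n))) \<and>
    (\<lambda>m. to_completion (ring_on R) p (mps_nth h m)) = (\<lambda>m. to_completion (ring_on R) p (mps_nth (\<Psi> f) m))"
  show "h = \<Psi> f"
  proof (rule mps_eqI)
    fix m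
    have hR: "mps_nth h m \<in> R" "mps_nth (\<Psi> f) m \<in> R" using h series_over_nth Psi_in[OF f] by auto
    have "to_completion (ring_on R) p (mps_nth h m) k = to_completion (ring_on R) p (mps_nth (\<Psi> f) m) k" for k
      using h by metis
    then have "\<exists>y\<in>R. mps_nth h m - mps_nth (\<Psi> f) m = of_nat p ^ k * y" for k
      unfolding R.to_completion_nth R.padic_coset_eq padic_cong_def .
    then have "mps_nth h m - mps_nth (\<Psi> f) m = 0" by (intro separated) (use hR in auto)
    then show "mps_nth h m = mps_nth (\<Psi> f) m" by simp
  qed
qed

text \<open>The relation between a lift and the p-th power comes from the p-derivation on the
  completed coordinate ring. It passes to \<open>f\<close> coefficient by coefficient, through an
  element \<open>b\<close> of the coordinate ring that is T-adically close to \<open>f\<close>. It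
  is what makes commutators divisible by the primes.\<close>

lemma frobenius_cong:
  assumes f: "f \<in> K"
  shows "\<exists>h\<in>K. \<Psi> f - f ^ p = of_nat p * h"
proof -
  have "padic_cong R p 1 (mps_nth (\<Psi> f) m) (mps_nth (f ^ p) m)" for m
  proof -
    obtain b where b: "b \<in> coord R n" "vanishes (Suc (size m)) (f - b)"
      using series_poly_approx[OF _ class_subring_coord f const_in_coord var_in_coord] by blast
    have bK: "b \<in> K" using b(1) approx.LK by blast
    have tb: "approx.tc b \<in> carrier B" by (rule approx.L.to_completion_in[OF b(1)])
    obtain e where e: "e \<in> coord R n" "approx.approx 1 (\<delta> p (approx.tc b)) e"
      using approx.approx_rep[OF delta_in[OF tb]] by blast
    have add_pow: "approx.approx 1 (add_pow B k (\<delta> p (approx.tc b))) (of_nat k * e)" for k :: nat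
    proof (induction k)
      case 0
      then show ?case using approx.approx_0 by simp
    next
      case (Suc k)
      have "add_pow B (Suc k) (\<delta> p (approx.tc b)) = add_pow B k (\<delta> p (approx.tc b)) \<oplus>\<^bsub>B\<^esub> \<delta> p (approx.tc b)"
        using delta_in[OF tb] by simp
      then show ?case using approx.approx_add[OF Suc e(2)] by (simp add: distrib_right add.commute)
    qed
    have "approx.approx 1 (\<phi> (approx.tc b)) (b ^ p + of_nat p * e)"
      unfolding frobenius_of_def
      by (intro approx.approx_add approx.approx_pow approx.approx_tc b(1) add_pow)
    then have "padic_cong K p 1 (\<Psi> b) (b ^ p + of_nat p * e)"
      using approx.approx_unique approx_Psi[OF b(1)] by blast
    moreover have "padic_cong K p 1 (b ^ p + of_nat p * e) (b ^ p)"
      unfolding padic_cong_def using e(1) approx.LK by auto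
    ultimately have "padic_cong K p 1 (\<Psi> b) (b ^ p)" using approx.K.padic_cong_trans by blast
    then have "padic_cong R p 1 (mps_nth (\<Psi> b) m) (mps_nth (b ^ p) m)"
      using K_cong[OF Psi_in[OF bK] approx.K.power[OF bK]] by blast
    moreover have "mps_nth (\<Psi> f) m = mps_nth (\<Psi> b) m"
    proof -
      have "vanishes (Suc (size m)) (\<Psi> (f - b))"
        using local_hom_Psi b(2) approx.K.diff[OF f bK] unfolding local_hom_def by blast
      then show ?thesis using vanishesD[of _ _ m] PsiK.hom_diff[OF f bK] by fastforce
    qed
    moreover have "vanishes (Suc (size m)) (f ^ l - b ^ l)" for l
      by (induction l) (auto intro: vanishes_cong_mult b(2))
    then have "mps_nth (f ^ p) m = mps_nth (b ^ p) m"
      using vanishesD[of _ "f ^ p - b ^ p" m] by fastforce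
    ultimately show ?thesis by simp
  qed
  then have "padic_cong K p 1 (\<Psi> f) (f ^ p)"
    using K_cong[OF Psi_in[OF f] approx.K.power[OF f]] by blast
  then show ?thesis unfolding padic_cong_def by simp
qed

end

section \<open>Evaluation along the orthogonal group\<close>

text \<open>The ideal-theoretic mean value formula: f - f(\<tau>) lies in the ideal generated by the
  finitely many differences of variables and their substitutes. For monomials this is telescoping.
  For series, the cofactors of a monomial of degree d vanish to order d - 1, so they can be
  summed.\<close>

lemma substitution_difference:
  fixes f :: "('i, 'a::comm_ring_1) mps"
  assumes R: "class_subring R" and fin: "finite I" and f: "f \<in> series_over R I"
    and \<tau>: "\<And>i. i \<in> I \<Longrightarrow> \<tau> i \<in> series_over R I" "\<And>i. vanishes 1 (\<tau> i)"
  shows "\<exists>g. (\<forall>i\<in>I. g i \<in> series_over R I) \<and>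
    f - mps_subst I id \<tau> f = (\<Sum>i\<in>I. (mps_var i - \<tau> i) * g i)"
proof -
  interpret R: class_subring R by fact
  interpret K: class_subring "series_over R I :: ('i, 'a) mps set" by (rule R.class_subring_series)
  interpret e: substitution R id I \<tau>
    by unfold_locales (use fin \<tau> in \<open>auto simp: hom_on_def\<close>)
  interpret T: substitution R id I mps_var
    by unfold_locales (use fin vanishes_var in \<open>auto simp: hom_on_def\<close>)
  have id: "mps_subst I id mps_var f = f"
    by (rule local_hom_eqI[OF R fin T.local_hom_subst _ _ _ f, where H = "\<lambda>f. f"])
       (auto simp: local_hom_def hom_on_def)
  let ?T = "\<lambda>a. \<Prod>i\<in>#a. mps_var i :: ('i, 'a) mps" and ?t = "\<lambda>a. \<Prod>i\<in>#a. \<tau> i"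
  \<comment> \<open>The order of the cofactors is carried through the induction; without it the
    infinite sums defining \<open>g\<close> below would not converge.\<close>
  define P where "P a c \<longleftrightarrow> (\<forall>i\<in>I. c i \<in> series_over R I \<and> vanishes (size a - 1) (c i)) \<and>
      ?T a - ?t a = (\<Sum>i\<in>I. (mps_var i - \<tau> i) * c i)" for a and c :: "'i \<Rightarrow> ('i, 'a) mps"
  have ex: "\<exists>c. P a c" if "set_mset a \<subseteq> I" for a
    using that
  proof (induction a)
    case empty
    show ?case by (intro exI[of _ "\<lambda>_. 0"]) (simp add: P_def)
  next
    case (add j a)
    then have j: "j \<in> I" and a: "set_mset a \<subseteq> I" by auto
    obtain c where c: "\<And>i. i \<in> I \<Longrightarrow> c i \<in> series_over R I" "\<And>i. i \<in> I \<Longrightarrow> vanishes (size a - 1) (c i)"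
      "?T a - ?t a = (\<Sum>i\<in>I. (mps_var i - \<tau> i) * c i)"
      using add.IH[OF a] unfolding P_def by blast
    define c' where "c' i = mps_var j * c i + (if i = j then ?t a else 0)" for i
    have ta: "?t a \<in> series_over R I" using \<tau>(1) a by (intro K.prod_mset) auto
    have "c' i \<in> series_over R I \<and> vanishes (size a) (c' i)" if i: "i \<in> I" for i
    proof
      show "c' i \<in> series_over R I"
        unfolding c'_def using R.var_in_series[OF j] c(1)[OF i] ta by (intro K.add K.mult) auto
      have "vanishes (1 + (size a - 1)) (mps_var j * c i)"
        by (rule vanishes_mult[OF vanishes_var c(2)[OF i]])
      then have "vanishes (size a) (mps_var j * c i)" by (rule vanishes_mono) simp
      then show "vanishes (size a) (c' i)"
        unfolding c'_def using vanishes_prod_mset[of \<tau> a] \<tau>(2) by (intro vanishes_add) auto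
    qed
    moreover have "?T (add_mset j a) - ?t (add_mset j a) = (\<Sum>i\<in>I. (mps_var i - \<tau> i) * c' i)"
    proof -
      have "(\<Sum>i\<in>I. (mps_var i - \<tau> i) * c' i)
          = mps_var j * (\<Sum>i\<in>I. (mps_var i - \<tau> i) * c i) + (\<Sum>i\<in>I. if i = j then (mps_var i - \<tau> i) * ?t a else 0)"
        by (auto simp: c'_def sum.distrib[symmetric] sum_distrib_left algebra_simps intro!: sum.cong)
      also have "\<dots> = mps_var j * (?T a - ?t a) + (mps_var j - \<tau> j) * ?t a"
        using fin j c(3) by (simp add: sum.delta)
      also have "\<dots> = ?T (add_mset j a) - ?t (add_mset j a)" by (simp add: algebra_simps)
      finally show ?thesis ..
    qed
    ultimately show ?case unfolding P_def by (intro exI[of _ c']) simp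
  qed
  define c where "c a = (SOME c. P a c)" for a
  have Pc: "P a (c a)" if "set_mset a \<subseteq> I" for a
    unfolding c_def by (rule someI_ex[OF ex[OF that]])
  have c: "\<And>a i. set_mset a \<subseteq> I \<Longrightarrow> i \<in> I \<Longrightarrow> c a i \<in> series_over R I"
    "\<And>a i. set_mset a \<subseteq> I \<Longrightarrow> i \<in> I \<Longrightarrow> vanishes (size a - 1) (c a i)"
    "\<And>a. set_mset a \<subseteq> I \<Longrightarrow> ?T a - ?t a = (\<Sum>i\<in>I. (mps_var i - \<tau> i) * c a i)"
    using Pc[unfolded P_def] by blast+
  let ?M = "\<lambda>k. {a. set_mset a \<subseteq> I \<and> size a \<le> k}"
  \<comment> \<open>The range reaches degree \<open>size m + 1\<close> because cofactors have one
    order less than their monomial.\<close>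
  define g where "g i = Abs_mps (\<lambda>m. \<Sum>a\<in>?M (Suc (size m)). mps_nth f a * mps_nth (c a i) m)" for i
  have g_nth: "mps_nth (g i) m = (\<Sum>a\<in>?M (Suc k). mps_nth f a * mps_nth (c a i) m)" if im: "i \<in> I" "size m \<le> k" for i m k
  proof -
    have zero: "mps_nth (c a i) m = 0" if a: "set_mset a \<subseteq> I" "\<not> size a \<le> Suc (size m)" for a
    proof (rule vanishesD[OF c(2)[OF a(1) im(1)]])
      show "size m < size a - 1" using a(2) by linarith
    qed
    show ?thesis
      unfolding g_def mps_nth_Abs
    proof (rule sum.mono_neutral_left[OF finite_multisets_size_le[OF fin]])
      show "?M (Suc (size m)) \<subseteq> ?M (Suc k)" using im(2) by auto
      show "\<forall>a\<in>?M (Suc k) - ?M (Suc (size m)). mps_nth f a * mps_nth (c a i) m = 0"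
      proof
        fix a assume "a \<in> ?M (Suc k) - ?M (Suc (size m))"
        then show "mps_nth f a * mps_nth (c a i) m = 0" using zero[of a] by simp
      qed
    qed
  qed
  have "g i \<in> series_over R I" if i: "i \<in> I" for i
  proof (rule series_overI)
    fix m
    show "mps_nth (g i) m \<in> R"
      unfolding g_nth[OF i order_refl] using c(1)[OF _ i] series_over_nth[OF f]
      by (intro R.sum R.mult) (auto intro: series_over_nth)
    assume "mps_nth (g i) m \<noteq> 0"
    then obtain a where "a \<in> ?M (Suc (size m))" "mps_nth f a * mps_nth (c a i) m \<noteq> 0"
      unfolding g_nth[OF i order_refl] by (meson sum.not_neutral_contains_not_neutral)
    then have "mps_nth (c a i) m \<noteq> 0" "set_mset a \<subseteq> I" by auto
    then show "set_mset m \<subseteq> I" using series_over_support[OF c(1)[OF _ i], of a m] by blast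
  qed
  moreover have "f - mps_subst I id \<tau> f = (\<Sum>i\<in>I. (mps_var i - \<tau> i) * g i)"
  proof (rule mps_eq_if_cong)
    fix k
    let ?S = "\<lambda>t. \<Sum>a\<in>?M (Suc k). mps_const (mps_nth f a) * (\<Prod>i\<in>#a. t i)"
    let ?G = "\<lambda>i. \<Sum>a\<in>?M (Suc k). mps_const (mps_nth f a) * c a i"
    have "vanishes k (f - ?S mps_var)"
      using T.subst_trunc[of "Suc k" f] unfolding id id_apply by (rule vanishes_mono) simp
    moreover have "vanishes k (mps_subst I id \<tau> f - ?S \<tau>)"
      using e.subst_trunc[of "Suc k" f] unfolding id_apply by (rule vanishes_mono) simp
    ultimately have 1: "vanishes k ((f - mps_subst I id \<tau> f) - (?S mps_var - ?S \<tau>))"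
      using vanishes_diff[of k "f - ?S mps_var" "mps_subst I id \<tau> f - ?S \<tau>"] by (simp add: algebra_simps)
    have "?S mps_var - ?S \<tau> = (\<Sum>a\<in>?M (Suc k). mps_const (mps_nth f a) * (\<Sum>i\<in>I. (mps_var i - \<tau> i) * c a i))"
      unfolding sum_subtractf[symmetric] right_diff_distrib[symmetric]
      by (rule sum.cong) (use c(3) in auto)
    also have "\<dots> = (\<Sum>i\<in>I. (mps_var i - \<tau> i) * ?G i)"
      unfolding sum_distrib_left by (subst sum.swap) (simp add: mult_ac)
    finally have 2: "?S mps_var - ?S \<tau> = (\<Sum>i\<in>I. (mps_var i - \<tau> i) * ?G i)" .
    have gk: "vanishes k (?G i - g i)" if "i \<in> I" for i
      unfolding vanishes_def using g_nth[OF that, of _ k] by simp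
    have "vanishes k ((mps_var i - \<tau> i) * ?G i - (mps_var i - \<tau> i) * g i)" if "i \<in> I" for i
      by (rule vanishes_cong_mult[OF _ gk[OF that]]) simp
    then have "vanishes k ((?S mps_var - ?S \<tau>) - (\<Sum>i\<in>I. (mps_var i - \<tau> i) * g i))"
      unfolding 2 by (rule vanishes_cong_sum)
    with 1 show "vanishes k ((f - mps_subst I id \<tau> f) - (\<Sum>i\<in>I. (mps_var i - \<tau> i) * g i))"
      by (rule vanishes_cong_trans)
  qed
  ultimately show ?thesis by blast
qed

text \<open>Any ring endomorphism fixes 1/M and sends \<zeta> to an N-th root of unity, thus to a
  power of \<zeta>. Raising to powers commutes, so the endomorphisms commute on generators.\<close>

lemma cyclotomic_homs_commute:
  assumes N: "N \<ge> 1" and \<zeta>: "primitive_root N \<zeta>" and M: "M > 0"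
    and R: "R = carrier (cyclotomic_ring M \<zeta>)"
    and h: "hom_on R h" "\<And>c. c \<in> R \<Longrightarrow> h c \<in> R" and h': "hom_on R h'" "\<And>c. c \<in> R \<Longrightarrow> h' c \<in> R"
    and c: "c \<in> R"
  shows "h (h' c) = h' (h c)"
proof -
  interpret R: class_subring R unfolding R carrier_cyclotomic_ring by (rule class_subring_generate)
  interpret h: class_subring_hom R h by unfold_locales (rule h)
  interpret h': class_subring_hom R h' by unfold_locales (rule h')
  have zeta_in: "\<zeta> \<in> R" and M_in: "1 / of_nat M \<in> R"
    unfolding R carrier_cyclotomic_ring by (auto intro: generate_ring.incl)
  have pow: "\<exists>k. g \<zeta> = \<zeta> ^ k" if "class_subring_hom R g" for g :: "complex \<Rightarrow> complex"
  proof -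
    interpret g: class_subring_hom R g by fact
    have zN: "\<zeta> ^ N = 1" using \<zeta> by (simp add: primitive_root_def)
    \<comment> \<open>Counting: the N powers of a primitive root are distinct, hence they are all N
      complex roots of unity of order dividing N.\<close>
    have "inj_on (\<lambda>k. \<zeta> ^ k) {..<N}"
    proof (rule linorder_inj_onI')
      fix i k assume ik: "i \<in> {..<N}" "k \<in> {..<N}" "i < k"
      show "\<zeta> ^ i \<noteq> \<zeta> ^ k"
      proof
        assume "\<zeta> ^ i = \<zeta> ^ k"
        moreover have "\<zeta> ^ k = \<zeta> ^ i * \<zeta> ^ (k - i)" using ik(3) by (simp flip: power_add)
        ultimately have "\<zeta> ^ i * \<zeta> ^ (k - i) = \<zeta> ^ i * 1" by simp
        moreover have "\<zeta> \<noteq> 0" using zN N by (auto simp: power_0_left)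
        ultimately have "\<zeta> ^ (k - i) = 1" by simp
        then show False using \<zeta> ik by (auto simp: primitive_root_def)
      qed
    qed
    then have "card ((\<lambda>k. \<zeta> ^ k) ` {..<N}) = N" by (simp add: card_image)
    moreover have "(\<lambda>k. \<zeta> ^ k) ` {..<N} \<subseteq> {z. z ^ N = 1}"
      using zN by (auto simp: power_mult[symmetric] mult.commute[of _ N]) (simp add: power_mult)
    moreover have "finite {z :: complex. z ^ N = 1}" "card {z :: complex. z ^ N = 1} = N"
      using N by (auto simp: finite_roots_unity card_roots_unity_eq)
    ultimately have "(\<lambda>k. \<zeta> ^ k) ` {..<N} = {z. z ^ N = 1}" by (intro card_subset_eq) auto
    moreover have "g \<zeta> ^ N = 1" using g.hom_power[OF zeta_in, of N] zN by simp
    ultimately show ?thesis by blast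
  qed
  obtain k where k: "h \<zeta> = \<zeta> ^ k" using pow[OF h.class_subring_hom_axioms] by blast
  obtain l where l: "h' \<zeta> = \<zeta> ^ l" using pow[OF h'.class_subring_hom_axioms] by blast
  have inv: "g (1 / of_nat M) = 1 / of_nat M" if "class_subring_hom R g" for g :: "complex \<Rightarrow> complex"
  proof -
    interpret g: class_subring_hom R g by fact
    have "of_nat M * g (1 / of_nat M) = g (of_nat M * (1 / of_nat M))"
      using g.hom_mult[OF R.of_nat M_in, of M] g.hom_of_nat by simp
    then show ?thesis using M by (simp add: field_simps)
  qed
  show ?thesis
    using c[unfolded R carrier_cyclotomic_ring]
  proof (induction rule: generate_ring.induct)
    case (incl c)
    then consider "c = 1 / of_nat M" | "c = \<zeta>" by auto
    then show ?case
    proof cases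
      case 2
      then show ?thesis
        using k l h.hom_power[OF zeta_in, of l] h'.hom_power[OF zeta_in, of k]
        by (simp add: mult.commute flip: power_mult)
    qed (simp add: inv[OF h.class_subring_hom_axioms] inv[OF h'.class_subring_hom_axioms])
  next
    case (a_inv c)
    then have "c \<in> R" by (simp add: R carrier_cyclotomic_ring)
    then show ?case using a_inv.IH h(2) h'(2) by (simp add: class_ring_simps h.hom_uminus h'.hom_uminus)
  next
    case (eng_add c d)
    then have "c \<in> R" "d \<in> R" by (simp_all add: R carrier_cyclotomic_ring)
    then show ?case using eng_add.IH h(2) h'(2) by (simp add: h.hom_add h'.hom_add)
  next
    case (eng_mult c d)
    then have "c \<in> R" "d \<in> R" by (simp_all add: R carrier_cyclotomic_ring)
    then show ?case using eng_mult.IH h(2) h'(2) by (simp add: h.hom_mult h'.hom_mult)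
  qed simp
qed

context class_subring begin

lemma idealI':
  assumes "J \<subseteq> R" "0 \<in> J" "\<And>a b. a \<in> J \<Longrightarrow> b \<in> J \<Longrightarrow> a + b \<in> J" "\<And>a c. a \<in> J \<Longrightarrow> c \<in> R \<Longrightarrow> c * a \<in> J"
  shows "ideal J (ring_on R)"
proof -
  interpret cring "ring_on R" by (rule cring_ring_on)
  have neg: "- a \<in> J" if "a \<in> J" for a
    using assms(4)[OF that uminus[OF one]] by simp
  have "subgroup J (add_monoid (ring_on R))"
    by (rule add.subgroupI) (use assms neg a_inv_ring_on in \<open>auto simp flip: a_inv_def\<close>)
  then show ?thesis
    by (rule idealI[OF ring_axioms]) (use assms(4) in \<open>auto simp: mult.commute\<close>)
qed

lemma idealD:
  assumes "ideal J (ring_on R)"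
  shows "J \<subseteq> R" "0 \<in> J" "a \<in> J \<Longrightarrow> b \<in> J \<Longrightarrow> a + b \<in> J" "a \<in> J \<Longrightarrow> c \<in> R \<Longrightarrow> c * a \<in> J"
proof -
  interpret ideal J "ring_on R" by fact
  show "J \<subseteq> R" using a_subset by simp
  show "0 \<in> J" using additive_subgroup.zero_closed[OF additive_subgroup_axioms] by simp
  show "a \<in> J \<Longrightarrow> b \<in> J \<Longrightarrow> a + b \<in> J"
    using additive_subgroup.a_closed[OF additive_subgroup_axioms] by simp
  show "a \<in> J \<Longrightarrow> c \<in> R \<Longrightarrow> c * a \<in> J" using I_l_closed by simp
qed

end

text \<open>A local homomorphism may move constants, but it fixes the zeros and ones of the identity
  matrix and sends series without constant term to such series.\<close>

lemma local_hom_const_term: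
  assumes R: "class_subring R" and H: "local_hom R I H"
    and g: "g \<in> carrier_mat n n" "const_term g = 1\<^sub>m n" "\<And>i j. i < n \<Longrightarrow> j < n \<Longrightarrow> g $$ (i, j) \<in> series_over R I"
  shows "const_term (map_mat H g) = 1\<^sub>m n"
proof -
  interpret R: class_subring R by fact
  interpret K: class_subring "series_over R I" by (rule R.class_subring_series)
  interpret H: class_subring_hom "series_over R I" H using H by unfold_locales (simp add: local_hom_def)
  have "mps_nth (H (g $$ (i, j))) {#} = 1\<^sub>m n $$ (i, j)" if ij: "i < n" "j < n" for i j
  proof -
    have "mps_nth (g $$ (i, j)) {#} = 1\<^sub>m n $$ (i, j)"
      using arg_cong[OF g(2), of "\<lambda>Y. Y $$ (i, j)"] ij g(1) by simp
    then have "vanishes 1 (g $$ (i, j) - 1\<^sub>m n $$ (i, j))"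
      unfolding vanishes_1_iff using ij by (auto simp: mps_nth_1)
    moreover have 1: "1\<^sub>m n $$ (i, j) \<in> series_over R I" using ij by auto
    ultimately have "vanishes 1 (H (g $$ (i, j) - 1\<^sub>m n $$ (i, j)))"
      using H K.diff[OF g(3)[OF ij] 1] unfolding local_hom_def by blast
    then have "vanishes 1 (H (g $$ (i, j)) - H (1\<^sub>m n $$ (i, j)))"
      using H.hom_diff[OF g(3)[OF ij] 1] by simp
    then show ?thesis unfolding vanishes_1_iff using ij by (auto simp: mps_nth_1 split: if_splits)
  qed
  then show ?thesis using g(1) by (intro eq_matI) auto
qed

text \<open>The equations characterising the square root are polynomial with coefficients 0, 1 and
  -1, so a local homomorphism carries them over, and with them the root that has constant term
  1.\<close>

lemma (in split_form) chern_image_hom: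
  assumes R: "class_subring R" "1 / 2 \<in> R" and H: "local_hom R I H" and p: "odd p"
    and g: "g \<in> carrier_mat n n" "const_term g = 1\<^sub>m n" "\<And>i j. i < n \<Longrightarrow> j < n \<Longrightarrow> g $$ (i, j) \<in> series_over R I"
    and F: "chern_image q p g F"
  shows "chern_image q p (map_mat H g) (map_mat H F)"
proof -
  interpret R: class_subring R by fact
  interpret K: class_subring "series_over R I" by (rule R.class_subring_series)
  interpret H: class_subring_hom "series_over R I" H using H by unfold_locales (simp add: local_hom_def)
  note fc = form_carrier[OF p g(1,2)] and fin = form_in_series[OF p g(1,2) R g(3)]
  \<comment> \<open>The root provided by \<open>chern_image\<close> need not have entries over
    \<open>R\<close>, where alone \<open>H\<close> is a homomorphism. Uniqueness replaces it by
    \<open>formS\<close>, whose entries are over \<open>R\<close>.\<close>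
  have F_eq: "F = entry_pow p g * formS p g"
    by (rule chern_image_unique[OF p g(1,2) F chern_image_formS[OF p g(1,2)]])
  have ep: "map_mat H (entry_pow p X) = entry_pow p (map_mat H X)"
    if "X \<in> carrier_mat n n" "\<And>i j. i < n \<Longrightarrow> j < n \<Longrightarrow> X $$ (i, j) \<in> series_over R I" for X
    using that by (intro eq_matI) (auto simp: H.hom_power)
  have epg: "map_mat H (entry_pow p g) = entry_pow p (map_mat H g)"
    by (rule ep[OF g(1)]) (rule g(3))
  have gp: "entry_pow p g $$ (i, j) \<in> series_over R I" if "i < n" "j < n" for i j
    using g that by auto
  have HQ: "map_mat H Q = Q"
  proof (rule eq_matI)
    fix i j assume "i < dim_row (Q :: ('c, complex) mps mat)" "j < dim_col (Q :: ('c, complex) mps mat)"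
    then show "map_mat H Q $$ (i, j) = Q $$ (i, j)"
      using q q_entries[of i j] H.hom_uminus[of 1] by (auto simp: mps_const.hom_uminus)
  qed auto
  have Qin: "Q $$ (i, j) \<in> series_over R I" if "i < n" "j < n" for i j
    using that q q_entries[of i j] R.uminus[OF R.one] by auto
  have mm: "map_mat H (X * X') = map_mat H X * map_mat H X'"
    if "X \<in> carrier_mat n n" "X' \<in> carrier_mat n n"
      "\<And>i j. i < n \<Longrightarrow> j < n \<Longrightarrow> X $$ (i, j) \<in> series_over R I"
      "\<And>i j. i < n \<Longrightarrow> j < n \<Longrightarrow> X' $$ (i, j) \<in> series_over R I" for X X'
    using that by (rule H.hom_mult_mat)
  have prod: "(X * X') $$ (i, j) \<in> series_over R I"
    if "X \<in> carrier_mat n n" "X' \<in> carrier_mat n n"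
      "\<And>i j. i < n \<Longrightarrow> j < n \<Longrightarrow> X $$ (i, j) \<in> series_over R I"
      "\<And>i j. i < n \<Longrightarrow> j < n \<Longrightarrow> X' $$ (i, j) \<in> series_over R I" "i < n" "j < n" for X X' i j
    using that by (intro K.mult_mat)
  have epc: "entry_pow p g \<in> carrier_mat n n" using g(1) by simp
  have YH: "map_mat H (formY p g) = transpose_mat (entry_pow p (map_mat H g)) * (Q * entry_pow p (map_mat H g))"
  proof -
    have "map_mat H (formY p g) = map_mat H (transpose_mat (entry_pow p g)) * map_mat H (Q * entry_pow p g)"
      unfolding formY_def by (rule mm) (use g(1) Q gp prod[OF Q(1) epc Qin gp] in auto)
    also have "map_mat H (Q * entry_pow p g) = Q * entry_pow p (map_mat H g)"
      using mm[OF Q(1) epc Qin gp] epg HQ by simp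
    finally show ?thesis by (simp only: map_mat_transpose' epg)
  qed
  have ZH: "map_mat H (formZ p g) = entry_pow p (transpose_mat (map_mat H g) * (Q * map_mat H g))"
  proof -
    have c: "transpose_mat g * (Q * g) \<in> carrier_mat n n" using g(1) Q by auto
    have Qg: "(Q * g) $$ (i, j) \<in> series_over R I" if "i < n" "j < n" for i j
      by (rule prod[OF Q(1) g(1) Qin g(3) that])
    have gt: "transpose_mat g $$ (i, j) \<in> series_over R I" if "i < n" "j < n" for i j
      using g that by simp
    have tg: "transpose_mat g \<in> carrier_mat n n" "Q * g \<in> carrier_mat n n" using g(1) Q by auto
    have "map_mat H (formZ p g) = entry_pow p (map_mat H (transpose_mat g * (Q * g)))"
      unfolding formZ_def by (rule ep[OF c prod[OF tg gt Qg]])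
    also have "map_mat H (transpose_mat g * (Q * g)) = map_mat H (transpose_mat g) * map_mat H (Q * g)"
      by (rule mm[OF tg gt Qg])
    also have "map_mat H (Q * g) = Q * map_mat H g" using mm[OF Q(1) g(1) Qin g(3)] HQ by simp
    finally show ?thesis by (simp only: map_mat_transpose')
  qed
  have SS: "map_mat H (formS p g * formS p g) = map_mat H (formS p g) * map_mat H (formS p g)"
    by (rule mm[OF fc(6) fc(6)]) (use fin in auto)
  have "map_mat H (formY p g) * (map_mat H (formS p g) * map_mat H (formS p g)) = map_mat H (formZ p g)"
    unfolding SS[symmetric] formS_square[OF p g(1,2), symmetric]
    by (rule mm[symmetric, OF fc(1) mult_carrier_mat[OF fc(6) fc(6)]]) (use fin prod[OF fc(6) fc(6)] in auto)
  moreover have "mat_vanishes 1 (map_mat H (formS p g) - 1\<^sub>m n)"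
  proof -
    have "const_term (formS p g) = 1\<^sub>m n"
      using formS_vanishes[OF p g(1,2)] mat_vanishes_1_iff[OF fc(6)] by simp
    then have "const_term (map_mat H (formS p g)) = 1\<^sub>m n"
      by (rule local_hom_const_term[OF R(1) H fc(6)]) (use fin in auto)
    then show ?thesis using mat_vanishes_1_iff[of "map_mat H (formS p g)" n] fc(6) by simp
  qed
  moreover have "map_mat H F = entry_pow p (map_mat H g) * map_mat H (formS p g)"
    unfolding F_eq epg[symmetric] by (rule mm[OF epc fc(6) gp]) (use fin in auto)
  ultimately show ?thesis
    unfolding chern_image_def using fc(6) g(1) YH ZH
    by (intro bexI[of _ "map_mat H (formS p g)"]) auto
qed

section \<open>Chern images of Heisenberg matrices\<close>

text \<open>If g preserves q, the right side of the equation for the root is the entrywise power of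
  q, that is q itself. The root then only corrects the failure of the entrywise power of g to
  preserve q.\<close>

lemma chern_image_orthogonal:
  fixes g :: "('i, complex) mps mat"
  assumes g: "g \<in> carrier_mat n n" and q: "q \<in> carrier_mat n n" and p: "p > 0"
    and S: "S \<in> carrier_mat n n" "const_term S = 1\<^sub>m n"
    and "transpose_mat g * (const_mat q * g) = const_mat q" "entry_pow p q = q"
    and "(transpose_mat (entry_pow p g) * (const_mat q * entry_pow p g)) * (S * S) = const_mat q"
  shows "chern_image q p g (entry_pow p g * S)"
proof -
  have "entry_pow p (const_mat q) = (const_mat q :: ('i, complex) mps mat)"
  proof (rule eq_matI)
    fix i j assume "i < dim_row (const_mat q :: ('i, complex) mps mat)" "j < dim_col (const_mat q :: ('i, complex) mps mat)"
    then show "entry_pow p (const_mat q) $$ (i, j) = const_mat q $$ (i, j)"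
      using arg_cong[OF assms(7), of "\<lambda>X. X $$ (i, j)"] by (simp flip: mps_const.hom_power)
  qed auto
  then show ?thesis
    unfolding chern_image_def using assms mat_vanishes_1_iff[OF S(1)]
    by (intro bexI[of _ S]) auto
qed

text \<open>The Heisenberg group of unitriangular matrices of size three, placed in the upper left
  corner of an identity matrix. The product of \<open>a\<close> and \<open>b'\<close> in the corner
  of its group law is the source of the nonzero curvature.\<close>

definition heis :: "nat \<Rightarrow> 'a \<Rightarrow> 'a \<Rightarrow> 'a \<Rightarrow> 'a::comm_ring_1 mat" where
  "heis r a b c = mat r r (\<lambda>(i, j). if i = j then 1 else if i = 0 \<and> j = 1 then a
     else if i = 1 \<and> j = 2 then b else if i = 0 \<and> j = 2 then c else 0)"

lemma heis_carrier [simp]: "heis r a b c \<in> carrier_mat r r"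
  by (simp add: heis_def)

lemma heis_mult:
  assumes "r \<ge> 3"
  shows "heis r a b c * heis r a' b' c' = heis r (a + a') (b + b') (c + c' + a * b')"
proof (rule eq_matI)
  fix i j assume "i < dim_row (heis r (a + a') (b + b') (c + c' + a * b'))"
    "j < dim_col (heis r (a + a') (b + b') (c + c' + a * b'))"
  then have ij: "i < r" "j < r" by (auto simp: heis_def)
  let ?Y = "\<lambda>k. heis r a' b' c' $$ (k, j)"
  have "(heis r a b c * heis r a' b' c') $$ (i, j) = (\<Sum>k<r. heis r a b c $$ (i, k) * ?Y k)"
    by (rule mult_mat_index) (use ij in auto)
  \<comment> \<open>Besides the diagonal entry, a row has nonzero entries at most in columns 1 and
    2.\<close>
  also have "\<dots> = (\<Sum>k<r. (if k = i then ?Y k else 0) + (if k = 1 then if i = 0 then a * ?Y k else 0 else 0)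
      + (if k = 2 then if i = 1 then b * ?Y k else if i = 0 then c * ?Y k else 0 else 0))"
    by (rule sum.cong) (use ij in \<open>auto simp: heis_def\<close>)
  also have "\<dots> = ?Y i + (if i = 0 then a * ?Y 1 else 0) + (if i = 1 then b * ?Y 2 else if i = 0 then c * ?Y 2 else 0)"
    using ij assms by (simp add: sum.distrib sum.delta)
  also have "\<dots> = heis r (a + a') (b + b') (c + c' + a * b') $$ (i, j)"
    using ij assms by (auto simp: heis_def)
  finally show "(heis r a b c * heis r a' b' c') $$ (i, j) = heis r (a + a') (b + b') (c + c' + a * b') $$ (i, j)" .
qed (auto simp: heis_def)

lemma heis_0: "heis r 0 0 0 = 1\<^sub>m r"
  by (rule eq_matI) (auto simp: heis_def)

lemma entry_pow_heis: "p > 0 \<Longrightarrow> entry_pow p (heis r a b c) = heis r (a ^ p) (b ^ p) (c ^ p)"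
  by (rule eq_matI) (auto simp: heis_def power_0_left)

lemma const_term_heis:
  "const_term (heis r a b c) = heis r (mps_nth a {#}) (mps_nth b {#}) (mps_nth c {#})"
  by (rule eq_matI) (auto simp: heis_def mps_nth_1)

lemma block_transpose_diag:
  assumes "G \<in> carrier_mat r r" "H \<in> carrier_mat s s"
  shows "transpose_mat (four_block_mat G (0\<^sub>m r s) (0\<^sub>m s r) H) = four_block_mat (transpose_mat G) (0\<^sub>m r s) (0\<^sub>m s r) (transpose_mat H)"
  using transpose_four_block_mat[OF assms(1) zero_carrier_mat zero_carrier_mat assms(2)] by simp

lemma block_mult_diag:
  fixes G :: "'a::comm_ring_1 mat"
  assumes "G \<in> carrier_mat r r" "H \<in> carrier_mat s s" "G' \<in> carrier_mat r r" "H' \<in> carrier_mat s s"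
  shows "four_block_mat G (0\<^sub>m r s) (0\<^sub>m s r) H * four_block_mat G' (0\<^sub>m r s) (0\<^sub>m s r) H'
    = four_block_mat (G * G') (0\<^sub>m r s) (0\<^sub>m s r) (H * H')"
  by (subst mult_four_block_mat[OF assms(1) zero_carrier_mat zero_carrier_mat assms(2)
      assms(3) zero_carrier_mat zero_carrier_mat assms(4)])
     (use assms in \<open>simp\<close>)

lemma block_mult_diag_anti:
  fixes G :: "'a::comm_ring_1 mat"
  assumes "G \<in> carrier_mat r r" "H \<in> carrier_mat r r" "X \<in> carrier_mat r r" "Y \<in> carrier_mat r r"
  shows "four_block_mat G (0\<^sub>m r r) (0\<^sub>m r r) H * four_block_mat (0\<^sub>m r r) X Y (0\<^sub>m r r)
    = four_block_mat (0\<^sub>m r r) (G * X) (H * Y) (0\<^sub>m r r)"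
  by (subst mult_four_block_mat[OF assms(1) zero_carrier_mat zero_carrier_mat assms(2)
      zero_carrier_mat assms(3,4) zero_carrier_mat])
     (use assms in \<open>simp\<close>)

lemma block_mult_anti_diag:
  fixes G :: "'a::comm_ring_1 mat"
  assumes "G \<in> carrier_mat r r" "H \<in> carrier_mat r r" "X \<in> carrier_mat r r" "Y \<in> carrier_mat r r"
  shows "four_block_mat (0\<^sub>m r r) X Y (0\<^sub>m r r) * four_block_mat G (0\<^sub>m r r) (0\<^sub>m r r) H
    = four_block_mat (0\<^sub>m r r) (X * H) (Y * G) (0\<^sub>m r r)"
  by (subst mult_four_block_mat[OF zero_carrier_mat assms(3,4) zero_carrier_mat
      assms(1) zero_carrier_mat zero_carrier_mat assms(2)])
     (use assms in \<open>simp\<close>)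

text \<open>The sign \<epsilon> treats both even split forms at once: 1 gives the symmetric one and
  -1 the symplectic one.\<close>

definition hyperbolic :: "complex \<Rightarrow> nat \<Rightarrow> complex mat" where
  "hyperbolic \<epsilon> r = four_block_mat (0\<^sub>m r r) (1\<^sub>m r) (\<epsilon> \<cdot>\<^sub>m 1\<^sub>m r) (0\<^sub>m r r)"

lemma hyperbolic_carrier: "hyperbolic \<epsilon> r \<in> carrier_mat (2 * r) (2 * r)"
  by (simp add: hyperbolic_def mult_2 four_block_carrier_mat)

lemma const_mat_hyperbolic:
  "const_mat (hyperbolic \<epsilon> r) = four_block_mat (0\<^sub>m r r) (1\<^sub>m r) (mps_const \<epsilon> \<cdot>\<^sub>m 1\<^sub>m r) (0\<^sub>m r r)"
  unfolding hyperbolic_def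
  by (rule eq_matI) auto

lemma entry_pow_hyperbolic: "p > 0 \<Longrightarrow> \<epsilon> ^ p = \<epsilon> \<Longrightarrow> entry_pow p (hyperbolic \<epsilon> r) = hyperbolic \<epsilon> r"
  by (rule eq_matI) (auto simp: hyperbolic_def power_0_left power_mult_distrib)

text \<open>The matrix \<open>diag(G, G\<^sup>-\<^sup>t)\<close> for \<open>G = heis r a b c\<close>; it preserves the hyperbolic forms.\<close>

definition heis_levi :: "nat \<Rightarrow> 'a \<Rightarrow> 'a \<Rightarrow> 'a \<Rightarrow> 'a::comm_ring_1 mat" where
  "heis_levi r a b c = four_block_mat (heis r a b c) (0\<^sub>m r r) (0\<^sub>m r r) (transpose_mat (heis r (- a) (- b) (a * b - c)))"

lemma heis_levi_carrier: "heis_levi r a b c \<in> carrier_mat (2 * r) (2 * r)"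
  by (simp add: heis_levi_def mult_2 four_block_carrier_mat)

text \<open>On block diagonal matrices the form sees only H G. This gives both the orthogonality of
  \<open>heis_levi\<close>, where H G = 1, and the defect of its entrywise power.\<close>

lemma levi_form:
  assumes "G \<in> carrier_mat r r" "H \<in> carrier_mat r r"
  defines "g \<equiv> four_block_mat G (0\<^sub>m r r) (0\<^sub>m r r) (transpose_mat H)"
  shows "transpose_mat g * (const_mat (hyperbolic \<epsilon> r) * g)
    = four_block_mat (0\<^sub>m r r) (transpose_mat (H * G)) (mps_const \<epsilon> \<cdot>\<^sub>m (H * G)) (0\<^sub>m r r)"
proof -
  have c: "transpose_mat G \<in> carrier_mat r r" "transpose_mat H \<in> carrier_mat r r" "mps_const \<epsilon> \<cdot>\<^sub>m 1\<^sub>m r \<in> carrier_mat r r"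
    using assms by auto
  have "const_mat (hyperbolic \<epsilon> r) * g = four_block_mat (0\<^sub>m r r) (transpose_mat H) (mps_const \<epsilon> \<cdot>\<^sub>m G) (0\<^sub>m r r)"
    unfolding const_mat_hyperbolic g_def block_mult_anti_diag[OF assms(1) c(2) one_carrier_mat c(3)]
    using assms c by (simp add: mult_smult_assoc_mat[of _ r r])
  moreover have "transpose_mat g = four_block_mat (transpose_mat G) (0\<^sub>m r r) (0\<^sub>m r r) H"
    unfolding g_def using block_transpose_diag[OF assms(1) c(2)] by simp
  ultimately show ?thesis
    using block_mult_diag_anti[OF c(1) assms(2) c(2), of "mps_const \<epsilon> \<cdot>\<^sub>m G"] assms
    by (simp add: transpose_mult[of H r r G r] mult_smult_distrib[of H r r G r])
qed

text \<open>With \<open>u\<close> for the product ab, this is the mean of two corners: c^p from the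
  upper block, and u^p + (c - u)^p from inverting the entrywise power of the inverse in the lower
  block.\<close>

definition heis_c :: "nat \<Rightarrow> ('i, complex) mps \<Rightarrow> ('i, complex) mps \<Rightarrow> ('i, complex) mps" where
  "heis_c p u c = mps_const (1 / 2) * (c ^ p + u ^ p + (c - u) ^ p)"

lemma half_double: "mps_const (1 / 2) * f + mps_const (1 / 2) * f = (f :: ('i, complex) mps)"
  by (rule mps_eqI) (simp only: mps_nth_add mps_nth_const_mult, simp)

text \<open>The entrywise power of g fails to preserve the form by a central Heisenberg element with
  corner \<open>k\<close>. Central elements multiply by adding corners, so the square root is again
  central, with half the negative of this corner.\<close>

lemma chern_image_heis_levi:
  fixes a b c :: "('i, complex) mps"
  assumes r: "r \<ge> 3" and p: "odd p" and \<epsilon>: "\<epsilon> ^ p = \<epsilon>"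
    and 0: "mps_nth a {#} = 0" "mps_nth b {#} = 0" "mps_nth c {#} = 0"
  shows "chern_image (hyperbolic \<epsilon> r) p (heis_levi r a b c) (heis_levi r (a ^ p) (b ^ p) (heis_c p (a * b) c))"
proof -
  have p0: "p > 0" using p by (rule odd_pos)
  \<comment> \<open>The corner of the product of the entrywise powers of G^(-1) and G; the other two
    parameters cancel because p is odd.\<close>
  define k where "k = (a * b - c) ^ p + c ^ p - a ^ p * b ^ p"
  define l where "l = - (mps_const (1 / 2) * k)"
  have kl: "k + (l + l) = 0" unfolding l_def using half_double[of k] by simp
  let ?G = "heis r a b c" and ?H = "heis r (- a) (- b) (a * b - c)"
  let ?Gp = "heis r (a ^ p) (b ^ p) (c ^ p)" and ?Hp = "heis r (- (a ^ p)) (- (b ^ p)) ((a * b - c) ^ p)"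
  let ?s = "heis r 0 0 l"
  let ?S = "four_block_mat ?s (0\<^sub>m r r) (0\<^sub>m r r) (transpose_mat ?s)"
  have HG: "?H * ?G = 1\<^sub>m r" by (simp add: heis_mult[OF r] heis_0)
  have HGp: "?Hp * ?Gp = heis r 0 0 k" by (simp add: heis_mult[OF r] k_def)
  have gp: "entry_pow p (heis_levi r a b c) = four_block_mat ?Gp (0\<^sub>m r r) (0\<^sub>m r r) (transpose_mat ?Hp)"
  proof -
    have "entry_pow p ?H = ?Hp" using p0 p by (simp add: entry_pow_heis power_minus_odd)
    then have "entry_pow p (transpose_mat ?H) = transpose_mat ?Hp" by (simp add: map_mat_transpose')
    moreover have "entry_pow p (0\<^sub>m r r :: ('i, complex) mps mat) = 0\<^sub>m r r"
      by (rule eq_matI) (use p0 in \<open>auto simp: power_0_left\<close>)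
    ultimately show ?thesis
      unfolding heis_levi_def
      by (subst map_four_block_mat[of _ r r _ r _ r]) (auto simp: entry_pow_heis[OF p0])
  qed
  have form: "transpose_mat (heis_levi r a b c) * (const_mat (hyperbolic \<epsilon> r) * heis_levi r a b c) = const_mat (hyperbolic \<epsilon> r)"
    unfolding heis_levi_def levi_form[OF heis_carrier heis_carrier] HG
    by (simp add: const_mat_hyperbolic)
  have formp: "transpose_mat (entry_pow p (heis_levi r a b c)) * (const_mat (hyperbolic \<epsilon> r) * entry_pow p (heis_levi r a b c))
      = four_block_mat (0\<^sub>m r r) (transpose_mat (heis r 0 0 k)) (mps_const \<epsilon> \<cdot>\<^sub>m heis r 0 0 k) (0\<^sub>m r r)"
    unfolding gp levi_form[OF heis_carrier heis_carrier] HGp ..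
  have SS: "?S * ?S = four_block_mat (heis r 0 0 (l + l)) (0\<^sub>m r r) (0\<^sub>m r r) (transpose_mat (heis r 0 0 (l + l)))"
  proof -
    have "transpose_mat ?s * transpose_mat ?s = transpose_mat (heis r 0 0 (l + l))"
      unfolding transpose_mult[OF heis_carrier heis_carrier, symmetric] by (simp add: heis_mult[OF r])
    then show ?thesis
      by (subst block_mult_diag) (auto simp: heis_mult[OF r])
  qed
  have YSS: "(transpose_mat (entry_pow p (heis_levi r a b c)) * (const_mat (hyperbolic \<epsilon> r) * entry_pow p (heis_levi r a b c))) * (?S * ?S)
      = const_mat (hyperbolic \<epsilon> r)"
  proof -
    have "transpose_mat (heis r 0 0 k) * transpose_mat (heis r 0 0 (l + l)) = 1\<^sub>m r"
      unfolding transpose_mult[OF heis_carrier heis_carrier, symmetric]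
      using kl by (simp add: heis_mult[OF r] heis_0 add.commute)
    moreover have "(mps_const \<epsilon> \<cdot>\<^sub>m heis r 0 0 k) * heis r 0 0 (l + l) = mps_const \<epsilon> \<cdot>\<^sub>m 1\<^sub>m r"
      using kl by (simp add: mult_smult_assoc_mat[of _ r r _ r] heis_mult[OF r] heis_0)
    ultimately show ?thesis
      unfolding formp SS unfolding const_mat_hyperbolic by (subst block_mult_anti_diag) auto
  qed
  have S1: "const_term ?S = 1\<^sub>m (2 * r)"
  proof -
    have "mps_nth l {#} = 0"
      using 0 p0 const_coeff.hom_power[of a p] const_coeff.hom_power[of b p] const_coeff.hom_power[of c p]
        const_coeff.hom_power[of "a * b - c" p]
      by (simp add: l_def k_def power_0_left)
    then have ct: "const_term ?s = 1\<^sub>m r" by (simp add: const_term_heis heis_0)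
    have "const_term (transpose_mat ?s) = 1\<^sub>m r" by (simp add: map_mat_transpose' ct)
    moreover have "const_term (0\<^sub>m r r :: ('i, complex) mps mat) = 0\<^sub>m r r"
      by (rule eq_matI) auto
    ultimately have "const_term ?S = four_block_mat (1\<^sub>m r) (0\<^sub>m r r) (0\<^sub>m r r) (1\<^sub>m r)"
      by (subst map_four_block_mat[of _ r r _ r _ r]) (auto simp: ct)
    also have "\<dots> = 1\<^sub>m (2 * r)" by (rule eq_matI) auto
    finally show ?thesis .
  qed
  have "entry_pow p (heis_levi r a b c) * ?S = heis_levi r (a ^ p) (b ^ p) (heis_c p (a * b) c)"
  proof -
    have c': "c ^ p + l = heis_c p (a * b) c"
    proof -
      have "(c - a * b) ^ p = - ((a * b - c) ^ p)" using p power_minus_odd[of p "a * b - c"] by simp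
      then have "heis_c p (a * b) c = mps_const (1 / 2) * (c ^ p + c ^ p - k)"
        unfolding heis_c_def k_def by (simp add: power_mult_distrib algebra_simps)
      also have "\<dots> = c ^ p + l"
        using half_double[of "c ^ p"] unfolding l_def by (simp add: algebra_simps)
      finally show ?thesis ..
    qed
    have eq: "(a * b - c) ^ p + l = a ^ p * b ^ p - (c ^ p + l)"
      using kl unfolding k_def by (simp add: algebra_simps add_eq_0_iff2)
    have hs: "?s * ?Hp = heis r (- (a ^ p)) (- (b ^ p)) ((a * b - c) ^ p + l)"
      by (simp add: heis_mult[OF r] add.commute)
    have "transpose_mat ?Hp * transpose_mat ?s = transpose_mat (heis r (- (a ^ p)) (- (b ^ p)) (a ^ p * b ^ p - heis_c p (a * b) c))"
      unfolding transpose_mult[OF heis_carrier heis_carrier, symmetric] hs eq c' ..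
    moreover have "?Gp * ?s = heis r (a ^ p) (b ^ p) (heis_c p (a * b) c)"
      unfolding c'[symmetric] by (simp add: heis_mult[OF r])
    ultimately show ?thesis
      unfolding gp unfolding heis_levi_def by (subst block_mult_diag) auto
  qed
  moreover have "chern_image (hyperbolic \<epsilon> r) p (heis_levi r a b c) (entry_pow p (heis_levi r a b c) * ?S)"
  proof (rule chern_image_orthogonal[OF heis_levi_carrier hyperbolic_carrier p0 _ S1 form entry_pow_hyperbolic[OF p0 \<epsilon>] YSS])
    show "?S \<in> carrier_mat (2 * r) (2 * r)" by (simp add: mult_2 four_block_carrier_mat)
  qed
  ultimately show ?thesis by simp
qed

text \<open>Passage to the odd split form: the extra coordinate stays the identity, and the root is
  extended by a diagonal 1.\<close>

lemma chern_image_block: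
  assumes g: "g \<in> carrier_mat m m" and q: "q \<in> carrier_mat m m" and p: "p > 0" and F: "chern_image q p g F"
  defines "D \<equiv> \<lambda>X :: ('i, complex) mps mat. four_block_mat (1\<^sub>m 1) (0\<^sub>m 1 m) (0\<^sub>m m 1) X"
  shows "chern_image (four_block_mat (1\<^sub>m 1) (0\<^sub>m 1 m) (0\<^sub>m m 1) q) p (D g) (D F)"
proof -
  obtain S where S: "S \<in> carrier_mat m m" "mat_vanishes 1 (S - 1\<^sub>m m)" "F = entry_pow p g * S"
    "(transpose_mat (entry_pow p g) * (const_mat q * entry_pow p g)) * (S * S) = entry_pow p (transpose_mat g * (const_mat q * g))"
    using F g unfolding chern_image_def by auto
  have DD: "D X * D Y = D (X * Y)" if "X \<in> carrier_mat m m" "Y \<in> carrier_mat m m" for X Y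
    unfolding D_def using block_mult_diag[of "1\<^sub>m 1" 1 X m "1\<^sub>m 1" Y] that by simp
  have DT: "transpose_mat (D X) = D (transpose_mat X)" if "X \<in> carrier_mat m m" for X
    unfolding D_def using block_transpose_diag[of "1\<^sub>m 1" 1 X m] that by simp
  have DP: "entry_pow p (D X) = D (entry_pow p X)" if "X \<in> carrier_mat m m" for X
    unfolding D_def using that p by (intro eq_matI) (auto simp: power_0_left)
  have DQ: "const_mat (four_block_mat (1\<^sub>m 1) (0\<^sub>m 1 m) (0\<^sub>m m 1) q) = D (const_mat q)"
    unfolding D_def using q by (intro eq_matI) auto
  have dim: "dim_row (D g) = Suc m" using g by (simp add: D_def)
  have c: "entry_pow p g \<in> carrier_mat m m" "const_mat q \<in> carrier_mat m m" using g q by auto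
  note mc = mult_carrier_mat[of _ m m _ m]
  show ?thesis
    unfolding chern_image_def dim
  proof (intro bexI conjI)
    show "D S \<in> carrier_mat (Suc m) (Suc m)" using S(1) by (intro carrier_matI) (simp_all add: D_def)
    have "D S - 1\<^sub>m (Suc m) = four_block_mat (0\<^sub>m 1 1) (0\<^sub>m 1 m) (0\<^sub>m m 1) (S - 1\<^sub>m m)"
      unfolding D_def using S(1) by (intro eq_matI) auto
    then show "mat_vanishes 1 (D S - 1\<^sub>m (Suc m))"
      using S(1,2) by (auto simp: mat_vanishes_def)
    show "D F = entry_pow p (D g) * D S"
      unfolding S(3) DP[OF g] DD[OF c(1) S(1)] ..
    show "transpose_mat (entry_pow p (D g)) * (const_mat (four_block_mat (1\<^sub>m 1) (0\<^sub>m 1 m) (0\<^sub>m m 1) q) * entry_pow p (D g)) * (D S * D S)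
      = entry_pow p (transpose_mat (D g) * (const_mat (four_block_mat (1\<^sub>m 1) (0\<^sub>m 1 m) (0\<^sub>m m 1) q) * D g))"
      unfolding DQ DP[OF g] DT[OF c(1)] DT[OF g] DD[OF c(2,1)] DD[OF c(2) g] DD[OF S(1) S(1)]
      using c g S(1,4) by (simp add: DD DP mc)
  qed
qed

section \<open>Expansions modulo the third power of a variable\<close>

definition expands :: "('i, complex) mps \<Rightarrow> complex \<Rightarrow> complex \<Rightarrow> ('i, complex) mps \<Rightarrow> bool" where
  "expands t \<alpha> \<beta> f \<longleftrightarrow> (\<exists>h. f = 1 + mps_const \<alpha> * t + mps_const \<beta> * t ^ 2 + t ^ 3 * h)"

lemma expandsI: "f = 1 + mps_const \<alpha> * t + mps_const \<beta> * t ^ 2 + t ^ 3 * h \<Longrightarrow> expands t \<alpha> \<beta> f"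
  unfolding expands_def by blast

lemma expands_mult:
  assumes "expands t \<alpha> \<beta> f" "expands t \<alpha>' \<beta>' g"
  shows "expands t (\<alpha> + \<alpha>') (\<beta> + \<beta>' + \<alpha> * \<alpha>') (f * g)"
proof -
  obtain h k where f: "f = 1 + mps_const \<alpha> * t + mps_const \<beta> * t ^ 2 + t ^ 3 * h"
    and g: "g = 1 + mps_const \<alpha>' * t + mps_const \<beta>' * t ^ 2 + t ^ 3 * k"
    using assms unfolding expands_def by blast
  let ?a = "mps_const \<alpha> :: ('a, complex) mps" and ?b = "mps_const \<beta> :: ('a, complex) mps"
  let ?a' = "mps_const \<alpha>' :: ('a, complex) mps" and ?b' = "mps_const \<beta>' :: ('a, complex) mps"
  show ?thesis
    by (rule expandsI[where h = "h * g + (1 + ?a * t + ?b * t ^ 2) * k + ?a * ?b' + ?b * ?a' + ?b * ?b' * t"])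
       (unfold f g, simp add: mps_const.hom_add mps_const.hom_mult algebra_simps power2_eq_square power3_eq_cube)
qed

lemma expands_power:
  assumes "expands t \<alpha> \<beta> f"
  shows "expands t (of_nat p * \<alpha>) (of_nat p * \<beta> + of_nat p * (of_nat p - 1) / 2 * \<alpha> ^ 2) (f ^ p)"
proof (induction p)
  case 0
  show ?case by (rule expandsI[of _ _ _ _ 0]) simp
next
  case (Suc p)
  have "\<alpha> + of_nat p * \<alpha> = of_nat (Suc p) * \<alpha>" by (simp add: algebra_simps)
  moreover have "\<beta> + (of_nat p * \<beta> + of_nat p * (of_nat p - 1) / 2 * \<alpha> ^ 2) + \<alpha> * (of_nat p * \<alpha>)
      = of_nat (Suc p) * \<beta> + of_nat (Suc p) * (of_nat (Suc p) - 1) / 2 * \<alpha> ^ 2"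
    by (simp add: field_simps power2_eq_square)
  ultimately show ?case using expands_mult[OF assms Suc] by simp
qed

text \<open>Since \<open>u\<close> is of higher order than t^m, \<open>c\<close> and
  \<open>c - u\<close> share that leading power. For p at least 3 the summand u^p contributes only
  from third order on after t^(mp) is factored out, so the answer is the mean of two powers.\<close>

lemma heis_c_expands:
  assumes "expands t \<alpha> \<beta> e" "expands t \<alpha>' \<beta>' e'" "p \<ge> 3"
    and c: "c = t ^ m * e" and u: "u = t ^ m * (t * w)" and cu: "c - u = t ^ m * e'"
  shows "\<exists>f. heis_c p u c = t ^ (m * p) * f \<and>
    expands t (of_nat p * (\<alpha> + \<alpha>') / 2)
      ((of_nat p * (\<beta> + \<beta>') + of_nat p * (of_nat p - 1) / 2 * (\<alpha> ^ 2 + \<alpha>' ^ 2)) / 2) f"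
proof -
  obtain h k where h: "e ^ p = 1 + mps_const (of_nat p * \<alpha>) * t + mps_const (of_nat p * \<beta> + of_nat p * (of_nat p - 1) / 2 * \<alpha> ^ 2) * t ^ 2 + t ^ 3 * h"
    and k: "e' ^ p = 1 + mps_const (of_nat p * \<alpha>') * t + mps_const (of_nat p * \<beta>' + of_nat p * (of_nat p - 1) / 2 * \<alpha>' ^ 2) * t ^ 2 + t ^ 3 * k"
    using expands_power[OF assms(1), of p] expands_power[OF assms(2), of p] unfolding expands_def by blast
  have tw: "(t * w) ^ p = t ^ 3 * (t ^ (p - 3) * w ^ p)"
  proof -
    have "t ^ p = t ^ 3 * t ^ (p - 3)" using assms(3) by (simp flip: power_add)
    then show ?thesis unfolding power_mult_distrib by (simp only: mult.assoc)
  qed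
  define f where "f = mps_const (1 / 2) * (e ^ p + (t * w) ^ p + e' ^ p)"
  have "heis_c p u c = t ^ (m * p) * f"
    unfolding heis_c_def f_def cu unfolding c u power_mult_distrib power_mult by (simp add: algebra_simps)
  moreover have "expands t (of_nat p * (\<alpha> + \<alpha>') / 2)
      ((of_nat p * (\<beta> + \<beta>') + of_nat p * (of_nat p - 1) / 2 * (\<alpha> ^ 2 + \<alpha>' ^ 2)) / 2) f"
  proof (rule expandsI[where h = "mps_const (1 / 2) * (h + k + t ^ (p - 3) * w ^ p)"])
    have 1: "mps_const (1 / 2) * (1 + 1) = (1 :: ('a, complex) mps)"
      unfolding distrib_left by (rule half_double)
    have 2: "mps_const (of_nat p * (\<alpha> + \<alpha>') / 2) = mps_const (1 / 2) * (mps_const (of_nat p * \<alpha>) + mps_const (of_nat p * \<alpha>') :: ('a, complex) mps)"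
      unfolding mps_const.hom_add[symmetric] mps_const.hom_mult[symmetric] by (simp add: field_simps)
    have 3: "mps_const ((of_nat p * (\<beta> + \<beta>') + of_nat p * (of_nat p - 1) / 2 * (\<alpha> ^ 2 + \<alpha>' ^ 2)) / 2)
        = mps_const (1 / 2) * (mps_const (of_nat p * \<beta> + of_nat p * (of_nat p - 1) / 2 * \<alpha> ^ 2)
          + mps_const (of_nat p * \<beta>' + of_nat p * (of_nat p - 1) / 2 * \<alpha>' ^ 2) :: ('a, complex) mps)"
      unfolding mps_const.hom_add[symmetric] mps_const.hom_mult[symmetric] by (intro arg_cong[of _ _ mps_const]) (simp add: algebra_simps add_divide_distrib diff_divide_distrib)
    show "f = 1 + mps_const (of_nat p * (\<alpha> + \<alpha>') / 2) * t
        + mps_const ((of_nat p * (\<beta> + \<beta>') + of_nat p * (of_nat p - 1) / 2 * (\<alpha> ^ 2 + \<alpha>' ^ 2)) / 2) * t ^ 2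
        + t ^ 3 * (mps_const (1 / 2) * (h + k + t ^ (p - 3) * w ^ p))"
      unfolding f_def h k tw 2 3 by (subst 1[symmetric]) (simp only: algebra_simps)
  qed
  ultimately show ?thesis by blast
qed

lemma var_power_nth: "mps_nth (mps_var i ^ k) m = (if m = replicate_mset k i then 1 else 0 :: 'a::comm_ring_1)"
  using mps_nth_prod_var[of "replicate_mset k i" m, where 'a = 'a] by (simp add: image_replicate_mset)

lemma expands_coeff:
  assumes "expands (mps_var i) 0 \<beta> f"
  shows "mps_nth (mps_var i ^ N * f) (replicate_mset (N + 2) i) = \<beta>"
proof -
  let ?t = "mps_var i :: ('a, complex) mps"
  obtain h where h: "f = 1 + mps_const 0 * ?t + mps_const \<beta> * ?t ^ 2 + ?t ^ 3 * h"
    using assms unfolding expands_def by blast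
  have "?t ^ N * f = ?t ^ N + mps_const \<beta> * ?t ^ (N + 2) + ?t ^ (N + 3) * h"
    unfolding h power_add by (simp add: algebra_simps)
  moreover have "vanishes (N + 3) (?t ^ (N + 3) * h)"
    using vanishes_power[OF vanishes_var, of "N + 3" i] by (intro vanishes_mult_left) simp
  then have "mps_nth (?t ^ (N + 3) * h) (replicate_mset (N + 2) i) = 0"
    by (rule vanishesD) simp
  moreover have "replicate_mset (N + 2) i \<noteq> replicate_mset N i"
    by (metis size_replicate_mset add_eq_self_zero zero_neq_numeral)
  ultimately show ?thesis by (simp add: var_power_nth del: replicate_mset_Suc add_2_eq_Suc')
qed

text \<open>The choice makes c = t (1 + t) and c - u = t (1 - t). The linear terms of their powers
  cancel in the mean, which leaves r (r - 1) / 2 as the second-order coefficient. With no linear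
  term present, the second application with exponent s merely multiplies it by s.\<close>

lemma heis_c_noncommuting:
  fixes i :: 'i and p p' :: nat
  defines "t \<equiv> mps_var i :: ('i, complex) mps"
  defines "c \<equiv> t + t ^ 2" and "u \<equiv> mps_const 2 * t ^ 2"
  assumes "p \<ge> 3" "p' \<ge> 3" "p \<noteq> p'"
  shows "heis_c p' (u ^ p) (heis_c p u c) \<noteq> heis_c p (u ^ p') (heis_c p' u c)"
proof -
  have main: "\<exists>f. heis_c s (u ^ r) (heis_c r u c) = t ^ (r * s) * f \<and>
      expands t 0 (of_nat s * (of_nat r * (of_nat r - 1) / 2)) f" if rs: "r \<ge> 3" "s \<ge> 3" for r s :: nat
  proof -
    let ?\<beta> = "of_nat r * (of_nat r - 1) / 2 :: complex"
    have two: "mps_const 2 * f = f + f" for f :: "('i, complex) mps"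
      by (rule mps_eqI) (simp only: mps_nth_const_mult mps_nth_add mult_2)
    have "expands t 1 0 (1 + t)" by (rule expandsI[where h = 0]) simp
    moreover have "expands t (- 1) 0 (1 - t)" by (rule expandsI[where h = 0]) (simp add: mps_const.hom_uminus)
    moreover have "c = t ^ 1 * (1 + t)" by (simp add: c_def algebra_simps power2_eq_square)
    moreover have "u = t ^ 1 * (t * mps_const 2)" by (simp add: u_def algebra_simps power2_eq_square)
    moreover have "c - u = t ^ 1 * (1 - t)" unfolding c_def u_def two by (simp add: algebra_simps power2_eq_square)
    ultimately obtain f where f: "heis_c r u c = t ^ r * f" "expands t 0 ?\<beta> f"
      using heis_c_expands[of t 1 0 "1 + t" "-1" 0 "1 - t" r c 1 u "mps_const 2"] rs by auto
    obtain h where h: "f = 1 + mps_const 0 * t + mps_const ?\<beta> * t ^ 2 + t ^ 3 * h"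
      using f(2) unfolding expands_def by blast
    \<comment> \<open>From t^(2r) = t^r t^3 t^(r-3): relative to t^r, the new \<open>u ^ r\<close>
      is of third order and does not affect the second-order coefficient.\<close>
    define v where "v = mps_const 2 ^ r * t ^ (r - 3)"
    have ur: "u ^ r = t ^ r * (t ^ 3 * v)"
    proof -
      have "t ^ r = t ^ 3 * t ^ (r - 3)" using rs(1) by (simp flip: power_add)
      then show ?thesis unfolding u_def v_def power_mult_distrib by (simp add: power2_eq_square power_mult_distrib algebra_simps)
    qed
    have e': "expands t 0 ?\<beta> (f - t ^ 3 * v)"
      by (rule expandsI[where h = "h - v"]) (simp add: h algebra_simps)
    have "u ^ r = t ^ r * (t * (t ^ 2 * v))" unfolding ur by (simp add: power3_eq_cube power2_eq_square mult.assoc)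
    moreover have "heis_c r u c - u ^ r = t ^ r * (f - t ^ 3 * v)"
      unfolding f(1) ur by (simp add: algebra_simps)
    ultimately have ex: "\<exists>f'. heis_c s (u ^ r) (heis_c r u c) = t ^ (r * s) * f' \<and>
        expands t (of_nat s * (0 + 0) / 2) ((of_nat s * (?\<beta> + ?\<beta>) + of_nat s * (of_nat s - 1) / 2 * (0 ^ 2 + 0 ^ 2)) / 2) f'"
      by (rule heis_c_expands[OF f(2) e' rs(2) f(1)])
    have "(of_nat s * (b + b) + of_nat s * (of_nat s - 1) / 2 * (0 ^ 2 + 0 ^ 2)) / 2 = of_nat s * b" for b :: complex
      by simp
    moreover have "of_nat s * (0 + 0) / 2 = (0 :: complex)" by simp
    ultimately show ?thesis using ex by (simp only:)
  qed
  obtain f where f: "heis_c p' (u ^ p) (heis_c p u c) = t ^ (p * p') * f"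
    "expands t 0 (of_nat p' * (of_nat p * (of_nat p - 1) / 2)) f" using main[OF assms(4,5)] by blast
  obtain f' where f': "heis_c p (u ^ p') (heis_c p' u c) = t ^ (p' * p) * f'"
    "expands t 0 (of_nat p * (of_nat p' * (of_nat p' - 1) / 2)) f'" using main[OF assms(5,4)] by blast
  show ?thesis
  proof
    assume "heis_c p' (u ^ p) (heis_c p u c) = heis_c p (u ^ p') (heis_c p' u c)"
    then have "t ^ (p * p') * f = t ^ (p * p') * f'" using f(1) f'(1) by (simp add: mult.commute)
    \<comment> \<open>Cancelling p p' / 2 from both coefficients leaves p - 1 = p' - 1.\<close>
    then have "(of_nat p' * (of_nat p * (of_nat p - 1) / 2) :: complex) = of_nat p * (of_nat p' * (of_nat p' - 1) / 2)"
      using expands_coeff[of i _ f "p * p'"] expands_coeff[of i _ f' "p * p'"] f(2) f'(2) unfolding t_def by metis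
    then have "(of_nat p :: complex) = of_nat p'" using assms(4,5) by (auto simp: field_simps)
    then show False using assms(6) by simp
  qed
qed

section \<open>Chern images in rank two\<close>

text \<open>The determinant in rank two, written out for direct computation.\<close>

definition disc :: "'a::comm_ring_1 mat \<Rightarrow> 'a" where
  "disc X = X $$ (0, 0) * X $$ (1, 1) - X $$ (0, 1) * X $$ (1, 0)"

lemma sum_lessThan_2: "(\<Sum>k<2. f k) = f 0 + f (1::nat)"
  by (simp add: numeral_2_eq_2)

lemma eq_mat_2:
  assumes "X \<in> carrier_mat 2 2" "Y \<in> carrier_mat 2 2"
    "X $$ (0, 0) = Y $$ (0, 0)" "X $$ (0, 1) = Y $$ (0, 1)" "X $$ (1, 0) = Y $$ (1, 0)" "X $$ (1, 1) = Y $$ (1, 1)"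
  shows "X = Y"
proof (rule eq_matI)
  fix i j assume "i < dim_row Y" "j < dim_col Y"
  then have "i = 0 \<or> i = 1" "j = 0 \<or> j = 1" using assms(2) by auto
  then show "X $$ (i, j) = Y $$ (i, j)" using assms by auto
qed (use assms in auto)

lemma mult_mat_2:
  assumes "X \<in> carrier_mat 2 2" "Y \<in> carrier_mat 2 2" "i < 2" "j < 2"
  shows "(X * Y) $$ (i, j) = X $$ (i, 0) * Y $$ (0, j) + X $$ (i, 1) * Y $$ (1, j)"
  unfolding mult_mat_index[OF assms] sum_lessThan_2 ..

lemma hyperbolic_1_index:
  "hyperbolic \<epsilon> 1 $$ (0, 0) = 0" "hyperbolic \<epsilon> 1 $$ (0, 1) = 1" "hyperbolic \<epsilon> 1 $$ (1, 0) = \<epsilon>" "hyperbolic \<epsilon> 1 $$ (1, 1) = 0"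
  by (simp_all add: hyperbolic_def)

lemma form_2:
  assumes "X \<in> carrier_mat 2 2"
  shows "transpose_mat X * (const_mat (hyperbolic \<epsilon> 1) * X) = mat 2 2 (\<lambda>(i, j).
    X $$ (0, i) * X $$ (1, j) + mps_const \<epsilon> * X $$ (1, i) * X $$ (0, j))"
proof -
  have c: "const_mat (hyperbolic \<epsilon> 1) \<in> carrier_mat 2 2" "transpose_mat X \<in> carrier_mat 2 2"
    using hyperbolic_carrier[of \<epsilon> 1] assms by auto
  have d: "dim_row X = 2" "dim_col X = 2" "dim_row (hyperbolic \<epsilon> 1) = 2" "dim_col (hyperbolic \<epsilon> 1) = 2"
    using assms hyperbolic_carrier[of \<epsilon> 1] by auto
  show ?thesis
  proof (rule eq_matI)
    fix i j assume "i < dim_row (mat 2 2 (\<lambda>(i, j). X $$ (0, i) * X $$ (1, j) + mps_const \<epsilon> * X $$ (1, i) * X $$ (0, j)))"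
      "j < dim_col (mat 2 2 (\<lambda>(i, j). X $$ (0, i) * X $$ (1, j) + mps_const \<epsilon> * X $$ (1, i) * X $$ (0, j)))"
    then have ij: "i < 2" "j < 2" by auto
    have QX: "(const_mat (hyperbolic \<epsilon> 1) * X) $$ (0, j) = X $$ (1, j)"
      "(const_mat (hyperbolic \<epsilon> 1) * X) $$ (1, j) = mps_const \<epsilon> * X $$ (0, j)"
      using mult_mat_2[OF c(1) assms, of 0 j] mult_mat_2[OF c(1) assms, of 1 j] ij d
      by (simp_all add: hyperbolic_1_index[unfolded One_nat_def])
    show "(transpose_mat X * (const_mat (hyperbolic \<epsilon> 1) * X)) $$ (i, j)
        = mat 2 2 (\<lambda>(i, j). X $$ (0, i) * X $$ (1, j) + mps_const \<epsilon> * X $$ (1, i) * X $$ (0, j)) $$ (i, j)"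
      unfolding mult_mat_2[OF c(2) mult_carrier_mat[OF c(1) assms] ij] QX
      using ij d by (simp add: mult_ac)
  qed (use d in auto)
qed

text \<open>In rank two alternating forms are unique up to a scalar, and the scalar here is the
  determinant.\<close>

lemma form_2_symplectic:
  assumes "X \<in> carrier_mat 2 2"
  shows "transpose_mat X * (const_mat (hyperbolic (- 1) 1) * X) = disc X \<cdot>\<^sub>m const_mat (hyperbolic (- 1) 1)"
  unfolding form_2[OF assms]
  by (rule eq_mat_2) (use hyperbolic_carrier[of "-1" 1] in
      \<open>auto simp: hyperbolic_1_index[unfolded One_nat_def] disc_def mps_const.hom_uminus algebra_simps\<close>)

lemma series_sqrt:
  fixes f :: "('i, complex) mps"
  assumes "mps_nth f {#} = 1"
  obtains h where "mps_nth h {#} = 1" "h * h = f"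
proof -
  define E where "E = mat 1 1 (\<lambda>_. f - 1)"
  have E: "E \<in> carrier_mat 1 1" "mat_vanishes 1 E"
    using assms by (auto simp: E_def mat_vanishes_def vanishes_Suc_0_iff mps_nth_1)
  let ?S = "mat_series (\<lambda>l. (1/2) gchoose l) E"
  have S: "?S \<in> carrier_mat 1 1" using mat_series_carrier[OF E(1)] .
  have "(?S * ?S) $$ (0, 0) = f" unfolding mat_series_sqrt[OF E] using E by (simp add: E_def)
  then have "?S $$ (0, 0) * ?S $$ (0, 0) = f"
    using mult_mat_index[OF S S, of 0 0] by simp
  moreover have "mps_nth (?S $$ (0, 0)) {#} = 1"
    using mat_series_nth[OF E, of 0 0 "{#}" 0] E by simp
  ultimately show ?thesis using that by blast
qed

lemma series_inverse:
  fixes f :: "('i, complex) mps"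
  assumes "mps_nth f {#} = 1"
  obtains d where "d * f = 1"
proof -
  define E where "E = mat 1 1 (\<lambda>_. f - 1)"
  have E: "E \<in> carrier_mat 1 1" "mat_vanishes 1 E"
    using assms by (auto simp: E_def mat_vanishes_def vanishes_Suc_0_iff mps_nth_1)
  let ?V = "mat_series (\<lambda>l. (-1) ^ l) E"
  have "(?V * (1\<^sub>m 1 + E)) $$ (0, 0) = 1"
    unfolding mat_series_inverse[OF E] by simp
  then have "?V $$ (0, 0) * f = 1"
    using mult_mat_index[of ?V 1 1 "1\<^sub>m 1 + E" 1 0 0] mat_series_carrier[OF E(1)] E
    by (simp add: E_def)
  then show ?thesis using that by blast
qed

text \<open>Both sides of the equation for the root are scalar multiples of q, hence the root can be
  sought among scalar matrices.\<close>

lemma chern_image_symplectic_2I: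
  assumes p: "odd p" and g: "g \<in> carrier_mat 2 2"
    and l: "mps_nth l {#} = 1" "l ^ 2 * disc (entry_pow p g) = disc g ^ p"
  shows "chern_image (hyperbolic (- 1) 1) p g (l \<cdot>\<^sub>m entry_pow p g)"
proof -
  let ?Q = "const_mat (hyperbolic (- 1) 1)"
  have Q: "?Q \<in> carrier_mat 2 2" using hyperbolic_carrier[of "-1" 1] by simp
  have gp: "entry_pow p g \<in> carrier_mat 2 2" using g by simp
  let ?S = "l \<cdot>\<^sub>m 1\<^sub>m 2"
  have SS: "?S * ?S = (l * l) \<cdot>\<^sub>m 1\<^sub>m 2"
    by (rule eq_matI) (auto simp: scalar_prod_def numeral_2_eq_2 less_Suc_eq)
  have dQ: "(d \<cdot>\<^sub>m ?Q) * (e \<cdot>\<^sub>m 1\<^sub>m 2) = (e * d) \<cdot>\<^sub>m ?Q" for d e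
    by (rule eq_mat_2) (use Q in \<open>auto simp: mult_smult_distrib[of _ 2 2 _ 2] right_mult_one_mat\<close>)
  have pQ: "entry_pow p (d \<cdot>\<^sub>m ?Q) = d ^ p \<cdot>\<^sub>m ?Q" for d
    by (rule eq_mat_2) (use Q p odd_pos[OF p] in
        \<open>auto simp: hyperbolic_1_index[unfolded One_nat_def] mps_const.hom_uminus power_0_left power_minus_odd\<close>)
  have "mat_vanishes 1 (?S - 1\<^sub>m 2)"
    using l(1) by (auto simp: mat_vanishes_def vanishes_Suc_0_iff mps_nth_1)
  moreover have "l \<cdot>\<^sub>m entry_pow p g = entry_pow p g * ?S"
    using gp by (simp add: mult_smult_distrib[OF gp one_carrier_mat])
  moreover have "(transpose_mat (entry_pow p g) * (?Q * entry_pow p g)) * (?S * ?S) = entry_pow p (transpose_mat g * (?Q * g))"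
    unfolding form_2_symplectic[OF g] form_2_symplectic[OF gp] SS dQ pQ
    using l(2) by (simp add: power2_eq_square)
  ultimately show ?thesis
    unfolding chern_image_def using g by (intro bexI[of _ ?S]) auto
qed

section \<open>Split matrices as hyperbolic blocks\<close>

lemma split_form_hyperbolic:
  assumes "\<epsilon> \<in> {1, - 1}" shows "split_form (2 * r) (hyperbolic \<epsilon> r)"
proof
  have t: "transpose_mat (hyperbolic \<epsilon> r) = four_block_mat (0\<^sub>m r r) (\<epsilon> \<cdot>\<^sub>m 1\<^sub>m r) (1\<^sub>m r) (0\<^sub>m r r)"
    unfolding hyperbolic_def by (rule eq_matI) auto
  have e: "\<epsilon> * \<epsilon> = 1" using assms by auto
  have ee: "(\<epsilon> \<cdot>\<^sub>m 1\<^sub>m r) * (\<epsilon> \<cdot>\<^sub>m 1\<^sub>m r) = 1\<^sub>m r"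
    using e by (subst mult_smult_assoc_mat[of _ r r _ r]) (auto intro!: eq_matI)
  show "hyperbolic \<epsilon> r \<in> carrier_mat (2 * r) (2 * r)" by (rule hyperbolic_carrier)
  show "hyperbolic \<epsilon> r $$ (i, j) \<in> {0, 1, - 1}" if "i < 2 * r" "j < 2 * r" for i j
    using that assms by (auto simp: hyperbolic_def)
  show "hyperbolic \<epsilon> r * transpose_mat (hyperbolic \<epsilon> r) = 1\<^sub>m (2 * r)"
    unfolding t unfolding hyperbolic_def
    by (subst mult_four_block_mat[of _ r r _ r _ r _ _ r _ r]) (auto simp: ee mult_2)
  show "transpose_mat (hyperbolic \<epsilon> r) * hyperbolic \<epsilon> r = 1\<^sub>m (2 * r)"
    unfolding t unfolding hyperbolic_def
    by (subst mult_four_block_mat[of _ r r _ r _ r _ _ r _ r]) (auto simp: ee mult_2)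
qed

lemma split_form_block:
  assumes "split_form m q"
  shows "split_form (Suc m) (four_block_mat (1\<^sub>m 1) (0\<^sub>m 1 m) (0\<^sub>m m 1) q)"
proof
  interpret q: split_form m q by fact
  have t: "transpose_mat (four_block_mat (1\<^sub>m 1) (0\<^sub>m 1 m) (0\<^sub>m m 1) q) = four_block_mat (1\<^sub>m 1) (0\<^sub>m 1 m) (0\<^sub>m m 1) (transpose_mat q)"
    using block_transpose_diag[of "1\<^sub>m 1" 1 q m] q.q by simp
  have one: "four_block_mat (1\<^sub>m 1) (0\<^sub>m 1 m) (0\<^sub>m m 1) (1\<^sub>m m) = (1\<^sub>m (Suc m) :: complex mat)"
    by (rule eq_matI) auto
  show "four_block_mat (1\<^sub>m 1) (0\<^sub>m 1 m) (0\<^sub>m m 1) q \<in> carrier_mat (Suc m) (Suc m)"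
    using q.q by (intro carrier_matI) auto
  show "four_block_mat (1\<^sub>m 1) (0\<^sub>m 1 m) (0\<^sub>m m 1) q $$ (i, j) \<in> {0, 1, - 1}" if "i < Suc m" "j < Suc m" for i j
    using that q.q q.q_entries[of "i - 1" "j - 1"] by auto
  show "four_block_mat (1\<^sub>m 1) (0\<^sub>m 1 m) (0\<^sub>m m 1) q * transpose_mat (four_block_mat (1\<^sub>m 1) (0\<^sub>m 1 m) (0\<^sub>m m 1) q) = 1\<^sub>m (Suc m)"
    unfolding t using q.q q.q_left one by (subst block_mult_diag) auto
  show "transpose_mat (four_block_mat (1\<^sub>m 1) (0\<^sub>m 1 m) (0\<^sub>m m 1) q) * four_block_mat (1\<^sub>m 1) (0\<^sub>m 1 m) (0\<^sub>m m 1) q = 1\<^sub>m (Suc m)"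
    unfolding t using q.q q.q_right one by (subst block_mult_diag) auto
qed

lemma split_matrix_cases:
  assumes "split_matrix n q"
  obtains r \<epsilon> where "\<epsilon> \<in> {1, - 1}" "n = 2 * r" "q = hyperbolic \<epsilon> r"
  | r where "n = Suc (2 * r)" "q = four_block_mat (1\<^sub>m 1) (0\<^sub>m 1 (2 * r)) (0\<^sub>m (2 * r) 1) (hyperbolic 1 r)"
proof -
  have 1: "1 \<cdot>\<^sub>m 1\<^sub>m r = (1\<^sub>m r :: complex mat)" and m1: "- 1 \<cdot>\<^sub>m 1\<^sub>m r = (- 1\<^sub>m r :: complex mat)" for r
    by (auto intro!: eq_matI)
  show ?thesis
    using assms that(1)[of 1] that(1)[of "- 1"] that(2) unfolding split_matrix_def hyperbolic_def
    by (auto simp: 1 m1)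
qed

lemma split_form_split_matrix: "split_matrix n q \<Longrightarrow> split_form n q"
proof (erule split_matrix_cases)
  show "\<epsilon> \<in> {1, - 1} \<Longrightarrow> n = 2 * r \<Longrightarrow> q = hyperbolic \<epsilon> r \<Longrightarrow> split_form n q" for \<epsilon> r
    using split_form_hyperbolic by simp
  show "n = Suc (2 * r) \<Longrightarrow> q = four_block_mat (1\<^sub>m 1) (0\<^sub>m 1 (2 * r)) (0\<^sub>m (2 * r) 1) (hyperbolic 1 r) \<Longrightarrow>
      split_form n q" for r
    using split_form_block[OF split_form_hyperbolic[of 1 r]] by simp
qed

lemma disc_smult: "X \<in> carrier_mat 2 2 \<Longrightarrow> disc (l \<cdot>\<^sub>m X) = l ^ 2 * disc X"
  by (simp add: disc_def algebra_simps power2_eq_square)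

lemma const_term_2:
  assumes "const_term X = 1\<^sub>m 2"
  shows "mps_nth (X $$ (0, 0)) {#} = 1" "mps_nth (X $$ (0, 1)) {#} = 0"
    "mps_nth (X $$ (1, 0)) {#} = 0" "mps_nth (X $$ (1, 1)) {#} = 1"
proof -
  have "dim_row X = 2" "dim_col X = 2"
    using arg_cong[OF assms, of dim_row] arg_cong[OF assms, of dim_col] by auto
  then have "mps_nth (X $$ (i, j)) {#} = 1\<^sub>m 2 $$ (i, j)" if "i < 2" "j < 2" for i j
    using arg_cong[OF assms, of "\<lambda>X. X $$ (i, j)"] that by simp
  from this[of 0 0] this[of 0 1] this[of 1 0] this[of 1 1]
  show "mps_nth (X $$ (0, 0)) {#} = 1" "mps_nth (X $$ (0, 1)) {#} = 0"
    "mps_nth (X $$ (1, 0)) {#} = 0" "mps_nth (X $$ (1, 1)) {#} = 1" by auto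
qed

lemma const_term_disc:
  assumes "const_term X = 1\<^sub>m 2" shows "mps_nth (disc X) {#} = 1"
  using const_term_2[OF assms] by (simp add: disc_def)

lemma const_term_entry_pow_1: "p > 0 \<Longrightarrow> const_term X = 1\<^sub>m n \<Longrightarrow> const_term (entry_pow p X) = 1\<^sub>m n"
  by (simp add: const_term_entry_pow entry_pow_1)

lemma chern_image_symplectic_2E:
  assumes p: "odd p" and g: "g \<in> carrier_mat 2 2" "const_term g = 1\<^sub>m 2"
    and F: "chern_image (hyperbolic (- 1) 1) p g F"
  obtains l where "mps_nth l {#} = 1" "l ^ 2 * disc (entry_pow p g) = disc g ^ p" "F = l \<cdot>\<^sub>m entry_pow p g"
proof -
  interpret split_form 2 "hyperbolic (- 1) 1" using split_form_hyperbolic[of "- 1" 1] by simp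
  have "mps_nth (disc (entry_pow p g)) {#} = 1"
    by (intro const_term_disc const_term_entry_pow_1 odd_pos p g)
  then obtain d where d: "d * disc (entry_pow p g) = 1" by (rule series_inverse)
  have "mps_nth (disc g ^ p * d) {#} = 1"
    using arg_cong[OF d, of "\<lambda>f. mps_nth f {#}"] \<open>mps_nth (disc (entry_pow p g)) {#} = 1\<close> const_term_disc[OF g(2)]
    by (simp add: const_coeff.hom_power mps_nth_1)
  then obtain l where l: "mps_nth l {#} = 1" "l * l = disc g ^ p * d" by (rule series_sqrt)
  have "l ^ 2 * disc (entry_pow p g) = disc g ^ p * (d * disc (entry_pow p g))"
    unfolding power2_eq_square l(2) by (simp only: mult.assoc)
  then have l2: "l ^ 2 * disc (entry_pow p g) = disc g ^ p" by (simp add: d)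
  have "F = l \<cdot>\<^sub>m entry_pow p g"
    by (rule chern_image_unique[OF p g F chern_image_symplectic_2I[OF p g(1) l(1) l2]])
  then show ?thesis using that l(1) l2 by blast
qed

lemma const_term_smult: "mps_nth l {#} = 1 \<Longrightarrow> const_term (l \<cdot>\<^sub>m X) = const_term X"
  by (rule eq_matI) auto

text \<open>Because \<open>disc F\<close> is the p-th power of \<open>disc g\<close>, the scalar
  \<open>k * l ^ p'\<close> satisfies the relation for the exponent pp'. As
  \<open>chern_image\<close> also makes sense for this composite exponent, the outcome is symmetric
  in the two primes.\<close>

lemma chern_image_symplectic_2_comp:
  assumes p: "odd p" "odd p'" and g: "g \<in> carrier_mat 2 2" "const_term g = 1\<^sub>m 2"
    and F: "chern_image (hyperbolic (- 1) 1) p g F" and F': "chern_image (hyperbolic (- 1) 1) p' F F'"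
  shows "chern_image (hyperbolic (- 1) 1) (p * p') g F'"
proof -
  obtain l where l: "mps_nth l {#} = 1" "l ^ 2 * disc (entry_pow p g) = disc g ^ p" "F = l \<cdot>\<^sub>m entry_pow p g"
    by (rule chern_image_symplectic_2E[OF p(1) g F])
  have Fc: "F \<in> carrier_mat 2 2" "const_term F = 1\<^sub>m 2"
    unfolding l(3) const_term_smult[OF l(1)] using g p by (auto intro!: const_term_entry_pow_1 odd_pos)
  obtain k where k: "mps_nth k {#} = 1" "k ^ 2 * disc (entry_pow p' F) = disc F ^ p'" "F' = k \<cdot>\<^sub>m entry_pow p' F"
    by (rule chern_image_symplectic_2E[OF p(2) Fc F'])
  have Fp: "entry_pow p' F = l ^ p' \<cdot>\<^sub>m entry_pow (p * p') g"
    unfolding l(3) using g(1) by (intro eq_matI) (auto simp: power_mult_distrib power_mult)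
  have gc: "entry_pow p g \<in> carrier_mat 2 2" "entry_pow (p * p') g \<in> carrier_mat 2 2" using g by auto
  have "disc F = disc g ^ p" unfolding l(3) disc_smult[OF gc(1)] l(2) ..
  then have "(k * l ^ p') ^ 2 * disc (entry_pow (p * p') g) = disc g ^ (p * p')"
    using k(2) unfolding Fp disc_smult[OF gc(2)] by (simp add: power_mult power_mult_distrib mult.assoc)
  moreover have "mps_nth (k * l ^ p') {#} = 1" using k(1) l(1) by (simp add: const_coeff.hom_power)
  moreover have "F' = (k * l ^ p') \<cdot>\<^sub>m entry_pow (p * p') g"
    unfolding k(3) Fp by (intro eq_matI) (auto simp: mult.assoc)
  ultimately show ?thesis
    using chern_image_symplectic_2I[of "p * p'" g "k * l ^ p'"] p g(1) by simp
qed

lemma chern_image_diag_2: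
  fixes a d :: "('i, complex) mps"
  assumes ad: "a * d = 1" and p: "odd p"
  defines "g \<equiv> \<lambda>k. mat 2 2 (\<lambda>(i, j). if i \<noteq> j then 0 else if i = 0 then a ^ k else d ^ k)"
  shows "chern_image (hyperbolic 1 1) p (g k) (g (k * p))"
proof -
  have gc: "g k \<in> carrier_mat 2 2" for k by (simp add: g_def)
  have p0: "p > 0" using p by (rule odd_pos)
  have form: "transpose_mat (g k) * (const_mat (hyperbolic 1 1) * g k) = const_mat (hyperbolic 1 1)" for k
  proof -
    have "a ^ k * d ^ k = 1" "d ^ k * a ^ k = 1" using ad by (simp_all add: mult.commute flip: power_mult_distrib)
    then show ?thesis
      unfolding form_2[OF gc] using hyperbolic_carrier[of 1 1]
      by (intro eq_mat_2) (auto simp: g_def hyperbolic_1_index[unfolded One_nat_def])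
  qed
  have gp: "entry_pow p (g k) = g (k * p)"
    by (rule eq_matI) (use p0 in \<open>auto simp: g_def power_mult power_0_left\<close>)
  have S: "1\<^sub>m 2 \<in> carrier_mat 2 2" "const_term (1\<^sub>m 2 :: ('i, complex) mps mat) = 1\<^sub>m 2"
    by (auto intro!: eq_matI simp: mps_nth_1)
  have "chern_image (hyperbolic 1 1) p (g k) (entry_pow p (g k) * 1\<^sub>m 2)"
  proof (rule chern_image_orthogonal[OF gc _ p0 S form])
    show "hyperbolic 1 1 \<in> carrier_mat 2 2" using hyperbolic_carrier[of 1 1] by simp
    show "entry_pow p (hyperbolic 1 1) = hyperbolic 1 1" by (rule entry_pow_hyperbolic[OF p0]) simp
    show "transpose_mat (entry_pow p (g k)) * (const_mat (hyperbolic 1 1) * entry_pow p (g k)) * (1\<^sub>m 2 * 1\<^sub>m 2) = const_mat (hyperbolic 1 1)"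
      unfolding gp form using hyperbolic_carrier[of 1 1] by simp
  qed
  then show ?thesis unfolding gp using gc[of "k * p"] by simp
qed

section \<open>Evaluation of series at a matrix congruent to 1\<close>

definition eval_at :: "nat \<Rightarrow> series mat \<Rightarrow> series \<Rightarrow> series" where
  "eval_at n g = mps_subst (vars n) id (\<lambda>(i, j). if i < n \<and> j < n then g $$ (i, j) - 1\<^sub>m n $$ (i, j) else 0)"

lemma eval_at_substitution:
  fixes R :: "complex set"
  assumes "class_subring R" and g: "g \<in> carrier_mat n n" "const_term g = 1\<^sub>m n"
  shows "substitution R id (vars n) (\<lambda>(i, j). if i < n \<and> j < n then g $$ (i, j) - 1\<^sub>m n $$ (i, j) else 0)"
proof -
  interpret class_subring R by fact
  show ?thesis
  proof
    show "hom_on R (id :: complex \<Rightarrow> complex)" by (simp add: hom_on_def)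
    show "finite (vars n)" by simp
    fix ik :: "nat \<times> nat"
    have "mat_vanishes 1 (g - 1\<^sub>m n)" using g mat_vanishes_1_iff[OF g(1)] by simp
    then have "vanishes 1 (g $$ (i, k) - 1\<^sub>m n $$ (i, k))" if "i < n" "k < n" for i k
      using that g(1) unfolding mat_vanishes_def by auto
    then show "vanishes 1 (case ik of (i, k) \<Rightarrow> if i < n \<and> k < n then g $$ (i, k) - 1\<^sub>m n $$ (i, k) else 0)"
      by (auto split: prod.splits)
  qed
qed

lemma eval_at:
  assumes R: "class_subring R" and g: "g \<in> carrier_mat n n" "const_term g = 1\<^sub>m n"
  shows "local_hom R (vars n) (eval_at n g)" "eval_at n g (mps_const c) = mps_const c"
    "map_mat (eval_at n g) (generic_mat n) = g"
proof -
  interpret R: class_subring R by fact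
  interpret s: substitution R id "vars n" "\<lambda>(i, j). if i < n \<and> j < n then g $$ (i, j) - 1\<^sub>m n $$ (i, j) else 0"
    by (rule eval_at_substitution[OF R g])
  show loc: "local_hom R (vars n) (eval_at n g)" unfolding eval_at_def by (rule s.local_hom_subst)
  show "eval_at n g (mps_const c) = mps_const c" unfolding eval_at_def by simp
  interpret K: class_subring "series_over R (vars n)" by (rule R.class_subring_series)
  interpret e: class_subring_hom "series_over R (vars n)" "eval_at n g"
    using loc by unfold_locales (simp add: local_hom_def)
  show "map_mat (eval_at n g) (generic_mat n) = g"
  proof (rule eq_matI)
    fix i j assume "i < dim_row g" "j < dim_col g"
    then have ij: "i < n" "j < n" using g by auto
    have "eval_at n g (mps_var (i, j)) = g $$ (i, j) - 1\<^sub>m n $$ (i, j)"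
      unfolding eval_at_def using ij by (subst s.subst_var) auto
    moreover have "eval_at n g (generic_mat n $$ (i, j)) = eval_at n g (if i = j then 1 else 0) + eval_at n g (mps_var (i, j))"
      unfolding generic_mat_index[OF ij] by (rule e.hom_add) (use ij in auto)
    ultimately show "map_mat (eval_at n g) (generic_mat n) $$ (i, j) = g $$ (i, j)" using ij by auto
  qed (use g in auto)
qed

section \<open>The curvature modulo the orthogonal ideal\<close>

locale chern_primes = P: chern_prime n q R p \<phi>\<^sub>0 \<delta> W S + P': chern_prime n q R p' \<phi>\<^sub>0' \<delta> W' S'
  for n :: nat and q :: "complex mat" and R :: "complex set" and \<delta> :: connection
    and p :: nat and \<phi>\<^sub>0 :: "complex \<Rightarrow> complex" and W S :: "(nat \<Rightarrow> series set) mat"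
    and p' :: nat and \<phi>\<^sub>0' :: "complex \<Rightarrow> complex" and W' S' :: "(nat \<Rightarrow> series set) mat"
begin

abbreviation K :: "series set" where "K \<equiv> series_over R (vars n)"

abbreviation J :: "series set" where "J \<equiv> orthogonal_ideal (ring_on R) n q"

abbreviation gens :: "series mat" where
  "gens \<equiv> transpose_mat (generic_mat n) * const_mat q * generic_mat n - const_mat q"

definition bracket :: "series \<Rightarrow> series" where
  "bracket f = P.\<Psi> (P'.\<Psi> f) - P'.\<Psi> (P.\<Psi> f)"

lemma curvature_eq:
  assumes "f \<in> K"
  shows "curvature (ring_on R) n \<delta> p p' f = mps_const (1 / (of_nat p * of_nat p')) * bracket f"
  unfolding curvature_def bracket_def
    P.series_frobenius_eq[OF assms] P'.series_frobenius_eq[OF assms]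
    P.series_frobenius_eq[OF P'.Psi_in[OF assms]] P'.series_frobenius_eq[OF P.Psi_in[OF assms]] ..

lemma gens_in: "elements_mat gens \<subseteq> K"
proof
  fix f assume "f \<in> elements_mat gens"
  then obtain i j where ij: "i < n" "j < n" "f = gens $$ (i, j)"
    using P.q by (auto dest!: elements_matD)
  have Qin: "const_mat q $$ (i, j) \<in> K" if "i < n" "j < n" for i j
    using P.q_in[OF that] that P.q by auto
  have xin: "generic_mat n $$ (i, j) \<in> K" "transpose_mat (generic_mat n) $$ (i, j) \<in> K" if "i < n" "j < n" for i j
    using generic_mat_in_series[OF P.R.class_subring_axioms] that by auto
  have "(transpose_mat (generic_mat n) * const_mat q) $$ (i, j) \<in> K" if "i < n" "j < n" for i j
    by (rule P.approx.K.mult_mat[of _ n n _ n]) (use P.q xin Qin that in auto)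
  note xQ = this
  have c: "transpose_mat (generic_mat n) * const_mat q \<in> carrier_mat n n"
    using P.q by (intro mult_carrier_mat[of _ n n]) auto
  have "(transpose_mat (generic_mat n) * const_mat q * generic_mat n) $$ (i, j) \<in> K"
    by (rule P.approx.K.mult_mat[OF c generic_mat_carrier _ _ ij(1,2)]) (erule (1) xQ, erule (1) xin(1))
  moreover have "f = (transpose_mat (generic_mat n) * const_mat q * generic_mat n) $$ (i, j) - const_mat q $$ (i, j)"
    using ij P.q by simp
  ultimately show "f \<in> K" using Qin[OF ij(1,2)] P.approx.K.diff by simp
qed

lemma ideal_J: "ideal J (ring_on K)" and gens_J: "elements_mat gens \<subseteq> J"
proof -
  interpret cring "ring_on K" by (rule P.approx.K.cring_ring_on)
  show "ideal J (ring_on K)" "elements_mat gens \<subseteq> J"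
    unfolding orthogonal_ideal_def power_series_ring_eq' ring_on_simps(1)
    using genideal_ideal[of "elements_mat gens"] genideal_self[of "elements_mat gens"] gens_in by simp_all
qed

lemma J_minimal:
  assumes "ideal I (ring_on K)" "elements_mat gens \<subseteq> I" shows "J \<subseteq> I"
proof -
  interpret cring "ring_on K" by (rule P.approx.K.cring_ring_on)
  show ?thesis
    unfolding orthogonal_ideal_def power_series_ring_eq' ring_on_simps(1)
    using genideal_minimal[OF assms] .
qed

lemmas J = P.approx.K.idealD[OF ideal_J]

lemma rcos_J: "J +>\<^bsub>power_series_ring (ring_on R) n\<^esub> f = {j + f | j. j \<in> J}"
  unfolding power_series_ring_eq' by (auto simp: a_r_coset_def r_coset_def)

text \<open>The union runs over all representatives \<open>f\<close>. A union of translates of J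
  equals J exactly when every translate does, so the equivalence requires no prior knowledge that
  the curvature maps J into itself.\<close>

lemma so_curvature_eq_zero_iff:
  assumes "C \<in> carrier (power_series_ring (ring_on R) n Quot J)"
  shows "(so_curvature (ring_on R) n q \<delta> p p' C = \<zero>\<^bsub>power_series_ring (ring_on R) n Quot J\<^esub>)
    \<longleftrightarrow> (\<forall>f\<in>C. mps_const (1 / (of_nat p * of_nat p')) * bracket f \<in> J)"
proof -
  obtain y where y: "y \<in> K" "C = {j + y | j. j \<in> J}"
    using assms unfolding FactRing_def A_RCOSETS_def' rcos_J by (auto simp: power_series_ring_eq')
  have C: "C \<subseteq> K" "C \<noteq> {}" using y J(1,2) P.approx.K.add by auto
  have coset: "{j + c | j. j \<in> J} = J \<longleftrightarrow> c \<in> J" for c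
  proof
    assume "{j + c | j. j \<in> J} = J"
    moreover have "0 + c \<in> {j + c | j. j \<in> J}" using J(2) by blast
    ultimately show "c \<in> J" by simp
  next
    assume c: "c \<in> J"
    have "- c \<in> J" using J(4)[OF c, of "- 1"] P.approx.K.uminus[OF P.approx.K.one] by simp
    then have "\<exists>j'\<in>J. j = j' + c" if "j \<in> J" for j
      using that J(3)[of j "- c"] by (intro bexI[of _ "j + - c"]) auto
    then show "{j + c | j. j \<in> J} = J" using J(3)[OF _ c] by blast
  qed
  have "so_curvature (ring_on R) n q \<delta> p p' C = (\<Union>f\<in>C. {j + mps_const (1 / (of_nat p * of_nat p')) * bracket f | j. j \<in> J})"
    unfolding so_curvature_def rcos_J using C(1) curvature_eq by (intro SUP_cong) auto
  moreover have "\<zero>\<^bsub>power_series_ring (ring_on R) n Quot J\<^esub> = J" by (simp add: FactRing_def)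
  moreover have "(\<Union>f\<in>C. {j + c f | j. j \<in> J}) = J \<longleftrightarrow> (\<forall>f\<in>C. c f \<in> J)" for c :: "series \<Rightarrow> series"
  proof
    assume *: "(\<Union>f\<in>C. {j + c f | j. j \<in> J}) = J"
    have "0 + c f \<in> (\<Union>f\<in>C. {j + c f | j. j \<in> J})" if "f \<in> C" for f using that J(2) by blast
    then show "\<forall>f\<in>C. c f \<in> J" unfolding * by simp
  next
    assume *: "\<forall>f\<in>C. c f \<in> J"
    have "(\<Union>f\<in>C. {j + c f | j. j \<in> J}) = (\<Union>f\<in>C. J)"
      by (rule SUP_cong) (use * coset in auto)
    then show "(\<Union>f\<in>C. {j + c f | j. j \<in> J}) = J" using C(2) by simp
  qed
  ultimately show ?thesis by simp
qed

text \<open>Composition is reversed: applying the homomorphism e \<circ> \<open>P.\<Psi>\<close> to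
  the formula for \<open>P'.\<Psi>\<close> at x evaluates the formula for p' at the result of the
  formula for p. Hence \<open>G\<close> belongs to p although \<open>P'.\<Psi>\<close> acts
  first.\<close>

lemma iterate_image:
  assumes e: "local_hom R (vars n) e"
    and G: "chern_image q p (map_mat e (generic_mat n)) G" "chern_image q p' G G'"
  shows "map_mat (\<lambda>f. e (P.\<Psi> (P'.\<Psi> f))) (generic_mat n) = G'"
proof -
  have g: "map_mat e (generic_mat n) \<in> carrier_mat n n" by simp
  have g1: "const_term (map_mat e (generic_mat n)) = 1\<^sub>m n"
    by (rule local_hom_const_term[OF P.R.class_subring_axioms e generic_mat_carrier const_term_generic_mat
        generic_mat_in_series[OF P.R.class_subring_axioms]])
  have "chern_image q p (map_mat e (generic_mat n)) (map_mat e P.F)"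
    by (rule P.chern_image_hom[OF P.R.class_subring_axioms P.half e P.p(2) generic_mat_carrier const_term_generic_mat
        generic_mat_in_series[OF P.R.class_subring_axioms] P.chern_image_F])
  then have eF: "map_mat e P.F = G"
    using P.chern_image_unique[OF P.p(2) g g1 _ G(1)] by blast
  have loc: "local_hom R (vars n) (\<lambda>f. e (P.\<Psi> f))"
    by (rule local_hom_comp[OF P.local_hom_Psi e P.Psi_in])
  have ex: "map_mat (\<lambda>f. e (P.\<Psi> f)) (generic_mat n) = G"
    unfolding eF[symmetric] P.Psi_x[symmetric] by (rule eq_matI) auto
  have "chern_image q p' (map_mat (\<lambda>f. e (P.\<Psi> f)) (generic_mat n)) (map_mat (\<lambda>f. e (P.\<Psi> f)) P'.F)"
    by (rule P.chern_image_hom[OF P.R.class_subring_axioms P.half loc P'.p(2) generic_mat_carrier const_term_generic_mat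
        generic_mat_in_series[OF P.R.class_subring_axioms] P'.chern_image_F])
  then have 1: "chern_image q p' G (map_mat (\<lambda>f. e (P.\<Psi> f)) P'.F)" unfolding ex .
  have Gc: "G \<in> carrier_mat n n" unfolding ex[symmetric] by simp
  have G1: "const_term G = 1\<^sub>m n"
    unfolding eF[symmetric]
    by (rule local_hom_const_term[OF P.R.class_subring_axioms e P.F_carrier P.const_term_F P.F_in])
  have "map_mat (\<lambda>f. e (P.\<Psi> f)) P'.F = G'"
    by (rule P.chern_image_unique[OF P'.p(2) Gc G1 1 G(2)])
  moreover have "map_mat (\<lambda>f. e (P.\<Psi> (P'.\<Psi> f))) (generic_mat n) = map_mat (\<lambda>f. e (P.\<Psi> f)) P'.F"
    unfolding P'.Psi_x[symmetric] by (rule eq_matI) auto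
  ultimately show ?thesis by simp
qed

end

sublocale chern_primes \<subseteq> swap: chern_primes n q R \<delta> p' \<phi>\<^sub>0' W' S' p \<phi>\<^sub>0 W S
  by (intro chern_primes.intro P.chern_prime_axioms P'.chern_prime_axioms)

context chern_primes begin

lemma K_subring: "class_subring_hom K e" if "local_hom R (vars n) e" 
  for e :: "series \<Rightarrow> ('j, 'b::comm_ring_1) mps"
  using that by unfold_locales (simp add: local_hom_def)

lemma bracket_hom:
  assumes e: "local_hom R (vars n) e" and f: "f \<in> K"
  shows "e (bracket f) = e (P.\<Psi> (P'.\<Psi> f)) - e (P'.\<Psi> (P.\<Psi> f))"
  unfolding bracket_def
  by (rule class_subring_hom.hom_diff[OF K_subring[OF e]]) (intro P.Psi_in P'.Psi_in f)+

text \<open>The kernel of \<open>e\<close> is an ideal, and it contains the generators of J because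
  the image of x preserves q.\<close>

lemma J_kernel:
  fixes e :: "series \<Rightarrow> ('j, complex) mps"
  assumes e: "local_hom R (vars n) e"
    and g: "transpose_mat (map_mat e (generic_mat n)) * (const_mat q * map_mat e (generic_mat n)) = const_mat q"
    and f: "f \<in> J"
  shows "e f = 0"
proof -
  interpret e: class_subring_hom K e by (rule K_subring[OF e])
  let ?I = "{f \<in> K. e f = 0}" and ?x = "generic_mat n"
  have "ideal ?I (ring_on K)"
    by (rule P.approx.K.idealI') (auto simp: e.hom_add e.hom_mult)
  moreover have "elements_mat gens \<subseteq> ?I"
  proof
    fix h assume h: "h \<in> elements_mat gens"
    then obtain i j where ij: "i < n" "j < n" "h = gens $$ (i, j)"
      using P.q by (auto dest!: elements_matD)
    have Qc: "const_mat q \<in> carrier_mat n n" and xt: "transpose_mat ?x \<in> carrier_mat n n" using P.q by auto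
    have Qin: "const_mat q $$ (i, j) \<in> K" if "i < n" "j < n" for i j
      using P.q_in[OF that] that P.q by auto
    have xin: "?x $$ (i, j) \<in> K" "transpose_mat ?x $$ (i, j) \<in> K" if "i < n" "j < n" for i j
      using generic_mat_in_series[OF P.R.class_subring_axioms] that by auto
    have Qx: "(const_mat q * ?x) $$ (i, j) \<in> K" if "i < n" "j < n" for i j
      by (rule P.approx.K.mult_mat[OF Qc generic_mat_carrier _ _ that]) (erule (1) Qin, erule (1) xin(1))
    have xQx: "(transpose_mat ?x * (const_mat q * ?x)) $$ (i, j) \<in> K"
      by (rule P.approx.K.mult_mat[OF xt mult_carrier_mat[OF Qc generic_mat_carrier] _ _ ij(1,2)])
        (erule (1) xin(2), erule (1) Qx)
    have eQ: "map_mat e (const_mat q) = const_mat q"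
    proof (rule eq_matI)
      fix i j assume "i < dim_row (const_mat q :: ('j, complex) mps mat)" "j < dim_col (const_mat q :: ('j, complex) mps mat)"
      then show "map_mat e (const_mat q) $$ (i, j) = const_mat q $$ (i, j)"
        using P.q P.q_entries[of i j] e.hom_uminus[of 1] by (auto simp: mps_const.hom_uminus)
    qed auto
    have "map_mat e (transpose_mat ?x * (const_mat q * ?x)) = map_mat e (transpose_mat ?x) * map_mat e (const_mat q * ?x)"
      by (rule e.hom_mult_mat[OF xt mult_carrier_mat[OF Qc generic_mat_carrier]]) (erule (1) xin(2), erule (1) Qx)
    also have "map_mat e (const_mat q * ?x) = map_mat e (const_mat q) * map_mat e ?x"
      by (rule e.hom_mult_mat[OF Qc generic_mat_carrier]) (erule (1) Qin, erule (1) xin(1))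
    finally have "map_mat e (transpose_mat ?x * (const_mat q * ?x)) = const_mat q"
      using g by (simp only: map_mat_transpose' eQ)
    note eX = this
    have "e ((transpose_mat ?x * (const_mat q * ?x)) $$ (i, j)) = map_mat e (transpose_mat ?x * (const_mat q * ?x)) $$ (i, j)"
      by (rule index_map_mat(1)[symmetric]) (use ij Qc in auto)
    also have "\<dots> = map_mat e (const_mat q) $$ (i, j)" by (simp only: eX eQ)
    also have "\<dots> = e (const_mat q $$ (i, j))" by (rule index_map_mat(1)) (use ij Qc in auto)
    finally have "e ((transpose_mat ?x * (const_mat q * ?x)) $$ (i, j)) = e (const_mat q $$ (i, j))" .
    moreover have "h = (transpose_mat ?x * (const_mat q * ?x)) $$ (i, j) - const_mat q $$ (i, j)"
      unfolding ij(3) assoc_mult_mat[OF xt Qc generic_mat_carrier] using ij Qc by simp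
    ultimately have "e h = 0" using e.hom_diff[OF xQx Qin[OF ij(1,2)]] by simp
    then show "h \<in> ?I" using h gens_in by auto
  qed
  ultimately show ?thesis using J_minimal f by blast
qed

lemma so_curvature_nonzero:
  assumes e: "local_hom R (vars n) e" and g: "map_mat e (generic_mat n) = g"
    and orth: "transpose_mat g * (const_mat q * g) = const_mat q"
    and G: "chern_image q p g G" "chern_image q p' G G'"
    and H: "chern_image q p' g H" "chern_image q p H H'" and neq: "G' \<noteq> H'"
  shows "\<exists>C\<in>carrier (power_series_ring (ring_on R) n Quot J).
    so_curvature (ring_on R) n q \<delta> p p' C \<noteq> \<zero>\<^bsub>power_series_ring (ring_on R) n Quot J\<^esub>"
proof -
  let ?x = "generic_mat n"
  have G': "map_mat (\<lambda>f. e (P.\<Psi> (P'.\<Psi> f))) ?x = G'"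
    by (rule iterate_image[OF e]) (use G g in auto)
  have H': "map_mat (\<lambda>f. e (P'.\<Psi> (P.\<Psi> f))) ?x = H'"
    by (rule swap.iterate_image[OF e]) (use H g in auto)
  have "\<exists>i<n. \<exists>j<n. G' $$ (i, j) \<noteq> H' $$ (i, j)"
  proof (rule ccontr)
    assume "\<not> ?thesis"
    then have "G' = H'" unfolding G'[symmetric] H'[symmetric] by (intro eq_matI) auto
    then show False using neq by simp
  qed
  then obtain i j where ij: "i < n" "j < n" "G' $$ (i, j) \<noteq> H' $$ (i, j)" by blast
  define f where "f = ?x $$ (i, j)"
  have f: "f \<in> K" unfolding f_def by (rule generic_mat_in_series[OF P.R.class_subring_axioms ij(1,2)])
  have "e (bracket f) = G' $$ (i, j) - H' $$ (i, j)"
    unfolding bracket_hom[OF e f] G'[symmetric] H'[symmetric] using ij by (simp add: f_def)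
  then have nz: "e (bracket f) \<noteq> 0" using ij(3) by simp
  define C where "C = J +>\<^bsub>power_series_ring (ring_on R) n\<^esub> f"
  have C: "C \<in> carrier (power_series_ring (ring_on R) n Quot J)"
    unfolding C_def FactRing_def A_RCOSETS_def' using f by (auto simp: power_series_ring_eq')
  have fC: "f \<in> C" unfolding C_def rcos_J using J(2) by force
  have "mps_const (1 / (of_nat p * of_nat p')) * bracket f \<notin> J"
  proof
    assume *: "mps_const (1 / (of_nat p * of_nat p')) * bracket f \<in> J"
    \<comment> \<open>Multiplying by pp' stays inside J, so nonvanishing may be tested on the
      commutator without its denominator.\<close>
    have "mps_const (of_nat p * of_nat p') * (mps_const (1 / (of_nat p * of_nat p')) * bracket f) \<in> J"
      by (rule J(4)[OF *]) auto
    moreover have "mps_const (of_nat p * of_nat p') * (mps_const (1 / (of_nat p * of_nat p')) * bracket f) = bracket f"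
      by (rule mps_eqI) (use P.p(1) P'.p(1) in \<open>simp add: prime_gt_0_nat\<close>)
    ultimately have "bracket f \<in> J" by simp
    then have "e (bracket f) = 0" by (rule J_kernel[OF e, rotated]) (use g orth in simp)
    then show False using nz by simp
  qed
  then show ?thesis using so_curvature_eq_zero_iff[OF C] C fC by blast
qed

text \<open>Both Frobenius lifts reduce to a power map, so their bracket is divisible by \<open>p\<close> and by \<open>p'\<close>.\<close>

lemma bracket_dvd_left:
  assumes f: "f \<in> K" shows "\<exists>h\<in>K. bracket f = of_nat p * h"
proof -
  obtain k1 where k1: "k1 \<in> K" "P.\<Psi> (P'.\<Psi> f) - P'.\<Psi> f ^ p = of_nat p * k1"
    using P.frobenius_cong[OF P'.Psi_in[OF f]] by blast
  obtain k2 where k2: "k2 \<in> K" "P.\<Psi> f - f ^ p = of_nat p * k2"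
    using P.frobenius_cong[OF f] by blast
  \<comment> \<open>Both composites are congruent modulo p to the p-th power of
    \<open>P'.\<Psi> f\<close>: one by the congruence at that series, the other by applying
    \<open>P'.\<Psi>\<close> to the congruence at \<open>f\<close>.\<close>
  have "P'.\<Psi> (P.\<Psi> f) - P'.\<Psi> f ^ p = P'.\<Psi> (P.\<Psi> f - f ^ p)"
    using P'.PsiK.hom_diff[OF P.Psi_in[OF f] P.approx.K.power[OF f]] P'.PsiK.hom_power[OF f] by simp
  also have "\<dots> = of_nat p * P'.\<Psi> k2"
    unfolding k2(2) using P'.PsiK.hom_mult[OF P.approx.K.of_nat k2(1)] P'.PsiK.hom_of_nat by simp
  finally have "bracket f = of_nat p * (k1 - P'.\<Psi> k2)"
    unfolding bracket_def using k1(2) by (simp add: algebra_simps)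
  moreover have "k1 - P'.\<Psi> k2 \<in> K" by (intro P.approx.K.diff k1 P'.Psi_in k2)
  ultimately show ?thesis by blast
qed

end

context chern_primes begin

lemma bracket_swap: "swap.bracket f = - bracket f"
  by (simp add: bracket_def swap.bracket_def)

text \<open>Divisibility by each of two distinct primes is combined by a Bezout relation. The
  quotient must itself be a series over A, since a congruence modulo J will be applied to
  it.\<close>

lemma curvature_in:
  assumes f: "f \<in> K" and neq: "p \<noteq> p'"
  shows "mps_const (1 / (of_nat p * of_nat p')) * bracket f \<in> K"
proof -
  obtain a where a: "a \<in> K" "bracket f = of_nat p * a" using bracket_dvd_left[OF f] by blast
  obtain b' where b': "b' \<in> K" "swap.bracket f = of_nat p' * b'" using swap.bracket_dvd_left[OF f] by blast
  define b where "b = - b'"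
  have b: "b \<in> K" "bracket f = of_nat p' * b"
    using b' P.approx.K.uminus unfolding b_def bracket_swap by (auto simp: minus_equation_iff)
  have "coprime (int p) (int p')" using P.p(1) P'.p(1) neq by (simp add: primes_coprime)
  then obtain u v where uv: "u * int p + v * int p' = 1"
    using bezout_int[of "int p" "int p'"] by (auto simp: coprime_iff_gcd_eq_1)
  have "bracket f = of_int (u * int p + v * int p') * bracket f" by (simp add: uv)
  also have "\<dots> = of_int u * of_nat p * (of_nat p' * b) + of_int v * of_nat p' * (of_nat p * a)"
    using a(2) b(2) by (simp add: distrib_right)
  also have "\<dots> = of_nat p * of_nat p' * (of_int u * b + of_int v * a)"
    by (simp add: algebra_simps)
  also have "\<dots> = mps_const (of_nat p * of_nat p') * (of_int u * b + of_int v * a)"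
    by (simp add: mps_const.hom_mult mps_const.hom_of_nat)
  finally have eq: "bracket f = mps_const (of_nat p * of_nat p') * (of_int u * b + of_int v * a)" .
  have "mps_const (1 / (of_nat p * of_nat p')) * bracket f = of_int u * b + of_int v * a"
    unfolding eq by (rule mps_eqI) (use P.p(1) P'.p(1) in \<open>simp add: prime_gt_0_nat\<close>)
  moreover have "of_int u * b + of_int v * a \<in> K"
    by (intro P.approx.K.add P.approx.K.mult P.approx.K.of_int a b)
  ultimately show ?thesis by simp
qed

text \<open>Modulo J the map \<open>e\<close> is the identity, so it is enough that \<open>e\<close>
  kills the curvature. After \<open>e\<close>, the two composites agree on constants and on x, hence
  everywhere by continuity.\<close>

lemma so_curvature_zero:
  assumes e: "local_hom R (vars n) e" and g: "map_mat e (generic_mat n) = g"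
    and const: "\<And>c. c \<in> R \<Longrightarrow> e (mps_const c) = mps_const c"
    and J_cong: "\<And>f. f \<in> K \<Longrightarrow> f - e f \<in> J"
    and G: "chern_image q p g G" "chern_image q p' G G'"
    and H: "chern_image q p' g H" "chern_image q p H G'"
    and phi0: "\<And>c. c \<in> R \<Longrightarrow> \<phi>\<^sub>0 (\<phi>\<^sub>0' c) = \<phi>\<^sub>0' (\<phi>\<^sub>0 c)" and neq: "p \<noteq> p'"
    and C: "C \<in> carrier (power_series_ring (ring_on R) n Quot J)"
  shows "so_curvature (ring_on R) n q \<delta> p p' C = \<zero>\<^bsub>power_series_ring (ring_on R) n Quot J\<^esub>"
  unfolding so_curvature_eq_zero_iff[OF C]
proof
  interpret e: class_subring_hom K e by (rule K_subring[OF e])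
  let ?x = "generic_mat n"
  fix f assume "f \<in> C"
  then have f: "f \<in> K"
    using C J(1) P.approx.K.add unfolding FactRing_def A_RCOSETS_def' rcos_J by (auto simp: power_series_ring_eq')
  let ?l = "\<lambda>f. e (P.\<Psi> (P'.\<Psi> f))" and ?r = "\<lambda>f. e (P'.\<Psi> (P.\<Psi> f))"
  have eq: "map_mat ?l ?x = map_mat ?r ?x"
    using iterate_image[OF e, of G G'] swap.iterate_image[OF e, of H G'] G H g by simp
  have l: "local_hom R (vars n) ?l"
    by (rule local_hom_comp[OF P'.local_hom_Psi local_hom_comp[OF P.local_hom_Psi e P.Psi_in] P'.Psi_in])
  have r: "local_hom R (vars n) ?r"
    by (rule local_hom_comp[OF P.local_hom_Psi local_hom_comp[OF P'.local_hom_Psi e P'.Psi_in] P.Psi_in])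
  interpret l: class_subring_hom K ?l by (rule K_subring[OF l])
  interpret r: class_subring_hom K ?r by (rule K_subring[OF r])
  have "?l f = ?r f"
  proof (rule local_hom_eqI[OF P.R.class_subring_axioms _ l r _ _ f])
    show "finite (vars n)" by simp
    show "?l (mps_const c) = ?r (mps_const c)" if "c \<in> R" for c
      by (simp add: P.Psi_const P'.Psi_const phi0[OF that])
    fix ij assume "ij \<in> vars n"
    then obtain i j where ij: "ij = (i, j)" "i < n" "j < n" by auto
    have x: "?x $$ (i, j) \<in> K" by (rule generic_mat_in_series[OF P.R.class_subring_axioms ij(2,3)])
    have d: "(if i = j then 1 else 0) \<in> K" by auto
    have v: "mps_var ij = ?x $$ (i, j) - (if i = j then 1 else 0)"
      using ij by (simp add: generic_mat_index)
    have "?l (?x $$ (i, j)) = ?r (?x $$ (i, j))"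
      using arg_cong[OF eq, of "\<lambda>X. X $$ (i, j)"] ij by simp
    moreover have "?l (if i = j then 1 else 0) = ?r (if i = j then 1 else 0)" by simp
    ultimately show "?l (mps_var ij) = ?r (mps_var ij)"
      unfolding v l.hom_diff[OF x d] r.hom_diff[OF x d] by simp
  qed
  then have zero: "e (bracket f) = 0" unfolding bracket_hom[OF e f] by simp
  define k where "k = mps_const (1 / (of_nat p * of_nat p')) * bracket f"
  have k: "k \<in> K" unfolding k_def by (rule curvature_in[OF f neq])
  have c: "mps_const (of_nat p * of_nat p') \<in> K" by auto
  have "bracket f = mps_const (of_nat p * of_nat p') * k"
    unfolding k_def by (rule mps_eqI) (use P.p(1) P'.p(1) in \<open>simp add: prime_gt_0_nat\<close>)
  then have "mps_const (of_nat p * of_nat p') * e k = 0"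
    using zero e.hom_mult[OF c k] const[OF P.R.mult[OF P.R.of_nat P.R.of_nat], of p p'] by simp
  then have "of_nat p * of_nat p' * mps_nth (e k) m = 0" for m
    by (metis mps_nth_0 mps_nth_const_mult)
  \<comment> \<open>The complex coefficients have no torsion, so the vanishing of the image of the
    commutator passes to that of its quotient by pp'.\<close>
  then have "e k = 0" using P.p(1) P'.p(1) by (intro mps_eqI) (auto simp: prime_gt_0_nat)
  then show "mps_const (1 / (of_nat p * of_nat p')) * bracket f \<in> J"
    using J_cong[OF k] unfolding k_def by simp
qed

end

lemma so_curvature_same_prime:
  assumes "chern_primes n q R \<delta> p \<phi>\<^sub>0 W S p \<phi>\<^sub>0 W S"
    and "C \<in> carrier (power_series_ring (ring_on R) n Quot orthogonal_ideal (ring_on R) n q)"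
  shows "so_curvature (ring_on R) n q \<delta> p p C = \<zero>\<^bsub>power_series_ring (ring_on R) n Quot orthogonal_ideal (ring_on R) n q\<^esub>"
proof -
  interpret chern_primes n q R \<delta> p \<phi>\<^sub>0 W S p \<phi>\<^sub>0 W S by fact
  have "0 \<in> orthogonal_ideal (ring_on R) n q" by (rule J(2))
  then show ?thesis unfolding so_curvature_eq_zero_iff[OF assms(2)] by (simp add: bracket_def)
qed

text \<open>A certificate for nonzero curvature that does not mention the connection; it can be
  constructed for the hyperbolic forms and then transported to the odd form.\<close>

definition noncommuting :: "nat \<Rightarrow> complex mat \<Rightarrow> nat \<Rightarrow> nat \<Rightarrow> bool" where
  "noncommuting n q p p' \<longleftrightarrow> (\<exists>g G G' H H' :: series mat. g \<in> carrier_mat n n \<and> const_term g = 1\<^sub>m n \<and>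
     G \<in> carrier_mat n n \<and> H \<in> carrier_mat n n \<and>
     transpose_mat g * (const_mat q * g) = const_mat q \<and>
     chern_image q p g G \<and> chern_image q p' G G' \<and> chern_image q p' g H \<and> chern_image q p H H' \<and> G' \<noteq> H')"

lemma noncommuting_hyperbolic:
  assumes r: "r \<ge> 3" and \<epsilon>: "\<epsilon> \<in> {1, - 1}" and p: "odd p" "p \<ge> 3" "odd p'" "p' \<ge> 3" "p \<noteq> p'"
  shows "noncommuting (2 * r) (hyperbolic \<epsilon> r) p p'"
proof -
  define t :: series where "t = mps_var (0, 0)"
  define a where "a = mps_const 2 * t"
  define c where "c = t + t ^ 2"
  define u where "u = mps_const 2 * t ^ 2"
  have ab: "a * t = u" by (simp add: a_def u_def power2_eq_square mult.assoc)
  have ab': "a ^ k * t ^ k = u ^ k" for k unfolding ab[symmetric] by (simp add: power_mult_distrib)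
  have t0: "mps_nth t {#} = 0" by (simp add: t_def mps_nth_var)
  have 0: "mps_nth a {#} = 0" "mps_nth c {#} = 0" "mps_nth u {#} = 0"
    by (simp_all add: a_def c_def u_def t0 power2_eq_square)
  have pow0: "mps_nth (f ^ k) {#} = 0" if "mps_nth f {#} = 0" "k \<ge> 3" for f :: series and k
    using that const_coeff.hom_power[of f k] by (simp add: power_0_left)
  have hc0: "mps_nth (heis_c k f h) {#} = 0" if "mps_nth f {#} = 0" "mps_nth h {#} = 0" "k \<ge> 3" for k and f h :: series
    using that by (simp add: heis_c_def pow0)
  have ep: "\<epsilon> ^ k = \<epsilon>" if "odd k" for k using \<epsilon> that by auto
  \<comment> \<open>The exponent m records how often powers have been taken: the two outer
    parameters stay powers of a and t with product u^m, so iteration remains in the Heisenberg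
    family.\<close>
  have image: "chern_image (hyperbolic \<epsilon> r) k (heis_levi r (a ^ m) (t ^ m) h) (heis_levi r (a ^ (m * k)) (t ^ (m * k)) (heis_c k (u ^ m) h))"
    if "odd k" "mps_nth (a ^ m) {#} = 0" "mps_nth (t ^ m) {#} = 0" "mps_nth h {#} = 0" for k m h
    using chern_image_heis_levi[OF r that(1) ep[OF that(1)] that(2-4)] by (simp add: ab' power_mult)
  let ?g = "heis_levi r (a ^ 1) (t ^ 1) c"
  have "const_term ?g = 1\<^sub>m (2 * r)"
  proof -
    have "const_term (transpose_mat (heis r (- (a ^ 1)) (- (t ^ 1)) (a ^ 1 * t ^ 1 - c))) = 1\<^sub>m r"
      by (simp add: map_mat_transpose' const_term_heis 0 t0 heis_0)
    moreover have "const_term (heis r (a ^ 1) (t ^ 1) c) = 1\<^sub>m r"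
      by (simp add: const_term_heis 0 t0 heis_0)
    moreover have "const_term (0\<^sub>m r r :: series mat) = 0\<^sub>m r r" by (rule eq_matI) auto
    ultimately have "const_term ?g = four_block_mat (1\<^sub>m r) (0\<^sub>m r r) (0\<^sub>m r r) (1\<^sub>m r)"
      unfolding heis_levi_def by (subst map_four_block_mat[of _ r r _ r _ r]) auto
    then show ?thesis by (simp add: mult_2)
  qed
  moreover have "transpose_mat ?g * (const_mat (hyperbolic \<epsilon> r) * ?g) = const_mat (hyperbolic \<epsilon> r)"
  proof -
    have "heis r (- (a ^ 1)) (- (t ^ 1)) (a ^ 1 * t ^ 1 - c) * heis r (a ^ 1) (t ^ 1) c = 1\<^sub>m r"
      by (simp add: heis_mult[OF r] heis_0)
    then show ?thesis
      unfolding heis_levi_def levi_form[OF heis_carrier heis_carrier] by (simp add: const_mat_hyperbolic)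
  qed
  moreover have "chern_image (hyperbolic \<epsilon> r) p ?g (heis_levi r (a ^ p) (t ^ p) (heis_c p u c))"
    using image[OF p(1), of 1 c] 0 t0 by simp
  moreover have "chern_image (hyperbolic \<epsilon> r) p' ?g (heis_levi r (a ^ p') (t ^ p') (heis_c p' u c))"
    using image[OF p(3), of 1 c] 0 t0 by simp
  moreover have "chern_image (hyperbolic \<epsilon> r) p' (heis_levi r (a ^ p) (t ^ p) (heis_c p u c))
      (heis_levi r (a ^ (p * p')) (t ^ (p * p')) (heis_c p' (u ^ p) (heis_c p u c)))"
    by (rule image[OF p(3)]) (use pow0 hc0 0 t0 p in auto)
  moreover have "chern_image (hyperbolic \<epsilon> r) p (heis_levi r (a ^ p') (t ^ p') (heis_c p' u c))
      (heis_levi r (a ^ (p' * p)) (t ^ (p' * p)) (heis_c p (u ^ p') (heis_c p' u c)))"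
    by (rule image[OF p(1)]) (use pow0 hc0 0 t0 p in auto)
  moreover have "heis_levi r (a ^ (p * p')) (t ^ (p * p')) (heis_c p' (u ^ p) (heis_c p u c))
      \<noteq> heis_levi r (a ^ (p' * p)) (t ^ (p' * p)) (heis_c p (u ^ p') (heis_c p' u c))"
  proof
    assume eq: "heis_levi r (a ^ (p * p')) (t ^ (p * p')) (heis_c p' (u ^ p) (heis_c p u c))
      = heis_levi r (a ^ (p' * p)) (t ^ (p' * p)) (heis_c p (u ^ p') (heis_c p' u c))"
    have "heis_levi r x y z $$ (0, 2) = z" for x y z :: series
      using r by (simp add: heis_levi_def heis_def)
    then have "heis_c p' (u ^ p) (heis_c p u c) = heis_c p (u ^ p') (heis_c p' u c)"
      using arg_cong[OF eq, of "\<lambda>X. X $$ (0, 2)"] by simp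
    then show False using heis_c_noncommuting[OF p(2,4,5), of "(0, 0) :: nat \<times> nat"] unfolding u_def c_def t_def by blast
  qed
  ultimately show ?thesis
    unfolding noncommuting_def using heis_levi_carrier by blast
qed

lemma noncommuting_block:
  assumes "noncommuting m q p p'" and q: "q \<in> carrier_mat m m" and p: "p > 0" "p' > 0"
  shows "noncommuting (Suc m) (four_block_mat (1\<^sub>m 1) (0\<^sub>m 1 m) (0\<^sub>m m 1) q) p p'"
proof -
  define D where "D = (\<lambda>X :: series mat. four_block_mat (1\<^sub>m 1) (0\<^sub>m 1 m) (0\<^sub>m m 1) X)"
  obtain g G G' H H' :: "series mat" where g: "g \<in> carrier_mat m m" "const_term g = 1\<^sub>m m"
    and c: "G \<in> carrier_mat m m" "H \<in> carrier_mat m m"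
    and orth: "transpose_mat g * (const_mat q * g) = const_mat q"
    and i: "chern_image q p g G" "chern_image q p' G G'" "chern_image q p' g H" "chern_image q p H H'" and neq: "G' \<noteq> H'"
    using assms(1) unfolding noncommuting_def by blast
  have c': "G' \<in> carrier_mat m m" "H' \<in> carrier_mat m m"
    using i(2,4) c unfolding chern_image_def by auto
  have carr: "D X \<in> carrier_mat (Suc m) (Suc m)" if "X \<in> carrier_mat m m" for X
    unfolding D_def using that by (intro carrier_matI) auto
  have "const_term (D g) = 1\<^sub>m (Suc m)"
  proof (rule eq_matI)
    fix i j assume "i < dim_row (1\<^sub>m (Suc m) :: complex mat)" "j < dim_col (1\<^sub>m (Suc m) :: complex mat)"
    then have ij: "i < Suc m" "j < Suc m" by auto
    have "mps_nth (g $$ (i, j)) {#} = 1\<^sub>m m $$ (i, j)" if "i < m" "j < m" for i j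
      using arg_cong[OF g(2), of "\<lambda>X. X $$ (i, j)"] that g(1) by simp
    from this[of "i - 1" "j - 1"] show "const_term (D g) $$ (i, j) = 1\<^sub>m (Suc m) $$ (i, j)"
      using ij g(1) by (auto simp: D_def mps_nth_1)
  qed (use g in \<open>auto simp: D_def\<close>)
  moreover have "transpose_mat (D g) * (const_mat (four_block_mat (1\<^sub>m 1) (0\<^sub>m 1 m) (0\<^sub>m m 1) q) * D g)
      = const_mat (four_block_mat (1\<^sub>m 1) (0\<^sub>m 1 m) (0\<^sub>m m 1) q)"
  proof -
    have DQ: "const_mat (four_block_mat (1\<^sub>m 1) (0\<^sub>m 1 m) (0\<^sub>m m 1) q) = D (const_mat q)"
      unfolding D_def using q by (intro eq_matI) auto
    have DD: "D X * D Y = D (X * Y)" if "X \<in> carrier_mat m m" "Y \<in> carrier_mat m m" for X Y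
      unfolding D_def using block_mult_diag[of "1\<^sub>m 1" 1 X m "1\<^sub>m 1" Y] that by simp
    have DT: "transpose_mat (D g) = D (transpose_mat g)"
      unfolding D_def using block_transpose_diag[of "1\<^sub>m 1" 1 g m] g by simp
    have "const_mat q \<in> carrier_mat m m" "const_mat q * g \<in> carrier_mat m m" "transpose_mat g \<in> carrier_mat m m"
      using q g(1) by auto
    then show ?thesis unfolding DQ DT by (simp add: DD g(1) orth)
  qed
  moreover have "D G' \<noteq> D H'"
  proof
    assume eq: "D G' = D H'"
    have "G' $$ (i, j) = H' $$ (i, j)" if "i < m" "j < m" for i j
      using arg_cong[OF eq, of "\<lambda>X. X $$ (Suc i, Suc j)"] that c' by (simp add: D_def)
    then have "G' = H'" using c' by (intro eq_matI) auto
    then show False using neq by simp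
  qed
  moreover note chern_image_block[OF g(1) q p(1) i(1), folded D_def] chern_image_block[OF c(1) q p(2) i(2), folded D_def]
    chern_image_block[OF g(1) q p(2) i(3), folded D_def] chern_image_block[OF c(2) q p(1) i(4), folded D_def]
  ultimately show ?thesis
    unfolding noncommuting_def using carr[OF g(1)] carr[OF c(1)] carr[OF c(2)] by blast
qed

text \<open>The bound on n is the one that gives r at least 3 in both the even and the odd case,
  which leaves room for the Heisenberg block.\<close>

lemma noncommuting_split:
  assumes "split_matrix n q" "n \<ge> 6" and p: "odd p" "p \<ge> 3" "odd p'" "p' \<ge> 3" "p \<noteq> p'"
  shows "noncommuting n q p p'"
  using assms(1)
proof (cases rule: split_matrix_cases)
  case (1 r \<epsilon>)
  then show ?thesis using noncommuting_hyperbolic[OF _ 1(1) p, of r] assms(2) by simp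
next
  case (2 r)
  then have "noncommuting (2 * r) (hyperbolic 1 r) p p'"
    using noncommuting_hyperbolic[OF _ _ p, of r 1] assms(2) by simp
  then show ?thesis unfolding 2 using p by (intro noncommuting_block hyperbolic_carrier) auto
qed

section \<open>Vanishing in rank two\<close>

lemma local_hom_id: "local_hom R I (\<lambda>f. f)"
  by (simp add: local_hom_def hom_on_def)

text \<open>Evaluation is at x itself: both iterates are the image of x for the exponent pp', so by
  uniqueness the lifts commute on all of A[[T]] and not merely modulo J.\<close>

lemma (in chern_primes) so_curvature_zero_symplectic:
  assumes n: "n = 2" and q: "q = hyperbolic (- 1) 1"
    and phi0: "\<And>c. c \<in> R \<Longrightarrow> \<phi>\<^sub>0 (\<phi>\<^sub>0' c) = \<phi>\<^sub>0' (\<phi>\<^sub>0 c)" and neq: "p \<noteq> p'"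
    and C: "C \<in> carrier (power_series_ring (ring_on R) n Quot J)"
  shows "so_curvature (ring_on R) n q \<delta> p p' C = \<zero>\<^bsub>power_series_ring (ring_on R) n Quot J\<^esub>"
proof -
  let ?x = "generic_mat n"
  have G: "chern_image q p' P.F (entry_pow p' P.F * P.formS p' P.F)"
    by (rule P.chern_image_formS[OF P'.p(2) P.F_carrier P.const_term_F])
  have H: "chern_image q p P'.F (entry_pow p P'.F * P.formS p P'.F)"
    by (rule P.chern_image_formS[OF P.p(2) P'.F_carrier P'.const_term_F])
  have x: "?x \<in> carrier_mat 2 2" "const_term ?x = 1\<^sub>m 2"
    using generic_mat_carrier[of n] const_term_generic_mat[of n] unfolding n by auto
  have "chern_image q (p * p') ?x (entry_pow p' P.F * P.formS p' P.F)"
    using chern_image_symplectic_2_comp[OF P.p(2) P'.p(2) x] P.chern_image_F G unfolding q by blast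
  moreover have "chern_image q (p * p') ?x (entry_pow p P'.F * P.formS p P'.F)"
    using chern_image_symplectic_2_comp[OF P'.p(2) P.p(2) x] P'.chern_image_F H unfolding q
    by (simp only: mult.commute[of p p'])
  ultimately have eq: "entry_pow p' P.F * P.formS p' P.F = entry_pow p P'.F * P.formS p P'.F"
    using P.chern_image_unique[of "p * p'" ?x, OF _ generic_mat_carrier const_term_generic_mat] P.p(2) P'.p(2) by simp
  show ?thesis
  proof (rule so_curvature_zero[OF local_hom_id _ _ _ P.chern_image_F G P'.chern_image_F H[folded eq] phi0 neq C])
    show "map_mat (\<lambda>f. f) ?x = ?x" by (rule eq_matI) auto
  qed (use J(2) in auto)
qed

text \<open>The generators of J are \<open>2 * x00 * x10\<close>, \<open>2 * x01 * x11\<close> and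
  \<open>x00 * x11 + x10 * x01 - 1\<close>, where \<open>xij\<close> denotes the entry of x at i, j.
  As 2, \<open>x00\<close> and \<open>x11\<close> are units, J contains \<open>x10\<close>,
  \<open>x01\<close> and \<open>x11\<close> minus the inverse of \<open>x00\<close>. Evaluation at
  diag(a, 1/a) with a = \<open>x00\<close> is therefore the identity modulo J.\<close>

lemma (in chern_primes) so_curvature_zero_symmetric:
  assumes n: "n = 2" and q: "q = hyperbolic 1 1"
    and phi0: "\<And>c. c \<in> R \<Longrightarrow> \<phi>\<^sub>0 (\<phi>\<^sub>0' c) = \<phi>\<^sub>0' (\<phi>\<^sub>0 c)" and neq: "p \<noteq> p'"
    and C: "C \<in> carrier (power_series_ring (ring_on R) n Quot J)"
  shows "so_curvature (ring_on R) n q \<delta> p p' C = \<zero>\<^bsub>power_series_ring (ring_on R) n Quot J\<^esub>"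
proof -
  let ?x = "generic_mat n"
  note Rs = P.R.class_subring_axioms
  have xin: "?x $$ (i, j) \<in> K" if "i < 2" "j < 2" for i j
    using generic_mat_in_series[OF Rs, of i n j] that n by simp
  have x1: "mps_nth (?x $$ (0, 0)) {#} = 1" "mps_nth (?x $$ (1, 1)) {#} = 1"
    using const_term_2[of ?x] const_term_generic_mat[of n] n by auto
  define a where "a = ?x $$ (0, 0)"
  obtain d where d: "d * a = 1" using series_inverse[OF x1(1)] unfolding a_def by blast
  obtain d' where d': "d' * ?x $$ (1, 1) = 1" using series_inverse[OF x1(2)] by blast
  have aK: "a \<in> K" using xin unfolding a_def by simp
  have dK: "d \<in> K"
    by (rule series_inverse_in_series[OF Rs aK _ d]) (use x1 in \<open>simp add: a_def\<close>)
  have d'K: "d' \<in> K"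
    by (rule series_inverse_in_series[OF Rs xin x1(2) d']) auto
  have ad: "a * d = 1" using d by (simp add: mult.commute)
  \<comment> \<open>Indexing by the exponent turns the power maps into multiplication of k, so that
    both orders of composition lead to the exponent pp'.\<close>
  define g where "g k = mat 2 2 (\<lambda>(i, j). if i \<noteq> j then 0 else if i = 0 then a ^ k else d ^ k)" for k :: nat
  have gc: "g 1 \<in> carrier_mat n n" by (simp add: g_def n)
  have a1: "mps_nth a {#} = 1" using x1 by (simp add: a_def)
  have "mps_nth d {#} = 1" using arg_cong[OF ad, of "\<lambda>f. mps_nth f {#}"] a1 by (simp add: mps_nth_1)
  then have g1: "const_term (g 1) = 1\<^sub>m n"
    unfolding n by (intro eq_mat_2) (auto simp: g_def a1)
  define e where "e = eval_at n (g 1)"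
  note e = eval_at[OF Rs gc g1, folded e_def]
  have image: "chern_image q r (g k) (g (k * r))" if "odd r" for r k
    unfolding q g_def by (rule chern_image_diag_2[OF ad that])
  have gens_elem: "?x $$ (0, i) * ?x $$ (1, j) + ?x $$ (1, i) * ?x $$ (0, j) - const_mat q $$ (i, j) \<in> J"
    if ij: "i < 2" "j < 2" for i j
  proof -
    have x2: "?x \<in> carrier_mat 2 2" using generic_mat_carrier[of n] n by simp
    have Qc: "const_mat q \<in> carrier_mat 2 2" using P.q n by simp
    have "gens = transpose_mat ?x * (const_mat q * ?x) - const_mat q"
      using assoc_mult_mat[of "transpose_mat ?x" 2 2 "const_mat q" 2 ?x 2] x2 Qc by simp
    also have "transpose_mat ?x * (const_mat q * ?x) = mat 2 2 (\<lambda>(i, j). ?x $$ (0, i) * ?x $$ (1, j) + mps_const 1 * ?x $$ (1, i) * ?x $$ (0, j))"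
      unfolding q by (rule form_2[OF x2])
    finally have "gens $$ (i, j) = ?x $$ (0, i) * ?x $$ (1, j) + ?x $$ (1, i) * ?x $$ (0, j) - const_mat q $$ (i, j)"
      using ij Qc by simp
    moreover have "gens $$ (i, j) \<in> J"
    proof (rule subsetD[OF gens_J elements_matI[OF _ ij refl]])
      show "gens \<in> carrier_mat 2 2" using Qc by (rule minus_carrier_mat)
    qed
    ultimately show ?thesis by simp
  qed
  note Qi = hyperbolic_1_index[of 1, unfolded One_nat_def]
  have Qdim: "dim_row q = 2" "dim_col q = 2" using P.q n by auto
  have half: "mps_const (1 / 2) \<in> K" using P.half by auto
  have x10: "?x $$ (1, 0) \<in> J"
  proof -
    have "a * ?x $$ (1, 0) + ?x $$ (1, 0) * a \<in> J"
      using gens_elem[of 0 0] Qdim by (simp add: q Qi a_def)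
    then have "mps_const (1 / 2) * d * (a * ?x $$ (1, 0) + ?x $$ (1, 0) * a) \<in> J"
      by (rule J(4)) (intro P.approx.K.mult half dK)
    moreover have "mps_const (1 / 2) * d * (a * ?x $$ (1, 0) + ?x $$ (1, 0) * a)
        = (d * a) * (mps_const (1 / 2) * ?x $$ (1, 0) + mps_const (1 / 2) * ?x $$ (1, 0))"
      by (simp only: algebra_simps)
    ultimately show ?thesis unfolding d half_double by simp
  qed
  have x01: "?x $$ (0, 1) \<in> J"
  proof -
    let ?b = "?x $$ (1, 1)"
    have "?x $$ (0, 1) * ?b + ?b * ?x $$ (0, 1) \<in> J"
      using gens_elem[of 1 1] Qdim by (simp add: q Qi)
    then have "mps_const (1 / 2) * d' * (?x $$ (0, 1) * ?b + ?b * ?x $$ (0, 1)) \<in> J"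
      by (rule J(4)) (intro P.approx.K.mult half d'K)
    moreover have "mps_const (1 / 2) * d' * (?x $$ (0, 1) * ?b + ?b * ?x $$ (0, 1))
        = (d' * ?b) * (mps_const (1 / 2) * ?x $$ (0, 1) + mps_const (1 / 2) * ?x $$ (0, 1))"
      by (simp only: algebra_simps)
    ultimately show ?thesis unfolding d' half_double by simp
  qed
  have x11: "?x $$ (1, 1) - d \<in> J"
  proof -
    have 1: "a * ?x $$ (1, 1) + ?x $$ (1, 0) * ?x $$ (0, 1) - 1 \<in> J"
      using gens_elem[of 0 1] Qdim by (simp add: q Qi a_def)
    have 2: "- ?x $$ (1, 0) * ?x $$ (0, 1) \<in> J"
      by (rule J(4)[OF x01]) (use xin P.approx.K.uminus in auto)
    have "a * ?x $$ (1, 1) - 1 \<in> J" using J(3)[OF 1 2] by simp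
    then have "d * (a * ?x $$ (1, 1) - 1) \<in> J" by (rule J(4)) (rule dK)
    moreover have "d * (a * ?x $$ (1, 1) - 1) = (d * a) * ?x $$ (1, 1) - d" by (simp add: algebra_simps)
    ultimately show ?thesis unfolding d by simp
  qed
  have J_cong: "f - e f \<in> J" if f: "f \<in> K" for f
  proof -
    let ?\<tau> = "\<lambda>(i, j). if i < n \<and> j < n then g 1 $$ (i, j) - 1\<^sub>m n $$ (i, j) else 0"
    interpret s: substitution R id "vars n" ?\<tau> by (rule eval_at_substitution[OF Rs gc g1])
    have tau: "?\<tau> ij \<in> K" "mps_var ij - ?\<tau> ij \<in> J" if ijn: "ij \<in> vars n" for ij
    proof -
      obtain i j where ij: "ij = (i, j)" "i < 2" "j < 2" using ijn n by auto
      have eq: "mps_var ij - ?\<tau> ij = ?x $$ (i, j) - g 1 $$ (i, j)"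
        using generic_mat_index[of i n j] ij n by (simp add: algebra_simps)
      have "g 1 $$ (i, j) \<in> K" using ij aK dK by (auto simp: g_def)
      moreover have "1\<^sub>m n $$ (i, j) \<in> K" using P.approx.K.one P.approx.K.zero ij n by auto
      ultimately have "g 1 $$ (i, j) - 1\<^sub>m n $$ (i, j) \<in> K" by (rule P.approx.K.diff)
      then show "?\<tau> ij \<in> K" using ij n by simp
      consider "(i, j) = (0, 0)" | "(i, j) = (0, 1)" | "(i, j) = (1, 0)" | "(i, j) = (1, 1)"
        using ij by (auto simp: numeral_2_eq_2 less_Suc_eq)
      then show "mps_var ij - ?\<tau> ij \<in> J"
        unfolding eq using J(2) x01 x10 x11 by cases (auto simp: g_def a_def)
    qed
    have "\<exists>h. (\<forall>ij\<in>vars n. h ij \<in> K) \<and> f - mps_subst (vars n) id ?\<tau> f = (\<Sum>ij\<in>vars n. (mps_var ij - ?\<tau> ij) * h ij)"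
      by (rule substitution_difference[OF Rs s.fin f tau(1) s.t])
    then obtain h where h: "\<forall>ij\<in>vars n. h ij \<in> K"
      "f - mps_subst (vars n) id ?\<tau> f = (\<Sum>ij\<in>vars n. (mps_var ij - ?\<tau> ij) * h ij)"
      by (elim exE conjE)
    have "(mps_var ij - ?\<tau> ij) * h ij \<in> J" if "ij \<in> vars n" for ij
      using J(4)[OF tau(2)[OF that] bspec[OF h(1) that]] by (simp only: mult.commute)
    then have "(\<Sum>ij\<in>S. (mps_var ij - ?\<tau> ij) * h ij) \<in> J" if "S \<subseteq> vars n" for S
      using that
    proof (induction S rule: infinite_finite_induct)
      case (insert ij S)
      then show ?case using J(3)[of "(mps_var ij - ?\<tau> ij) * h ij"] by simp
    qed (auto simp: J(2))
    then show ?thesis unfolding e_def eval_at_def h(2) by simp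
  qed
  show ?thesis
  proof (rule so_curvature_zero[OF e(1) e(3) e(2) J_cong _ _ _ _ phi0 neq C])
    show "chern_image q p (g 1) (g (1 * p))" "chern_image q p' (g (1 * p)) (g (1 * p * p'))"
      "chern_image q p' (g 1) (g (1 * p'))"
      by (rule image[OF P.p(2)] image[OF P'.p(2)])+
    show "chern_image q p (g (1 * p')) (g (1 * p * p'))"
      using image[OF P.p(2), of "1 * p'"] by (simp add: mult.commute)
  qed
qed

text \<open>Extracts the data at one prime from the connection. Oddness of p follows from M being
  even and prime to p; separatedness is the integrality argument for the cyclotomic ring.\<close>

lemma chern_prime_exists:
  assumes "even M" "M > 0" "N \<ge> 1" "primitive_root N \<zeta>" and R: "R = carrier (cyclotomic_ring M \<zeta>)"
    and V: "\<forall>p\<in>V. prime p \<and> \<not> p dvd M * N" and q: "split_matrix n q"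
    and chern: "chern_connection (ring_on R) n q V \<delta>" and p: "p \<in> V"
  shows "\<exists>\<phi>\<^sub>0 W S. chern_prime n q R p \<phi>\<^sub>0 \<delta> W S"
proof -
  interpret R: class_subring R unfolding R carrier_cyclotomic_ring by (rule class_subring_generate)
  interpret q: split_form n q by (rule split_form_split_matrix[OF q])
  have pr: "prime p" "\<not> p dvd M" using V p by auto
  have "odd p"
  proof
    assume "even p"
    then have "p = 2" using pr(1) by (metis prime_nat_iff dvd_refl even_numeral numeral_eq_one_iff semiring_norm(85) two_is_prime_nat primes_dvd_imp_eq)
    then show False using pr(2) assms(1) by simp
  qed
  have deriv: "p_derivation (padic_completion (ring_on (coord R n)) p) p (\<delta> p)"
    using chern p unfolding chern_connection_def adelic_connection_def coordinate_ring_coord by blast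
  have hom: "hom_on R f" "\<And>x. x \<in> R \<Longrightarrow> f x \<in> R" if "lifts_frobenius (ring_on R) p f" for f
  proof -
    have f: "f \<in> Ring.ring_hom (ring_on R) (ring_on R)" using that by (simp add: lifts_frobenius_def)
    show "hom_on R f"
      using ring_hom_add[OF f] ring_hom_mult[OF f] ring_hom_one[OF f] by (simp add: hom_on_def)
    show "\<And>x. x \<in> R \<Longrightarrow> f x \<in> R" using ring_hom_closed[OF f] by simp
  qed
  have sep: "x = 0" if "x \<in> R" "\<And>k. \<exists>y\<in>R. x = of_nat p ^ k * y" for x
    using cyclotomic_separated[of \<zeta> N M p x] assms(2-4) pr that unfolding R primitive_root_def by blast
  have half: "1 / 2 \<in> R" unfolding R by (rule half_in_cyclotomic[OF assms(1,2)])
  show ?thesis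
    using chern p unfolding chern_connection_def coordinate_ring_coord Let_def
    apply -
    apply (elim conjE)
    apply (drule (1) bspec)
    apply (elim exE conjE)
    apply (intro exI chern_prime.intro q.split_form_axioms R.class_subring_axioms chern_prime_axioms.intro)
    apply (use half pr(1) \<open>odd p\<close> sep deriv hom in \<open>assumption | blast\<close>)+
    done
qed

theorem theorem3p4:
  fixes M N n :: nat and \<zeta> :: complex and A :: "complex ring" and V :: "nat set"
    and q :: "complex mat" and \<delta> :: connection
  assumes "even M" and "M > 0" and "N \<ge> 1"
    and "primitive_root N \<zeta>"
    and "A = cyclotomic_ring M \<zeta>"
    and "\<forall>p\<in>V. prime p \<and> \<not> p dvd M * N"
    and "q \<in> general_linear A n" and "split_matrix n q"
    and "chern_connection A n q V \<delta>"
  shows "(n \<ge> 6 \<longrightarrow> (\<forall>p\<in>V. \<forall>p'\<in>V. p \<noteq> p' \<longrightarrow>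
            (\<exists>C\<in>carrier (power_series_ring A n Quot orthogonal_ideal A n q).
               so_curvature A n q \<delta> p p' C
                 \<noteq> \<zero>\<^bsub>power_series_ring A n Quot orthogonal_ideal A n q\<^esub>)))
       \<and> (n = 2 \<longrightarrow> (\<forall>p\<in>V. \<forall>p'\<in>V.
            (\<forall>C\<in>carrier (power_series_ring A n Quot orthogonal_ideal A n q).
               so_curvature A n q \<delta> p p' C
                 = \<zero>\<^bsub>power_series_ring A n Quot orthogonal_ideal A n q\<^esub>)))"
proof -
  define R where "R = carrier (cyclotomic_ring M \<zeta>)"
  have A: "A = ring_on R" unfolding assms(5) R_def by (rule cyclotomic_ring_eq)
  note ex = chern_prime_exists[OF assms(1-4) R_def assms(6,8) assms(9)[unfolded A]]
  show ?thesis
    unfolding A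
  proof (intro conjI impI ballI)
    fix p p' assume n: "n \<ge> 6" and pp: "p \<in> V" "p' \<in> V" "p \<noteq> p'"
    obtain \<phi>\<^sub>0 W S where P: "chern_prime n q R p \<phi>\<^sub>0 \<delta> W S" using ex[OF pp(1)] by blast
    obtain \<phi>\<^sub>0' W' S' where P': "chern_prime n q R p' \<phi>\<^sub>0' \<delta> W' S'" using ex[OF pp(2)] by blast
    interpret chern_primes n q R \<delta> p \<phi>\<^sub>0 W S p' \<phi>\<^sub>0' W' S' by (rule chern_primes.intro[OF P P'])
    have p3: "r \<ge> 3" if "prime r" "odd r" for r :: nat
      using prime_ge_2_nat[OF that(1)] that(2) by (cases "r = 2") auto
    obtain g G G' H H' :: "series mat" where g: "g \<in> carrier_mat n n" "const_term g = 1\<^sub>m n"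
      and orth: "transpose_mat g * (const_mat q * g) = const_mat q"
      and i: "chern_image q p g G" "chern_image q p' G G'" "chern_image q p' g H" "chern_image q p H H'" and neq: "G' \<noteq> H'"
      using noncommuting_split[OF assms(8) n P.p(2) p3[OF P.p] P'.p(2) p3[OF P'.p] pp(3)]
      unfolding noncommuting_def by blast
    note e = eval_at[OF P.R.class_subring_axioms g]
    show "\<exists>C\<in>carrier (power_series_ring (ring_on R) n Quot orthogonal_ideal (ring_on R) n q).
        so_curvature (ring_on R) n q \<delta> p p' C \<noteq> \<zero>\<^bsub>power_series_ring (ring_on R) n Quot orthogonal_ideal (ring_on R) n q\<^esub>"
      by (rule so_curvature_nonzero[OF e(1,3) orth i neq])
  next
    fix p p' C assume n: "n = 2" and pp: "p \<in> V" "p' \<in> V"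
      and C: "C \<in> carrier (power_series_ring (ring_on R) n Quot orthogonal_ideal (ring_on R) n q)"
    obtain \<phi>\<^sub>0 W S where P: "chern_prime n q R p \<phi>\<^sub>0 \<delta> W S" using ex[OF pp(1)] by blast
    obtain \<phi>\<^sub>0' W' S' where P': "chern_prime n q R p' \<phi>\<^sub>0' \<delta> W' S'" using ex[OF pp(2)] by blast
    show "so_curvature (ring_on R) n q \<delta> p p' C = \<zero>\<^bsub>power_series_ring (ring_on R) n Quot orthogonal_ideal (ring_on R) n q\<^esub>"
    proof (cases "p = p'")
      case True
      then show ?thesis using so_curvature_same_prime[OF chern_primes.intro[OF P P] C] by simp
    next
      case neq: False
      interpret chern_primes n q R \<delta> p \<phi>\<^sub>0 W S p' \<phi>\<^sub>0' W' S' by (rule chern_primes.intro[OF P P'])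
      \<comment> \<open>The lifts act on constants through \<phi>\<open>\<^sub>0\<close> and
        \<phi>\<open>\<^sub>0'\<close>, so agreement of the two composites on x is not enough: these
        endomorphisms of A must commute as well.\<close>
      have comm: "\<phi>\<^sub>0 (\<phi>\<^sub>0' c) = \<phi>\<^sub>0' (\<phi>\<^sub>0 c)" if "c \<in> R" for c
        by (rule cyclotomic_homs_commute[OF assms(3,4,2) R_def P.phi0 P'.phi0 that])
      from assms(8) show ?thesis
      proof (cases rule: split_matrix_cases)
        case (1 r \<epsilon>)
        then have "r = 1" using n by simp
        then have "q = hyperbolic 1 1 \<or> q = hyperbolic (- 1) 1" using 1 by auto
        then show ?thesis
          using so_curvature_zero_symmetric[OF n _ comm neq C] so_curvature_zero_symplectic[OF n _ comm neq C] by blast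
      next
        case (2 r)
        then show ?thesis using n by presburger
      qed
    qed
  qed
qed

end
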